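(* Let $d\ge1$. Suppose that the constant mean curvature $d+1$ problem for time-like hypersurfaces of $\mathbb{R}^{1,d+1}$, as a perturbation of $\mathcal{M}_{\mathrm{dS}}$, has small data global existence. Then there exist hypersurfaces of constant mean curvature $d+1$ which are not eventually tangent to a light cone. More precisely, fix an initial time $t_0>0$; then there exists a hypersurface $M$ of constant mean curvature $d+1$, which can be chosen to be arbitrarily close to $\mathcal{M}_{\mathrm{dS}}$ at time $t_0$, such that for every $(\tau_0,\xi_0)\in\mathbb{R}^{1,1+d}$ we have $$\lim_{t\to\infty}\ \sup_{(t,x)\in M}\Big|\,|x-\xi_0|-t+\tau_0\,\Big|>0 ,$$ where for each $t$ the supremum is over all $x\in\mathbb{R}^{d+1}$ with $(t,x)\in M$.
   Context: $\mathbb{R}^{1,d+1}$ is Minkowski space with coordinates $(t,x)$, and $\mathcal{M}_{\mathrm{dS}}=\{(t,x):-t^2+|x|^2=1\}$, a time-like hypersurface of constant mean curvature $d+1$. Mean curvature is the trace of the second fundamental form with respect to the inward unit normal. "Small data global existence" means: for initial data prescribed at time $t_0$ (position and time-like tangent direction of the hypersurface along a space-like $d$-sphere) that are sufficiently close to the data induced by $\mathcal{M}_{\mathrm{dS}}$ in a suitable (Sobolev or $C^k$) topology, the Cauchy problem for time-like hypersurfaces of constant mean curvature $d+1$ has a solution existing for all future time. *)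

theory Defs
  imports "HOL-Analysis.Analysis"
begin

text \<open>
  Minkowski space R^{1,d+1} is the type \<open>real \<times> 'a\<close> with \<open>'a\<close> a Euclidean space of dimension d + 1;
  a point is written (t, x). Abstract d-spheres are parametrised by the unit sphere of \<open>'a\<close>.
\<close>

definition mink :: "real \<times> 'a::euclidean_space \<Rightarrow> real \<times> 'a \<Rightarrow> real" where
  "mink u w = - (fst u * fst w) + snd u \<bullet> snd w"

definition timelike :: "real \<times> 'a::euclidean_space \<Rightarrow> bool" where
  "timelike u \<longleftrightarrow> mink u u < 0"

definition de_Sitter :: "(real \<times> 'a::euclidean_space) set" where
  "de_Sitter = {(t, x). - (t\<^sup>2) + (norm x)\<^sup>2 = 1}"


subsection \<open>Smooth maps\<close>

fun iter_deriv :: "'v::real_normed_vector list \<Rightarrow> ('v \<Rightarrow> 'w::real_normed_vector) \<Rightarrow> 'v \<Rightarrow> 'w" where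
  "iter_deriv [] f = f"
| "iter_deriv (v # vs) f = (\<lambda>x. frechet_derivative (iter_deriv vs f) (at x) v)"

text \<open>To be used for open \<open>S\<close>, where this is smoothness in the sense of class C-infinity.\<close>

definition smooth_on :: "'v::real_normed_vector set \<Rightarrow> ('v \<Rightarrow> 'w::real_normed_vector) \<Rightarrow> bool" where
  "smooth_on S f \<longleftrightarrow> (\<forall>vs. \<forall>x\<in>S. iter_deriv vs f differentiable (at x))"

text \<open>
  A map on the unit sphere is differentiated through its extension to the punctured space that is
  constant along rays, \<open>\<lambda>x. f (sgn x)\<close> where \<open>sgn x = x / |x|\<close>. The differential of this extension
  at a point \<open>\<omega>\<close> of the sphere vanishes on the normal direction \<open>\<omega>\<close> and is the intrinsic
  differential on the tangent directions, so that its range is the image of the tangent space.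
\<close>

definition radial_ext :: "('a::euclidean_space \<Rightarrow> 'w::real_normed_vector) \<Rightarrow> 'a \<Rightarrow> 'w" where
  "radial_ext f = (\<lambda>x. f (sgn x))"

definition smooth_on_sphere :: "('a::euclidean_space \<Rightarrow> 'w::real_normed_vector) \<Rightarrow> bool" where
  "smooth_on_sphere f \<longleftrightarrow> smooth_on (- {0}) (radial_ext f)"

text \<open>\<open>f\<close> and \<open>g\<close> are \<open>\<epsilon>\<close>-close in the C^k topology of the unit sphere.\<close>

definition Ck_close :: "nat \<Rightarrow> real \<Rightarrow> ('a::euclidean_space \<Rightarrow> 'w::real_normed_vector)
    \<Rightarrow> ('a \<Rightarrow> 'w) \<Rightarrow> bool" where
  "Ck_close k \<epsilon> f g \<longleftrightarrow>
     (\<forall>vs. set vs \<subseteq> Basis \<and> length vs \<le> k \<longrightarrow>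
        (\<forall>\<omega>\<in>sphere 0 1. norm (iter_deriv vs (radial_ext (\<lambda>\<omega>. f \<omega> - g \<omega>)) \<omega>) < \<epsilon>))"


subsection \<open>Time-like hypersurfaces and their mean curvature\<close>

text \<open>
  A hypersurface evolving from a d-sphere at time \<open>t\<^sub>0\<close> is described by the map
  \<open>(t, \<omega>) \<mapsto> (t, \<phi> t \<omega>)\<close> for \<open>t \<ge> t\<^sub>0\<close> and \<open>\<omega>\<close> in the unit sphere. As \<open>t\<close> has no
  critical points on a time-like hypersurface, this is a choice of parametrisation only;
  the curves \<open>\<omega> = const\<close> are not assumed to be time-like.
\<close>

definition param :: "(real \<Rightarrow> 'a::euclidean_space \<Rightarrow> 'a) \<Rightarrow> real \<times> 'a \<Rightarrow> real \<times> 'a" where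
  "param \<phi> = (\<lambda>(t, x). (t, \<phi> t (sgn x)))"

definition hypersurface_of :: "real \<Rightarrow> (real \<Rightarrow> 'a::euclidean_space \<Rightarrow> 'a) \<Rightarrow> (real \<times> 'a) set" where
  "hypersurface_of t\<^sub>0 \<phi> = {(t, \<phi> t \<omega>) |t \<omega>. t\<^sub>0 \<le> t \<and> \<omega> \<in> sphere 0 1}"

definition tangent_space ::
    "(real \<Rightarrow> 'a::euclidean_space \<Rightarrow> 'a) \<Rightarrow> real \<Rightarrow> 'a \<Rightarrow> (real \<times> 'a) set" where
  "tangent_space \<phi> t \<omega> = range (frechet_derivative (param \<phi>) (at (t, \<omega>)))"

text \<open>
  Smoothness up to the boundary \<open>t = t\<^sub>0\<close> means that there is a smooth extension to slightly
  earlier times (part of the total function \<open>\<phi>\<close>); no other condition is imposed before \<open>t\<^sub>0\<close>.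
  The hypersurface is embedded, and its induced metric is Lorentzian, i.e. every tangent space
  is a hyperplane containing a time-like vector.
\<close>

definition timelike_embedding :: "real \<Rightarrow> (real \<Rightarrow> 'a::euclidean_space \<Rightarrow> 'a) \<Rightarrow> bool" where
  "timelike_embedding t\<^sub>0 \<phi> \<longleftrightarrow>
     (\<exists>t\<^sub>1 < t\<^sub>0. smooth_on ({t\<^sub>1<..} \<times> (- {0})) (param \<phi>)) \<and>
     (\<forall>t\<ge>t\<^sub>0. inj_on (\<phi> t) (sphere 0 1)) \<and>
     (\<forall>t\<ge>t\<^sub>0. \<forall>\<omega>\<in>sphere 0 1.
        dim (tangent_space \<phi> t \<omega>) = DIM('a) \<and> (\<exists>u\<in>tangent_space \<phi> t \<omega>. timelike u))"

text \<open>
  The spatial part of a normal vector is a non-zero normal of the time slice within \<open>'a\<close>;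
  inward means that it points into the bounded component of the complement of that slice.
\<close>

definition inward_unit_normal ::
    "(real \<Rightarrow> 'a::euclidean_space \<Rightarrow> 'a) \<Rightarrow> real \<Rightarrow> 'a \<Rightarrow> real \<times> 'a \<Rightarrow> bool" where
  "inward_unit_normal \<phi> t \<omega> n \<longleftrightarrow>
     (\<forall>u\<in>tangent_space \<phi> t \<omega>. mink u n = 0) \<and> mink n n = 1 \<and>
     (\<forall>\<^sub>F s in at_right 0. \<phi> t \<omega> + s *\<^sub>R snd n \<in> inside (\<phi> t ` sphere 0 1))"

text \<open>
  The tangent space at \<open>(t, \<omega>)\<close> of the parameter domain, and the two fundamental forms as bilinear
  forms on it: \<open>g(\<xi>,\<eta>) = \<langle>\<partial>\<^sub>\<xi>\<Phi>, \<partial>\<^sub>\<eta>\<Phi>\<rangle>\<close> and \<open>h(\<xi>,\<eta>) = \<langle>\<partial>\<^sub>\<xi>\<partial>\<^sub>\<eta>\<Phi>, n\<rangle>\<close> with \<open>\<Phi> = param \<phi>\<close>.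
  The second one does not depend on the extension of \<open>\<Phi>\<close> off the sphere, because another extension
  changes \<open>\<partial>\<^sub>\<xi>\<partial>\<^sub>\<eta>\<Phi>\<close> by a tangential vector.
\<close>

definition domain_tangent :: "'a::euclidean_space \<Rightarrow> (real \<times> 'a) set" where
  "domain_tangent \<omega> = {(s, \<eta>). \<eta> \<bullet> \<omega> = 0}"

definition first_form :: "(real \<Rightarrow> 'a::euclidean_space \<Rightarrow> 'a) \<Rightarrow> real \<Rightarrow> 'a
    \<Rightarrow> real \<times> 'a \<Rightarrow> real \<times> 'a \<Rightarrow> real" where
  "first_form \<phi> t \<omega> \<xi> \<eta> =
     mink (iter_deriv [\<xi>] (param \<phi>) (t, \<omega>)) (iter_deriv [\<eta>] (param \<phi>) (t, \<omega>))"

definition second_form :: "(real \<Rightarrow> 'a::euclidean_space \<Rightarrow> 'a) \<Rightarrow> real \<Rightarrow> 'a \<Rightarrow> real \<times> 'a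
    \<Rightarrow> real \<times> 'a \<Rightarrow> real \<times> 'a \<Rightarrow> real" where
  "second_form \<phi> t \<omega> n \<xi> \<eta> = mink (iter_deriv [\<xi>, \<eta>] (param \<phi>) (t, \<omega>)) n"

text \<open>
  \<open>r\<close> is the trace on the subspace \<open>V\<close> of the bilinear form \<open>h\<close> with respect to the non-degenerate
  symmetric form \<open>g\<close>, computed in a \<open>g\<close>-orthogonal basis (its value is independent of the basis).
\<close>

definition has_metric_trace :: "'v::real_vector set \<Rightarrow> ('v \<Rightarrow> 'v \<Rightarrow> real) \<Rightarrow> ('v \<Rightarrow> 'v \<Rightarrow> real)
    \<Rightarrow> real \<Rightarrow> bool" where
  "has_metric_trace V g h r \<longleftrightarrow>
     (\<exists>B. finite B \<and> independent B \<and> span B = V \<and>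
        pairwise (\<lambda>b c. g b c = 0) B \<and> (\<forall>b\<in>B. g b b \<noteq> 0) \<and>
        r = (\<Sum>b\<in>B. h b b / g b b))"

definition has_mean_curvature ::
    "(real \<Rightarrow> 'a::euclidean_space \<Rightarrow> 'a) \<Rightarrow> real \<Rightarrow> 'a \<Rightarrow> real \<Rightarrow> bool" where
  "has_mean_curvature \<phi> t \<omega> H \<longleftrightarrow>
     (\<exists>n. inward_unit_normal \<phi> t \<omega> n \<and>
        has_metric_trace (domain_tangent \<omega>) (first_form \<phi> t \<omega>) (second_form \<phi> t \<omega> n) H)"


subsection \<open>The Cauchy problem\<close>

text \<open>
  Initial data along a space-like d-sphere in \<open>{t = t\<^sub>0}\<close>: the embedding \<open>X\<close> of the sphere, and a
  time-like direction, normalised to have time component 1, i.e. \<open>(1, v \<omega>)\<close>.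
\<close>

definition initial_data :: "('a::euclidean_space \<Rightarrow> 'a) \<Rightarrow> ('a \<Rightarrow> 'a) \<Rightarrow> bool" where
  "initial_data X v \<longleftrightarrow>
     smooth_on_sphere X \<and> inj_on X (sphere 0 1) \<and>
     (\<forall>\<omega>\<in>sphere 0 1. dim (range (frechet_derivative (radial_ext X) (at \<omega>))) = DIM('a) - 1) \<and>
     smooth_on_sphere v \<and> (\<forall>\<omega>\<in>sphere 0 1. timelike (1, v \<omega>))"

text \<open>
  \<open>M\<close> is a solution, for all times \<open>t \<ge> t\<^sub>0\<close>, of the Cauchy problem for time-like hypersurfaces of
  constant mean curvature \<open>H\<close>: it contains the initial sphere and is tangent there to the
  prescribed directions.
\<close>

definition global_cmc_solution ::
    "real \<Rightarrow> real \<Rightarrow> ('a::euclidean_space \<Rightarrow> 'a) \<Rightarrow> ('a \<Rightarrow> 'a) \<Rightarrow> (real \<times> 'a) set \<Rightarrow> bool" where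
  "global_cmc_solution H t\<^sub>0 X v M \<longleftrightarrow>
     (\<exists>\<phi>. timelike_embedding t\<^sub>0 \<phi> \<and> M = hypersurface_of t\<^sub>0 \<phi> \<and>
        (\<forall>t\<ge>t\<^sub>0. \<forall>\<omega>\<in>sphere 0 1. has_mean_curvature \<phi> t \<omega> H) \<and>
        (\<forall>\<omega>\<in>sphere 0 1. \<phi> t\<^sub>0 \<omega> = X \<omega> \<and> (1, v \<omega>) \<in> tangent_space \<phi> t\<^sub>0 \<omega>))"

text \<open>The data induced by \<open>de_Sitter\<close> at time \<open>t\<^sub>0\<close>.\<close>

definition dS_position :: "real \<Rightarrow> 'a::euclidean_space \<Rightarrow> 'a" where
  "dS_position t \<omega> = sqrt (1 + t\<^sup>2) *\<^sub>R \<omega>"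

definition dS_velocity :: "real \<Rightarrow> 'a::euclidean_space \<Rightarrow> 'a" where
  "dS_velocity t \<omega> = (t / sqrt (1 + t\<^sup>2)) *\<^sub>R \<omega>"

lemma de_Sitter_eq: "de_Sitter = {(t, dS_position t \<omega>) |t \<omega>. \<omega> \<in> sphere 0 1}"
proof -
  have pos: "1 + t\<^sup>2 > 0" for t :: real
    by (simp add: add_pos_nonneg)
  have "\<exists>\<omega>\<in>sphere 0 1. x = dS_position t \<omega>" if "- (t\<^sup>2) + (norm x)\<^sup>2 = 1" for t and x :: 'a
  proof -
    have "norm x = sqrt (1 + t\<^sup>2)"
      using that by (intro real_sqrt_unique [symmetric]) auto
    with pos [of t] show ?thesis
      by (intro bexI [of _ "x /\<^sub>R sqrt (1 + t\<^sup>2)"]) (auto simp: dS_position_def)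
  qed
  moreover have "- (t\<^sup>2) + (norm (dS_position t \<omega>))\<^sup>2 = 1" if "\<omega> \<in> sphere 0 1" for t and \<omega> :: 'a
    using that pos [of t] by (simp add: dS_position_def)
  ultimately show ?thesis
    by (fastforce simp: de_Sitter_def)
qed

lemma dS_velocity_derivative:
  "((\<lambda>t. dS_position t \<omega>) has_vector_derivative dS_velocity t \<omega>) (at t)"
proof -
  have "1 + t\<^sup>2 > 0"
    by (simp add: add_pos_nonneg)
  then have "((\<lambda>t. sqrt (1 + t\<^sup>2)) has_real_derivative t / sqrt (1 + t\<^sup>2)) (at t)"
    by (auto intro!: derivative_eq_intros simp: field_simps)
  from has_vector_derivative_scaleR [OF this has_vector_derivative_const [of \<omega>]]
  show ?thesis
    by (simp add: dS_position_def dS_velocity_def)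
qed

definition close_to_dS :: "nat \<Rightarrow> real \<Rightarrow> real \<Rightarrow> ('a::euclidean_space \<Rightarrow> 'a) \<Rightarrow> ('a \<Rightarrow> 'a) \<Rightarrow> bool" where
  "close_to_dS k \<epsilon> t\<^sub>0 X v \<longleftrightarrow>
     Ck_close k \<epsilon> X (dS_position t\<^sub>0) \<and> Ck_close k \<epsilon> v (dS_velocity t\<^sub>0)"

text \<open>
  Small data global existence at time \<open>t\<^sub>0\<close> in the C^k topology. Since C^k balls are contained in
  Sobolev balls for large \<open>k\<close>, global existence for Sobolev-small data is covered as well.
\<close>

definition small_data_global_existence ::
    "'a::euclidean_space itself \<Rightarrow> real \<Rightarrow> nat \<Rightarrow> real \<Rightarrow> bool" where
  "small_data_global_existence _ H k t\<^sub>0 \<longleftrightarrow>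
     (\<exists>\<epsilon>>0. \<forall>X v :: 'a \<Rightarrow> 'a. initial_data X v \<longrightarrow> close_to_dS k \<epsilon> t\<^sub>0 X v \<longrightarrow>
        (\<exists>M. global_cmc_solution H t\<^sub>0 X v M))"

end

theory Submission
  imports Defs "HOL-Real_Asymp.Real_Asymp"
begin

text \<open>
  Information on a time-like hypersurface travels no faster than light, and the de Sitter hyperboloid
  has horizons: its generator in the direction \<open>e\<close>, the curve of points \<open>(t, sqrt (1 + t\<^sup>2) e)\<close>, is
  at all later times determined by the data on the cap \<open>x \<bullet> e > t\<^sub>0\<close> of the initial sphere, which for
  \<open>t\<^sub>0 > 0\<close> is smaller than a half-sphere. Opposite caps can therefore be given unrelated data. Take
  those of the hyperboloid around \<open>e\<close> and those of its translate by a small time \<open>\<tau>\<close> around \<open>- e\<close>,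
  interpolated smoothly in between. The solution then contains the generators of the hyperboloid in
  all directions near \<open>e\<close>, so that a light cone to which it is asymptotic must have its apex at the
  origin; but it also contains a generator of the translate, whose asymptotic cone passes at distance
  \<open>\<tau>\<close> from that one in the direction \<open>- e\<close>. The limit in the theorem exists because \<open>|x - \<xi>| - t\<close> does
  not increase along causal curves of the hypersurface (\<open>cone_distance_converges\<close>).

  The assumption provides solutions but says nothing about their uniqueness, so the determination of
  the generators has to be proved (\<open>generator_in_hypersurface\<close>). Let \<open>\<Phi>\<close> be the position on the
  hypersurface and \<open>n\<close> its inward unit normal. The deviation \<open>V = n + \<Phi> - P\<close> vanishes precisely where
  the hypersurface agrees to first order with the hyperboloid of centre \<open>P\<close>. The differential of
  \<open>V\<close> is the sum of the identity and the differential of \<open>n\<close>, hence symmetric, and trace-free because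
  the mean curvature is that of the hyperboloid. For the energy-momentum current
  \<open>J = \<langle>V, \<partial>\<^sub>t\<rangle> V - \<langle>V, V\<rangle> \<partial>\<^sub>t / 2\<close> this means that the tangential trace of the differential of
  \<open>J\<close> is zero (\<open>frame.divg_flux\<close>), so the divergence of its tangential part is quadratic in \<open>V\<close>.
  By the dominant energy condition \<open>J\<close> has non-negative flux through the sections of the hypersurface
  by time slices and by null hyperplanes, which are nowhere time-like. The energy estimate \<open>cmc_hypersurface.deviation_eq_0\<close> concludes that \<open>V\<close> vanishes beyond
  the null hyperplane through \<open>P\<close> with normal \<open>(1, e)\<close> if it does so at the initial time. As \<open>V\<close> and
  \<open>J\<close> are vectors of Minkowski space, no choice of coordinates or gauge enters; the integration is
  over the parameters \<open>(t, x)\<close> with \<open>x\<close> in an annulus, along whose rays everything is constant.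
\<close>

section \<open>Continuously differentiable maps\<close>

text \<open>Continuity of each directional derivative suffices here: in finite dimensions it is the continuity
  of the differential, without reference to a normed space of linear maps.\<close>

definition C1_on :: "'v::real_normed_vector set \<Rightarrow> ('v \<Rightarrow> 'w::real_normed_vector) \<Rightarrow> bool" where
  "C1_on U f \<longleftrightarrow> (\<forall>p\<in>U. f differentiable (at p)) \<and>
     (\<forall>v. continuous_on U (\<lambda>p. frechet_derivative f (at p) v))"

lemma C1_onI:
  assumes "\<And>p. p \<in> U \<Longrightarrow> (f has_derivative f' p) (at p)" and "\<And>v. continuous_on U (\<lambda>p. f' p v)"
  shows "C1_on U f"
proof -
  have eq: "frechet_derivative f (at p) = f' p" if "p \<in> U" for p
    using frechet_derivative_at [OF assms(1) [OF that]] by simp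
  have "continuous_on U (\<lambda>p. frechet_derivative f (at p) v)" for v
    using assms(2) [of v] by (rule continuous_on_eq) (simp add: eq)
  then show ?thesis
    using assms(1) by (auto simp: C1_on_def differentiable_def)
qed

lemma C1_on_has_derivative:
  "C1_on U f \<Longrightarrow> p \<in> U \<Longrightarrow> (f has_derivative frechet_derivative f (at p)) (at p)"
  using frechet_derivative_works C1_on_def by blast

lemma C1_on_continuous_derivative:
  "C1_on U f \<Longrightarrow> continuous_on U (\<lambda>p. frechet_derivative f (at p) v)"
  by (simp add: C1_on_def)

lemma C1_on_linear_derivative:
  "C1_on U f \<Longrightarrow> p \<in> U \<Longrightarrow> linear (frechet_derivative f (at p))"
  using C1_on_has_derivative has_derivative_linear by blast

lemma C1_on_imp_continuous_on: "C1_on U f \<Longrightarrow> continuous_on U f"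
  by (auto simp: C1_on_def intro!: continuous_at_imp_continuous_on
      dest: differentiable_imp_continuous_within)

lemma C1_on_subset: "C1_on U f \<Longrightarrow> V \<subseteq> U \<Longrightarrow> C1_on V f"
  by (auto simp: C1_on_def intro: continuous_on_subset)

lemma C1_on_cong:
  assumes "open U" "\<And>p. p \<in> U \<Longrightarrow> f p = g p" "C1_on U f"
  shows "C1_on U g"
proof (rule C1_onI)
  show "(g has_derivative frechet_derivative f (at p)) (at p)" if "p \<in> U" for p
    using has_derivative_transform_within_open [OF C1_on_has_derivative [OF assms(3) that] assms(1) that]
      assms(2) by simp
qed (use assms C1_on_continuous_derivative in auto)

lemma C1_on_locally:
  assumes "\<And>p. p \<in> U \<Longrightarrow> \<exists>W. open W \<and> p \<in> W \<and> C1_on W f"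
  shows "C1_on U f"
  unfolding C1_on_def
proof (intro conjI ballI allI)
  fix p assume "p \<in> U"
  with assms show "f differentiable (at p)"
    by (auto simp: C1_on_def)
next
  fix v
  have "isCont (\<lambda>p. frechet_derivative f (at p) v) p" if p: "p \<in> U" for p
  proof -
    obtain W where W: "open W" "p \<in> W" "C1_on W f"
      using assms [OF p] by blast
    have "continuous_on W (\<lambda>p. frechet_derivative f (at p) v)"
      using W(3) by (rule C1_on_continuous_derivative)
    with W show ?thesis
      by (simp add: continuous_on_eq_continuous_at)
  qed
  then show "continuous_on U (\<lambda>p. frechet_derivative f (at p) v)"
    by (simp add: continuous_at_imp_continuous_on)
qed

lemma C1_on_const: "C1_on U (\<lambda>p. c)"
  by (rule C1_onI [where f' = "\<lambda>p v. 0"]) auto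

lemma C1_on_bounded_linear:
  assumes "bounded_linear L" shows "C1_on U L"
  by (rule C1_onI [where f' = "\<lambda>p. L"]) (auto intro: bounded_linear_imp_has_derivative assms)

lemma C1_on_bounded_linear_compose:
  assumes L: "bounded_linear L" and f: "C1_on U f" shows "C1_on U (\<lambda>p. L (f p))"
proof (rule C1_onI)
  show "((\<lambda>p. L (f p)) has_derivative (\<lambda>v. L (frechet_derivative f (at p) v))) (at p)" if "p \<in> U" for p
    by (rule bounded_linear.has_derivative [OF L C1_on_has_derivative [OF f that]])
  show "continuous_on U (\<lambda>p. L (frechet_derivative f (at p) v))" for v
    by (rule bounded_linear.continuous_on [OF L C1_on_continuous_derivative [OF f]])
qed

lemma C1_on_add:
  assumes f: "C1_on U f" and g: "C1_on U g" shows "C1_on U (\<lambda>p. f p + g p)"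
proof (rule C1_onI)
  show "((\<lambda>p. f p + g p) has_derivative
      (\<lambda>v. frechet_derivative f (at p) v + frechet_derivative g (at p) v)) (at p)" if "p \<in> U" for p
    by (intro has_derivative_add C1_on_has_derivative [OF f that] C1_on_has_derivative [OF g that])
qed (intro continuous_on_add C1_on_continuous_derivative [OF f] C1_on_continuous_derivative [OF g])

lemma (in bounded_bilinear) C1_on_prod:
  assumes f: "C1_on U f" and g: "C1_on U g" shows "C1_on U (\<lambda>p. prod (f p) (g p))"
proof (rule C1_onI)
  show "((\<lambda>p. prod (f p) (g p)) has_derivative (\<lambda>v. prod (f p) (frechet_derivative g (at p) v) +
      prod (frechet_derivative f (at p) v) (g p))) (at p)" if "p \<in> U" for p
    by (intro FDERIV C1_on_has_derivative [OF f that] C1_on_has_derivative [OF g that])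
qed (intro continuous_on_add continuous_on C1_on_imp_continuous_on f g
    C1_on_continuous_derivative [OF f] C1_on_continuous_derivative [OF g])

lemmas C1_on_scaleR = bounded_bilinear.C1_on_prod [OF bounded_bilinear_scaleR]
lemmas C1_on_mult = bounded_bilinear.C1_on_prod [OF bounded_bilinear_mult]
lemmas C1_on_inner = bounded_bilinear.C1_on_prod [OF bounded_bilinear_inner]

lemma C1_on_scaleR_const: "C1_on U f \<Longrightarrow> C1_on U (\<lambda>p. c *\<^sub>R f p)"
  by (rule C1_on_scaleR [OF C1_on_const])

lemma C1_on_minus: "C1_on U f \<Longrightarrow> C1_on U (\<lambda>p. - f p)"
  using C1_on_scaleR_const [of U f "-1"] by simp

lemma C1_on_diff: "C1_on U f \<Longrightarrow> C1_on U g \<Longrightarrow> C1_on U (\<lambda>p. f p - g p)"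
  using C1_on_add [of U f "\<lambda>p. - g p"] C1_on_minus [of U g] by simp

lemma C1_on_sum:
  assumes "\<And>i. i \<in> I \<Longrightarrow> C1_on U (f i)" shows "C1_on U (\<lambda>p. \<Sum>i\<in>I. f i p)"
  using assms by (induction I rule: infinite_finite_induct) (auto intro: C1_on_const C1_on_add)

lemma C1_on_compose_real:
  fixes f :: "'v::real_normed_vector \<Rightarrow> real"
  assumes f: "C1_on U f" and h: "\<And>s. s \<in> f ` U \<Longrightarrow> (h has_real_derivative h' s) (at s)"
    and h': "continuous_on (f ` U) h'"
  shows "C1_on U (\<lambda>p. h (f p))"
proof (rule C1_onI)
  show "((\<lambda>p. h (f p)) has_derivative (\<lambda>v. frechet_derivative f (at p) v * h' (f p))) (at p)"
    if "p \<in> U" for p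
    using has_derivative_compose [OF C1_on_has_derivative [OF f that]
        has_field_derivative_imp_has_derivative [OF h]] that
    by (simp add: mult.commute)
  show "continuous_on U (\<lambda>p. frechet_derivative f (at p) v * h' (f p))" for v
    by (intro continuous_on_mult C1_on_continuous_derivative [OF f]
        continuous_on_compose2 [OF h' C1_on_imp_continuous_on [OF f]]) auto
qed

lemma bounded_bilinear_mink: "bounded_bilinear (mink :: real \<times> 'a::euclidean_space \<Rightarrow> _)"
proof -
  define flip where "flip = (\<lambda>w :: real \<times> 'a. (- fst w, snd w))"
  have "bounded_linear flip"
    unfolding flip_def
    by (intro bounded_linear_Pair bounded_linear_minus bounded_linear_fst bounded_linear_snd)
  then have "bounded_bilinear (\<lambda>u w. u \<bullet> flip w)"
    by (rule bounded_bilinear.comp [OF bounded_bilinear_inner bounded_linear_ident])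
  moreover have "(mink :: real \<times> 'a \<Rightarrow> _) = (\<lambda>u w. u \<bullet> flip w)"
    by (auto simp: mink_def flip_def inner_prod_def fun_eq_iff)
  ultimately show ?thesis by simp
qed

lemmas C1_on_mink = bounded_bilinear.C1_on_prod [OF bounded_bilinear_mink]
lemmas mink_add_left = bounded_bilinear.add_left [OF bounded_bilinear_mink]
lemmas mink_add_right = bounded_bilinear.add_right [OF bounded_bilinear_mink]
lemmas mink_diff_left = bounded_bilinear.diff_left [OF bounded_bilinear_mink]
lemmas mink_diff_right = bounded_bilinear.diff_right [OF bounded_bilinear_mink]
lemmas mink_minus_left = bounded_bilinear.minus_left [OF bounded_bilinear_mink]
lemmas mink_minus_right = bounded_bilinear.minus_right [OF bounded_bilinear_mink]
lemmas mink_scaleR_left = bounded_bilinear.scaleR_left [OF bounded_bilinear_mink]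
lemmas mink_scaleR_right = bounded_bilinear.scaleR_right [OF bounded_bilinear_mink]
lemmas mink_zero_left = bounded_bilinear.zero_left [OF bounded_bilinear_mink]
lemmas mink_zero_right = bounded_bilinear.zero_right [OF bounded_bilinear_mink]
lemmas mink_sum_left = bounded_bilinear.sum_left [OF bounded_bilinear_mink]
lemmas mink_sum_right = bounded_bilinear.sum_right [OF bounded_bilinear_mink]
lemmas mink_simps = mink_add_left mink_add_right mink_diff_left mink_diff_right mink_minus_left
  mink_minus_right mink_scaleR_left mink_scaleR_right mink_zero_left mink_zero_right

lemma mink_commute: "mink u w = mink w u"
  by (simp add: mink_def inner_commute)

lemma linear_mink_left: "linear (\<lambda>u. mink u w)"
  by (rule linearI) (simp_all add: mink_simps)

text \<open>The mean value theorem, used once in each direction, writes the second difference as \<open>h\<^sup>2\<close>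
  times a mixed derivative at a nearby point. As the second difference is symmetric in \<open>u\<close> and \<open>v\<close>,
  this yields the symmetry of second derivatives.\<close>

lemma second_difference_quotient:
  fixes f :: "'v::real_normed_vector \<Rightarrow> real"
  assumes U: "open U" "p \<in> U" and f: "C1_on U f"
    and fu: "C1_on U (\<lambda>q. frechet_derivative f (at q) u)"
    and e: "\<epsilon> > 0"
  shows "\<exists>\<delta>>0. \<forall>h. 0 < h \<and> h < \<delta> \<longrightarrow>
      \<bar>(f (p + h *\<^sub>R u + h *\<^sub>R v) - f (p + h *\<^sub>R u) - f (p + h *\<^sub>R v) + f p) / h\<^sup>2
        - frechet_derivative (\<lambda>q. frechet_derivative f (at q) u) (at p) v\<bar> < \<epsilon>"
proof -
  let ?fu = "\<lambda>q. frechet_derivative f (at q) u"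
  let ?fuv = "\<lambda>q. frechet_derivative ?fu (at q) v"
  show ?thesis
  proof -
    obtain r where r: "r > 0" "ball p r \<subseteq> U"
      using U open_contains_ball by blast
    have "continuous_on U ?fuv"
      using fu by (rule C1_on_continuous_derivative)
    then have "isCont ?fuv p"
      using U by (simp add: continuous_on_eq_continuous_at)
    then obtain s where s: "s > 0" "\<And>q. dist q p < s \<Longrightarrow> dist (?fuv q) (?fuv p) < \<epsilon>"
      unfolding continuous_at_eps_delta using e by blast
    define \<delta> where "\<delta> = min r s / (norm u + norm v + 1)"
    have K: "norm u + norm v + 1 > 0"
      by (simp add: add_nonneg_pos)
    have "\<delta> > 0"
      using r s K by (simp add: \<delta>_def)
    moreover have "\<bar>(f (p + h *\<^sub>R u + h *\<^sub>R v) - f (p + h *\<^sub>R u) - f (p + h *\<^sub>R v) + f p) / h\<^sup>2 - ?fuv p\<bar> < \<epsilon>"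
      if h: "0 < h" "h < \<delta>" for h
    proof -
      have near: "dist (p + a *\<^sub>R u + b *\<^sub>R v) p < min r s" if "0 \<le> a" "a \<le> h" "0 \<le> b" "b \<le> h" for a b
      proof -
        have "dist (p + a *\<^sub>R u + b *\<^sub>R v) p = norm (a *\<^sub>R u + b *\<^sub>R v)"
          by (simp add: dist_norm algebra_simps)
        also have "\<dots> \<le> a * norm u + b * norm v"
          using that norm_triangle_ineq [of "a *\<^sub>R u" "b *\<^sub>R v"] by simp
        also have "\<dots> \<le> h * (norm u + norm v + 1)"
          using that mult_right_mono [of a h "norm u"] mult_right_mono [of b h "norm v"] h
          by (simp add: algebra_simps)
        also have "\<dots> < \<delta> * (norm u + norm v + 1)"
          using h K by simp
        also have "\<dots> = min r s"
          using K by (simp add: \<delta>_def)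
        finally show ?thesis .
      qed
      then have inU: "p + a *\<^sub>R u + b *\<^sub>R v \<in> U" if "0 \<le> a" "a \<le> h" "0 \<le> b" "b \<le> h" for a b
        using that r by (force simp: subset_iff dist_commute)
      define \<phi> where "\<phi> = (\<lambda>a. f (p + a *\<^sub>R u + h *\<^sub>R v) - f (p + a *\<^sub>R u))"
      have "\<exists>z::real. z > 0 \<and> z < h \<and> \<phi> h - \<phi> 0 =
          (h - 0) * (?fu (p + z *\<^sub>R u + h *\<^sub>R v) - ?fu (p + z *\<^sub>R u))"
      proof (rule MVT2 [OF h(1)])
        fix a :: real assume a: "0 \<le> a" "a \<le> h"
        have d: "((\<lambda>a. f (p + a *\<^sub>R u + b *\<^sub>R v)) has_real_derivative ?fu (p + a *\<^sub>R u + b *\<^sub>R v)) (at a)"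
          if "0 \<le> b" "b \<le> h" for b
        proof -
          have "((\<lambda>a. p + a *\<^sub>R u + b *\<^sub>R v) has_derivative (\<lambda>t. t *\<^sub>R u)) (at a)"
            by (auto intro!: derivative_eq_intros)
          from has_derivative_compose [OF this C1_on_has_derivative [OF f inU [OF a that]]]
          have "((\<lambda>a. f (p + a *\<^sub>R u + b *\<^sub>R v)) has_derivative
              (\<lambda>t. frechet_derivative f (at (p + a *\<^sub>R u + b *\<^sub>R v)) (t *\<^sub>R u))) (at a)" .
          moreover have "(\<lambda>t. frechet_derivative f (at (p + a *\<^sub>R u + b *\<^sub>R v)) (t *\<^sub>R u)) =
              (*) (?fu (p + a *\<^sub>R u + b *\<^sub>R v))"
            using C1_on_linear_derivative [OF f inU [OF a that]]
            by (auto simp: linear_cmul)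
          ultimately show ?thesis
            by (simp add: has_field_derivative_def)
        qed
        show "DERIV \<phi> a :> ?fu (p + a *\<^sub>R u + h *\<^sub>R v) - ?fu (p + a *\<^sub>R u)"
          unfolding \<phi>_def using DERIV_diff [OF d [of h] d [of 0]] h by simp
      qed
      then obtain z where z: "0 < z" "z < h" "\<phi> h - \<phi> 0 = h * (?fu (p + z *\<^sub>R u + h *\<^sub>R v) - ?fu (p + z *\<^sub>R u))"
        by auto
      define \<psi> where "\<psi> = (\<lambda>b. ?fu (p + z *\<^sub>R u + b *\<^sub>R v))"
      have "\<exists>y::real. y > 0 \<and> y < h \<and> \<psi> h - \<psi> 0 = (h - 0) * (?fuv (p + z *\<^sub>R u + y *\<^sub>R v))"
      proof (rule MVT2 [OF h(1)])
        fix b :: real assume b: "0 \<le> b" "b \<le> h"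
        have in': "p + z *\<^sub>R u + b *\<^sub>R v \<in> U"
          using inU [of z b] z b by simp
        have "((\<lambda>b. p + z *\<^sub>R u + b *\<^sub>R v) has_derivative (\<lambda>t. t *\<^sub>R v)) (at b)"
          by (auto intro!: derivative_eq_intros)
        from has_derivative_compose [OF this C1_on_has_derivative [OF fu in']]
        have "(\<psi> has_derivative
            (\<lambda>t. frechet_derivative ?fu (at (p + z *\<^sub>R u + b *\<^sub>R v)) (t *\<^sub>R v))) (at b)"
          unfolding \<psi>_def .
        moreover have "(\<lambda>t. frechet_derivative ?fu (at (p + z *\<^sub>R u + b *\<^sub>R v)) (t *\<^sub>R v)) =
            (*) (?fuv (p + z *\<^sub>R u + b *\<^sub>R v))"
          using C1_on_linear_derivative [OF fu in'] by (auto simp: linear_cmul)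
        ultimately show "DERIV \<psi> b :> ?fuv (p + z *\<^sub>R u + b *\<^sub>R v)"
          by (simp add: has_field_derivative_def)
      qed
      then obtain y where y: "0 < y" "y < h" "\<psi> h - \<psi> 0 = h * ?fuv (p + z *\<^sub>R u + y *\<^sub>R v)"
        by auto
      have "f (p + h *\<^sub>R u + h *\<^sub>R v) - f (p + h *\<^sub>R u) - f (p + h *\<^sub>R v) + f p = \<phi> h - \<phi> 0"
        by (simp add: \<phi>_def)
      also have "\<dots> = h * (\<psi> h - \<psi> 0)"
        using z by (simp add: \<psi>_def)
      also have "\<dots> = h\<^sup>2 * ?fuv (p + z *\<^sub>R u + y *\<^sub>R v)"
        using y by (simp add: power2_eq_square)
      finally have "(f (p + h *\<^sub>R u + h *\<^sub>R v) - f (p + h *\<^sub>R u) - f (p + h *\<^sub>R v) + f p) / h\<^sup>2 =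
          ?fuv (p + z *\<^sub>R u + y *\<^sub>R v)"
        using h by simp
      then show ?thesis
        using s(2) [of "p + z *\<^sub>R u + y *\<^sub>R v"] near [of z y] z y by (simp add: dist_real_def)
    qed
    ultimately show ?thesis by blast
  qed
qed

lemma symmetric_second_derivative_real:
  fixes f :: "'v::real_normed_vector \<Rightarrow> real"
  assumes U: "open U" "p \<in> U" and f: "C1_on U f"
    and fu: "C1_on U (\<lambda>q. frechet_derivative f (at q) u)"
    and fv: "C1_on U (\<lambda>q. frechet_derivative f (at q) v)"
  shows "frechet_derivative (\<lambda>q. frechet_derivative f (at q) u) (at p) v =
    frechet_derivative (\<lambda>q. frechet_derivative f (at q) v) (at p) u" (is "?a = ?b")
proof (rule ccontr)
  assume "?a \<noteq> ?b"
  then have e: "\<bar>?a - ?b\<bar> / 2 > 0" by simp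
  define q where "q h = (f (p + h *\<^sub>R u + h *\<^sub>R v) - f (p + h *\<^sub>R u) - f (p + h *\<^sub>R v) + f p) / h\<^sup>2" for h
  obtain d1 where d1: "d1 > 0" "\<And>h. 0 < h \<and> h < d1 \<Longrightarrow> \<bar>q h - ?a\<bar> < \<bar>?a - ?b\<bar> / 2"
    using second_difference_quotient [OF U f fu e, of v] unfolding q_def by blast
  obtain d2 where d2: "d2 > 0" "\<And>h. 0 < h \<and> h < d2 \<Longrightarrow> \<bar>q h - ?b\<bar> < \<bar>?a - ?b\<bar> / 2"
    using second_difference_quotient [OF U f fv e, of u] unfolding q_def
    by (simp add: algebra_simps) (use that in blast)
  have "\<bar>q (min d1 d2 / 2) - ?a\<bar> < \<bar>?a - ?b\<bar> / 2" "\<bar>q (min d1 d2 / 2) - ?b\<bar> < \<bar>?a - ?b\<bar> / 2"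
    using d1(1) d2(1) by (intro d1(2) d2(2); simp add: min_def)+
  moreover have "\<bar>?a - ?b\<bar> \<le> \<bar>q (min d1 d2 / 2) - ?a\<bar> + \<bar>q (min d1 d2 / 2) - ?b\<bar>"
    by (smt (verit))
  ultimately show False by linarith
qed

lemma frechet_derivative_inner_const:
  assumes "C1_on U f" "p \<in> U"
  shows "frechet_derivative (\<lambda>q. f q \<bullet> b) (at p) = (\<lambda>w. frechet_derivative f (at p) w \<bullet> b)"
  by (rule frechet_derivative_at [symmetric])
    (intro has_derivative_inner_left C1_on_has_derivative [OF assms])

lemma symmetric_second_derivative:
  fixes f :: "'v::real_normed_vector \<Rightarrow> 'w::euclidean_space"
  assumes U: "open U" "p \<in> U" and f: "C1_on U f"
    and df: "\<And>w. C1_on U (\<lambda>q. frechet_derivative f (at q) w)"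
  shows "frechet_derivative (\<lambda>q. frechet_derivative f (at q) u) (at p) v =
    frechet_derivative (\<lambda>q. frechet_derivative f (at q) v) (at p) u"
proof (rule euclidean_eqI)
  fix b :: 'w
  let ?g = "\<lambda>q. f q \<bullet> b"
  have g: "C1_on U ?g"
    by (rule C1_on_inner [OF f C1_on_const])
  have dg: "C1_on U (\<lambda>q. frechet_derivative ?g (at q) w)" for w
    by (rule C1_on_cong [OF U(1) _ C1_on_inner [OF df C1_on_const]]) (simp add: frechet_derivative_inner_const [OF f])
  have swap: "frechet_derivative (\<lambda>q. frechet_derivative ?g (at q) u) (at p) v =
      frechet_derivative (\<lambda>q. frechet_derivative f (at q) u) (at p) v \<bullet> b" for u v
  proof -
    have "((\<lambda>q. frechet_derivative f (at q) u \<bullet> b) has_derivative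
        (\<lambda>v. frechet_derivative (\<lambda>q. frechet_derivative f (at q) u) (at p) v \<bullet> b)) (at p)"
      by (intro has_derivative_inner_left C1_on_has_derivative [OF df] U)
    then have "((\<lambda>q. frechet_derivative ?g (at q) u) has_derivative
        (\<lambda>v. frechet_derivative (\<lambda>q. frechet_derivative f (at q) u) (at p) v \<bullet> b)) (at p)"
      by (rule has_derivative_transform_within_open [OF _ U]) (simp add: frechet_derivative_inner_const [OF f])
    then show ?thesis
      using frechet_derivative_at by metis
  qed
  show "frechet_derivative (\<lambda>q. frechet_derivative f (at q) u) (at p) v \<bullet> b =
      frechet_derivative (\<lambda>q. frechet_derivative f (at q) v) (at p) u \<bullet> b"
    using symmetric_second_derivative_real [OF U g dg dg, of u v] unfolding swap .
qed

section \<open>Smooth families of linear maps\<close>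

lemma linear_eq_sum_Basis:
  fixes L :: "'v::euclidean_space \<Rightarrow> 'w::real_vector"
  assumes "linear L" shows "L v = (\<Sum>b\<in>Basis. (v \<bullet> b) *\<^sub>R L b)"
  by (subst euclidean_representation [of v, symmetric]) (simp add: linear_sum [OF assms] linear_cmul [OF assms])

lemma C1_on_linear_apply:
  fixes B :: "'v::real_normed_vector \<Rightarrow> 'e::euclidean_space \<Rightarrow> 'w::real_normed_vector"
  assumes "open U" "\<And>p. p \<in> U \<Longrightarrow> linear (B p)" "\<And>v. C1_on U (\<lambda>p. B p v)" "C1_on U f"
  shows "C1_on U (\<lambda>p. B p (f p))"
proof (rule C1_on_cong [OF assms(1)])
  show "(\<Sum>b\<in>Basis. (f p \<bullet> b) *\<^sub>R B p b) = B p (f p)" if "p \<in> U" for p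
    by (rule linear_eq_sum_Basis [OF assms(2) [OF that], symmetric])
qed (intro C1_on_sum C1_on_scaleR C1_on_inner C1_on_const assms)

lemma continuous_on_linear_apply:
  fixes B :: "'v::topological_space \<Rightarrow> 'e::euclidean_space \<Rightarrow> 'w::real_normed_vector"
  assumes "\<And>p. p \<in> U \<Longrightarrow> linear (B p)" "\<And>v. continuous_on U (\<lambda>p. B p v)" "continuous_on U f"
  shows "continuous_on U (\<lambda>p. B p (f p))"
proof (rule continuous_on_eq)
  show "(\<Sum>b\<in>Basis. (f p \<bullet> b) *\<^sub>R B p b) = B p (f p)" if "p \<in> U" for p
    by (rule linear_eq_sum_Basis [OF assms(1) [OF that], symmetric])
qed (intro continuous_intros assms)

text \<open>Continuity and differentiability of the inverse \<open>K\<close> both come from the identity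
  \<open>K(p) w - K(q) w = - K(p) (L(p) - L(q)) K(q) w\<close>, in which the argument \<open>K(q) w\<close> is fixed; the
  lower bound on \<open>L\<close> bounds \<open>K\<close>.\<close>

lemma C1_on_inverse_linear_aux:
  fixes L :: "'v::real_normed_vector \<Rightarrow> 'e::euclidean_space \<Rightarrow> 'e"
  assumes U: "open U" and lin: "\<And>p. p \<in> U \<Longrightarrow> linear (L p)" and C1: "\<And>v. C1_on U (\<lambda>p. L p v)"
    and c: "c > 0" "\<And>p v. p \<in> U \<Longrightarrow> c * norm v \<le> norm (L p v)"
  shows "\<exists>K. (\<forall>p\<in>U. linear (K p) \<and> (\<forall>w. L p (K p w) = w) \<and> (\<forall>v. K p (L p v) = v)) \<and>
    (\<forall>w. C1_on U (\<lambda>p. K p w))"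
proof -
  have "\<exists>K. linear K \<and> (\<forall>w. L p (K w) = w) \<and> (\<forall>v. K (L p v) = v)" if "p \<in> U" for p
  proof -
    have "inj (L p)"
    proof -
      have "v = 0" if "L p v = 0" for v
        using c(1) c(2) [OF \<open>p \<in> U\<close>, of v] that by (simp add: mult_le_0_iff)
      then show ?thesis
        using linear_injective_0 [OF lin [OF that]] by blast
    qed
    then show ?thesis
      using linear_injective_isomorphism [OF lin [OF that]] by auto
  qed
  then obtain K where K: "\<And>p. p \<in> U \<Longrightarrow> linear (K p)" "\<And>p w. p \<in> U \<Longrightarrow> L p (K p w) = w"
      "\<And>p v. p \<in> U \<Longrightarrow> K p (L p v) = v"
    by metis
  have bd: "norm (K p w) \<le> norm w / c" if "p \<in> U" for p w
    using c(2) [OF that, of "K p w"] K(2) [OF that] c(1) by (simp add: field_simps)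
  have diff: "K p w - K q w = - K p (L p (K q w) - L q (K q w))" if "p \<in> U" "q \<in> U" for p q w
    using that by (simp add: linear_diff [OF K(1)] K)
  have cont: "continuous_on U (\<lambda>p. K p w)" for w
    unfolding continuous_on_def
  proof
    fix q assume q: "q \<in> U"
    define z where "z = K q w"
    have "((\<lambda>p. L p z) \<longlongrightarrow> L q z) (at q within U)"
      using C1_on_imp_continuous_on [OF C1 [of z]] q by (simp add: continuous_on_def)
    then have "((\<lambda>p. norm (L p z - L q z) / c) \<longlongrightarrow> norm (L q z - L q z) / c) (at q within U)"
      by (intro tendsto_intros) (use c in auto)
    then have lim: "((\<lambda>p. norm (L p z - L q z) / c) \<longlongrightarrow> 0) (at q within U)"
      by simp
    have "((\<lambda>p. K p w - K q w) \<longlongrightarrow> 0) (at q within U)"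
    proof (rule Lim_null_comparison [OF _ lim])
      show "\<forall>\<^sub>F p in at q within U. norm (K p w - K q w) \<le> norm (L p z - L q z) / c"
        unfolding eventually_at_filter
        by (intro always_eventually allI impI) (simp add: diff [OF _ q] bd z_def)
    qed
    then show "((\<lambda>p. K p w) \<longlongrightarrow> K q w) (at q within U)"
      by (simp add: LIM_zero_iff)
  qed
  define L' where "L' p v h = frechet_derivative (\<lambda>p. L p v) (at p) h" for p v h
  have "C1_on U (\<lambda>p. K p w)" for w
  proof (rule C1_onI)
    fix q assume q: "q \<in> U"
    define z where "z = K q w"
    have Lz: "((\<lambda>p. L p z) has_derivative L' q z) (at q)"
      using C1_on_has_derivative [OF C1 q] by (simp add: L'_def [abs_def])
    have b: "bounded_linear (L' q z)" 
      using Lz by (rule has_derivative_bounded_linear)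
    have Kb: "bounded_linear (K q)"
      using K(1) [OF q] by (simp add: linear_conv_bounded_linear)
    obtain M where M: "M > 0" "\<And>h. norm (L' q z h) \<le> norm h * M"
      using bounded_linear.pos_bounded [OF b] by blast
    have Kc: "((\<lambda>p. norm (K p v - K q v)) \<longlongrightarrow> 0) (at q)" for v
    proof -
      have "((\<lambda>p. K p v) \<longlongrightarrow> K q v) (at q)"
        using cont [of v] q U by (simp add: continuous_on_eq_continuous_at isCont_def)
      then show ?thesis
        by (simp add: LIM_zero_iff tendsto_norm_zero)
    qed
    have ev: "\<forall>\<^sub>F p in at q. p \<in> U"
      using U q eventually_at_topological by blast
    show "((\<lambda>p. K p w) has_derivative (\<lambda>h. - K q (L' q z h))) (at q)"
      unfolding has_derivative_at_within
    proof (intro conjI)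
      show "bounded_linear (\<lambda>h. - K q (L' q z h))"
        by (intro bounded_linear_minus bounded_linear_compose [OF Kb b])
      have lim1: "((\<lambda>p. norm (((L p z - L q z) - L' q z (p - q)) /\<^sub>R norm (p - q)) / c) \<longlongrightarrow> 0) (at q)"
      proof -
        have "((\<lambda>p. ((L p z - L q z) - L' q z (p - q)) /\<^sub>R norm (p - q)) \<longlongrightarrow> 0) (at q)"
          using Lz unfolding has_derivative_at_within by blast
        from tendsto_divide [OF tendsto_norm_zero [OF this] tendsto_const [of c]] c
        show ?thesis by simp
      qed
      have lim2: "((\<lambda>p. \<Sum>d\<in>Basis. M * norm (K p d - K q d)) \<longlongrightarrow> 0) (at q)"
        by (intro tendsto_null_sum tendsto_mult_right_zero Kc)
      have "\<forall>\<^sub>F p in at q. norm ((K p w - K q w - - K q (L' q z (p - q))) /\<^sub>R norm (p - q))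
          \<le> norm (((L p z - L q z) - L' q z (p - q)) /\<^sub>R norm (p - q)) / c +
            (\<Sum>d\<in>Basis. M * norm (K p d - K q d))"
        using ev
      proof (rule eventually_mono)
        fix p assume p: "p \<in> U"
        define k where "k = L' q z (p - q)"
        have "K p w - K q w - - K q k =
            - K p ((L p z - L q z) - k) - (K p k - K q k)"
          using diff [OF p q, of w] by (simp add: z_def linear_diff [OF K(1) [OF p]])
        also have "norm \<dots> \<le> norm (K p ((L p z - L q z) - k)) + norm (K p k - K q k)"
          using norm_triangle_ineq4 [of "- K p ((L p z - L q z) - k)"] by simp
        also have "\<dots> \<le> norm ((L p z - L q z) - k) / c + (\<Sum>d\<in>Basis. M * norm (K p d - K q d)) * norm (p - q)"
        proof (rule add_mono [OF bd [OF p]])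
          have "K p k - K q k = (\<Sum>d\<in>Basis. (k \<bullet> d) *\<^sub>R (K p d - K q d))"
            by (simp add: linear_eq_sum_Basis [OF K(1) [OF p], of k] linear_eq_sum_Basis [OF K(1) [OF q], of k]
                scaleR_diff_right sum_subtractf)
          also have "norm \<dots> \<le> (\<Sum>d\<in>Basis. norm ((k \<bullet> d) *\<^sub>R (K p d - K q d)))"
            by (rule norm_sum)
          also have "\<dots> \<le> (\<Sum>d\<in>Basis. M * norm (K p d - K q d) * norm (p - q))"
          proof (rule sum_mono)
            fix d :: 'e assume "d \<in> Basis"
            then have "\<bar>k \<bullet> d\<bar> \<le> norm (p - q) * M"
              using Basis_le_norm [of d k] M(2) [of "p - q"] by (simp add: k_def)
            from mult_right_mono [OF this norm_ge_zero [of "K p d - K q d"]]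
            show "norm ((k \<bullet> d) *\<^sub>R (K p d - K q d)) \<le> M * norm (K p d - K q d) * norm (p - q)"
              by (simp add: mult_ac)
          qed
          finally show "norm (K p k - K q k) \<le> (\<Sum>d\<in>Basis. M * norm (K p d - K q d)) * norm (p - q)"
            by (simp add: sum_distrib_right)
        qed
        finally have *: "norm (K p w - K q w - - K q k) \<le> \<dots>" .
        show "norm ((K p w - K q w - - K q (L' q z (p - q))) /\<^sub>R norm (p - q))
          \<le> norm (((L p z - L q z) - L' q z (p - q)) /\<^sub>R norm (p - q)) / c +
            (\<Sum>d\<in>Basis. M * norm (K p d - K q d))"
        proof (cases "p = q")
          case True then show ?thesis using M by (simp add: sum_nonneg)
        next
          case False
          have r: "inverse r * a \<le> inverse r * d / c + S" if "r > 0" "a \<le> d / c + S * r" for r a d S :: real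
            using mult_left_mono [OF that(2), of "inverse r"] that(1) by (simp add: algebra_simps)
          show ?thesis
            unfolding norm_scaleR using r [OF _ *] False by (simp add: k_def)
        qed
      qed
      then show "((\<lambda>p. (K p w - K q w - - K q (L' q z (p - q))) /\<^sub>R norm (p - q)) \<longlongrightarrow> 0) (at q)"
        by (rule Lim_null_comparison) (use tendsto_add [OF lim1 lim2] in simp)
    qed
  next
    fix h
    have "continuous_on U (\<lambda>p. L' p (K p w) h)"
    proof (rule continuous_on_linear_apply [where B = "\<lambda>p v. L' p v h", OF _ _ cont])
      show "linear (\<lambda>v. L' p v h)" if p: "p \<in> U" for p
      proof (rule linearI)
        have ev: "\<forall>\<^sub>F x in nhds p. x \<in> U"
          using U p eventually_nhds by blast
        have d: "((\<lambda>p. L p v) has_derivative L' p v) (at p)" for v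
          using C1_on_has_derivative [OF C1 p] by (simp add: L'_def [abs_def])
        show "L' p (v + w) h = L' p v h + L' p w h" for v w
        proof -
          have "((\<lambda>p. L p (v + w)) has_derivative (\<lambda>h. L' p v h + L' p w h)) (at p)"
            by (rule has_derivative_transform_within_open [OF has_derivative_add [OF d [of v] d [of w]] U p])
              (simp add: linear_add [OF lin])
          from has_derivative_unique [OF d this] show ?thesis by (simp add: fun_eq_iff)
        qed
        show "L' p (r *\<^sub>R v) h = r *\<^sub>R L' p v h" for r v
        proof -
          have "((\<lambda>p. L p (r *\<^sub>R v)) has_derivative (\<lambda>h. r *\<^sub>R L' p v h)) (at p)"
            by (rule has_derivative_transform_within_open [OF has_derivative_scaleR_right [OF d [of v]] U p])
              (simp add: linear_cmul [OF lin])
          from has_derivative_unique [OF d this] show ?thesis by (simp add: fun_eq_iff)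
        qed
      qed
      show "continuous_on U (\<lambda>p. L' p v h)" for v
        using C1_on_continuous_derivative [OF C1] by (simp add: L'_def)
    qed
    then show "continuous_on U (\<lambda>p. - K p (L' p (K p w) h))"
      by (intro continuous_on_minus continuous_on_linear_apply [OF K(1) cont])
  qed
  with K show ?thesis by blast
qed

text \<open>An injective linear map is bounded below, and the bound persists with half the constant for the
  nearby maps of the family.\<close>

lemma C1_on_inverse_linear:
  fixes L :: "'v::real_normed_vector \<Rightarrow> 'e::euclidean_space \<Rightarrow> 'e"
  assumes U: "open U" "p\<^sub>0 \<in> U" and lin: "\<And>p. p \<in> U \<Longrightarrow> linear (L p)"
    and C1: "\<And>v. C1_on U (\<lambda>p. L p v)" and inj: "inj (L p\<^sub>0)"
  obtains W K where "open W" "p\<^sub>0 \<in> W" "W \<subseteq> U" "\<And>p. p \<in> W \<Longrightarrow> linear (K p)"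
    "\<And>p w. p \<in> W \<Longrightarrow> L p (K p w) = w" "\<And>p v. p \<in> W \<Longrightarrow> K p (L p v) = v"
    "\<And>w. C1_on W (\<lambda>p. K p w)"
proof -
  obtain c where c: "c > 0" "\<And>v. c * norm v \<le> norm (L p\<^sub>0 v)"
    using linear_inj_bounded_below_pos [OF lin [OF U(2)] inj] by blast
  define g where "g p = (\<Sum>b\<in>Basis. norm (L p b - L p\<^sub>0 b))" for p
  have "continuous_on U g"
    unfolding g_def by (intro continuous_intros C1_on_imp_continuous_on [OF C1])
  from continuous_open_preimage [OF this U(1) open_lessThan [of "c / 2"]]
  have "open {p\<in>U. g p < c / 2}"
    by (simp add: vimage_def Int_def)
  define W where "W = {p\<in>U. g p < c / 2}"
  have W: "open W" "p\<^sub>0 \<in> W" "W \<subseteq> U"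
    using \<open>open {p\<in>U. g p < c / 2}\<close> U c by (auto simp: W_def g_def)
  have low: "c / 2 * norm v \<le> norm (L p v)" if "p \<in> W" for p v
  proof -
    have p: "p \<in> U" using that W by auto
    have "L p v - L p\<^sub>0 v = (\<Sum>b\<in>Basis. (v \<bullet> b) *\<^sub>R (L p b - L p\<^sub>0 b))"
      by (simp add: linear_eq_sum_Basis [OF lin [OF p], of v] linear_eq_sum_Basis [OF lin [OF U(2)], of v]
          scaleR_diff_right sum_subtractf)
    also have "norm \<dots> \<le> (\<Sum>b\<in>Basis. norm ((v \<bullet> b) *\<^sub>R (L p b - L p\<^sub>0 b)))"
      by (rule norm_sum)
    also have "\<dots> \<le> (\<Sum>b\<in>Basis. norm v * norm (L p b - L p\<^sub>0 b))"
      by (rule sum_mono) (simp add: mult_right_mono Basis_le_norm)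
    also have "\<dots> = norm v * g p"
      by (simp add: g_def sum_distrib_left)
    also have "\<dots> \<le> norm v * (c / 2)"
      using that by (intro mult_left_mono) (auto simp: W_def)
    finally have "norm (L p v - L p\<^sub>0 v) \<le> norm v * (c / 2)" .
    then show ?thesis
      using c(2) [of v] norm_triangle_ineq2 [of "L p\<^sub>0 v" "L p v"]
      by (simp add: norm_minus_commute algebra_simps)
  qed
  have "c / 2 > 0" using c by simp
  from C1_on_inverse_linear_aux [OF W(1) _ C1_on_subset [OF C1 W(3)] this low] lin W(3)
  obtain K where "\<And>p. p \<in> W \<Longrightarrow> linear (K p)"
    "\<And>p w. p \<in> W \<Longrightarrow> L p (K p w) = w" "\<And>p v. p \<in> W \<Longrightarrow> K p (L p v) = v"
    "\<And>w. C1_on W (\<lambda>p. K p w)"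
    by (metis subsetD)
  with W show thesis by (rule that)
qed

section \<open>The divergence theorem for compactly supported fields\<close>

definition divg :: "('e::euclidean_space \<Rightarrow> 'e) \<Rightarrow> 'e \<Rightarrow> real" where
  "divg Z p = (\<Sum>b\<in>Basis. frechet_derivative Z (at p) b \<bullet> b)"

text \<open>By translation invariance the integral of \<open>f (p + h v)\<close> does not depend on \<open>h\<close>; the claim is its
  derivative at \<open>h = 0\<close>, taken under the integral sign.\<close>

lemma integral_directional_derivative_eq_0:
  fixes f :: "'e::euclidean_space \<Rightarrow> real"
  assumes f: "C1_on UNIV f" and supp: "\<And>p. p \<notin> cbox a b \<Longrightarrow> f p = 0"
    and sub: "\<And>x y. x \<in> cbox a b \<Longrightarrow> norm y \<le> norm v \<Longrightarrow> x + y \<in> cbox a' b'"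
  shows "integral (cbox a' b') (\<lambda>p. frechet_derivative f (at p) v) = 0"
proof -
  let ?g = "\<lambda>h p. f (p + h *\<^sub>R v)"
  let ?g' = "\<lambda>h p. frechet_derivative f (at (p + h *\<^sub>R v)) v"
  have contf: "continuous_on UNIV f" and contf': "continuous_on UNIV (\<lambda>p. frechet_derivative f (at p) v)"
    using f C1_on_imp_continuous_on C1_on_continuous_derivative by blast+
  have A: "((\<lambda>h. integral (cbox a' b') (?g h)) has_vector_derivative
      integral (cbox a' b') (?g' 0)) (at 0 within {-1..1})"
  proof (rule leibniz_rule_vector_derivative)
    show "((\<lambda>h. ?g h p) has_vector_derivative ?g' h p) (at h within {-1..1})" for h p
    proof -
      have "((\<lambda>h. p + h *\<^sub>R v) has_derivative (\<lambda>t. t *\<^sub>R v)) (at h within {-1..1})"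
        by (auto intro!: derivative_eq_intros)
      from has_derivative_compose [OF this C1_on_has_derivative [OF f UNIV_I]]
      show ?thesis
        using C1_on_linear_derivative [OF f UNIV_I]
        by (simp add: has_vector_derivative_def linear_cmul)
    qed
    show "?g h integrable_on cbox a' b'" for h
      by (intro integrable_continuous continuous_on_compose2 [OF contf] continuous_intros) auto
    show "continuous_on ({-1..1} \<times> cbox a' b') (\<lambda>(h, p). ?g' h p)"
      unfolding case_prod_beta
      by (intro continuous_on_compose2 [OF contf'] continuous_intros) auto
  qed auto
  have B: "integral (cbox a' b') (?g h) = integral (cbox a' b') f" if h: "h \<in> {-1..1}" for h
  proof -
    have out: "f p = 0" if "p \<notin> cbox a' b'" for p
      using that sub [of p 0] supp by force
    have out': "?g h p = 0" if "p \<notin> cbox a' b'" for p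
    proof (rule supp, rule)
      assume "p + h *\<^sub>R v \<in> cbox a b"
      moreover have "norm (h *\<^sub>R v) \<le> norm v"
        using h mult_right_mono [of "\<bar>h\<bar>" 1 "norm v"] by auto
      ultimately have "(p + h *\<^sub>R v) + - (h *\<^sub>R v) \<in> cbox a' b'"
        by (intro sub) simp_all
      then show False using that by simp
    qed
    have Ig: "(?g h has_integral integral (cbox a' b') (?g h)) UNIV"
      by (rule has_integral_on_superset [OF integrable_integral])
        (auto intro!: integrable_continuous continuous_on_compose2 [OF contf] continuous_intros simp: out')
    have "((\<lambda>p. f (1 *\<^sub>R p + h *\<^sub>R v)) has_integral (integral (cbox a' b') f /\<^sub>R 1 ^ DIM('e)))
        (cbox ((a' - h *\<^sub>R v) /\<^sub>R 1) ((b' - h *\<^sub>R v) /\<^sub>R 1))"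
      by (intro has_integral_affinity' integrable_integral integrable_continuous
          continuous_on_subset [OF contf]) auto
    then have "(?g h has_integral integral (cbox a' b') f) (cbox (a' - h *\<^sub>R v) (b' - h *\<^sub>R v))"
      by simp
    then have "(?g h has_integral integral (cbox a' b') f) UNIV"
    proof (rule has_integral_on_superset)
      fix p assume "p \<notin> cbox (a' - h *\<^sub>R v) (b' - h *\<^sub>R v)"
      then have "p + h *\<^sub>R v \<notin> cbox a' b'"
        by (auto simp: mem_box algebra_simps)
      then show "?g h p = 0" by (rule out)
    qed simp
    with Ig show ?thesis
      by (rule has_integral_unique)
  qed
  have "((\<lambda>h. integral (cbox a' b') f) has_vector_derivative
      integral (cbox a' b') (?g' 0)) (at 0 within {-1..1::real})"
    by (rule has_vector_derivative_transform [OF _ _ A]) (simp_all add: B)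
  from vector_derivative_unique_within [OF _ this has_vector_derivative_const]
  show ?thesis
    by (simp add: trivial_limit_within islimpt_Icc)
qed

lemma divg_nonneg_imp_eq_0:
  fixes Z :: "'e::euclidean_space \<Rightarrow> 'e"
  assumes Z: "C1_on UNIV Z" and supp: "bounded {p. Z p \<noteq> 0}" and nonneg: "\<And>p. divg Z p \<ge> 0"
  shows "divg Z p = 0"
proof -
  obtain a b :: 'e where ab: "{p. Z p \<noteq> 0} \<subseteq> cbox a b"
    using supp bounded_subset_cbox_symmetric by metis
  have "bounded (insert p ((\<lambda>x. fst x + snd x) ` (cbox a b \<times> cball 0 1)))"
    unfolding bounded_insert
    by (intro compact_imp_bounded compact_continuous_image continuous_intros compact_Times) auto
  then obtain c where c: "insert p ((\<lambda>x. fst x + snd x) ` (cbox a b \<times> cball 0 1)) \<subseteq> box (- c) c"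
    using bounded_subset_box_symmetric by metis
  have cont: "continuous_on S (divg Z)" for S
    unfolding divg_def
    by (intro continuous_intros continuous_on_subset [OF C1_on_continuous_derivative [OF Z]]) auto
  have int: "(\<lambda>p. frechet_derivative Z (at p) b \<bullet> b) integrable_on cbox (- c) c" for b
    by (intro integrable_continuous continuous_intros
        continuous_on_subset [OF C1_on_continuous_derivative [OF Z]]) auto
  have "integral (cbox (- c) c) (divg Z) =
      (\<Sum>b\<in>Basis. integral (cbox (- c) c) (\<lambda>p. frechet_derivative Z (at p) b \<bullet> b))"
    unfolding divg_def by (rule integral_sum) (use int in auto)
  also have "\<dots> = 0"
  proof (rule sum.neutral, rule ballI)
    fix b' :: 'e assume b': "b' \<in> Basis"
    have "integral (cbox (- c) c) (\<lambda>p. frechet_derivative (\<lambda>p. Z p \<bullet> b') (at p) b') = 0"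
    proof (rule integral_directional_derivative_eq_0)
      show "C1_on UNIV (\<lambda>p. Z p \<bullet> b')"
        by (rule C1_on_inner [OF Z C1_on_const])
      show "Z p \<bullet> b' = 0" if "p \<notin> cbox a b" for p
      proof -
        have "Z p = 0" using ab that by blast
        then show ?thesis by simp
      qed
      show "x + y \<in> cbox (- c) c" if "x \<in> cbox a b" "norm y \<le> norm b'" for x y
      proof -
        have "(x, y) \<in> cbox a b \<times> cball 0 1" using that b' by simp
        then have "fst (x, y) + snd (x, y) \<in> box (- c) c" using c by blast
        then show ?thesis using box_subset_cbox by auto
      qed
    qed
    then show "integral (cbox (- c) c) (\<lambda>p. frechet_derivative Z (at p) b' \<bullet> b') = 0"
      by (simp add: frechet_derivative_inner_const [OF Z])
  qed
  finally have "integral (cbox (- c) c) (divg Z) = 0" .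
  then have "(divg Z has_integral 0) (cbox (- c) c)"
    using integrable_integral [OF integrable_continuous [OF cont]] by metis
  moreover have "p \<in> box (- c) c" using c by auto
  ultimately show ?thesis
    using has_integral_0_cbox_imp_0 [OF cont nonneg, of "- c" c p] box_subset_cbox by blast
qed

text \<open>At the truncation time the difference quotients from both sides tend to zero.\<close>

lemma
  fixes g :: "real \<times> 'a::real_normed_vector \<Rightarrow> 'w::real_normed_vector"
  assumes U: "open U" and g: "C1_on U g"
    and 0: "\<And>p. p \<in> U \<Longrightarrow> fst p = t\<^sub>0 \<Longrightarrow> g p = 0"
      "\<And>p v. p \<in> U \<Longrightarrow> fst p = t\<^sub>0 \<Longrightarrow> frechet_derivative g (at p) v = 0"
  shows has_derivative_truncate: "p \<in> U \<Longrightarrow> ((\<lambda>p. if fst p > t\<^sub>0 then g p else 0) has_derivative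
      (\<lambda>v. if fst p > t\<^sub>0 then frechet_derivative g (at p) v else 0)) (at p)"
    and C1_on_truncate: "C1_on U (\<lambda>p. if fst p > t\<^sub>0 then g p else 0)"
proof -
  let ?f = "\<lambda>p. if fst p > t\<^sub>0 then g p else 0"
  let ?f' = "\<lambda>p v. if fst p > t\<^sub>0 then frechet_derivative g (at p) v else 0"
  show deriv: "(?f has_derivative ?f' p) (at p)" if p: "p \<in> U" for p
  proof -
    have op: "open {q :: real \<times> 'a. fst q > t\<^sub>0}" "open {q :: real \<times> 'a. fst q < t\<^sub>0}"
      by (intro open_Collect_less continuous_intros)+
    consider "fst p > t\<^sub>0" | "fst p < t\<^sub>0" | "fst p = t\<^sub>0" by linarith
    then show ?thesis
    proof cases
      case 1
      have "(?f has_derivative frechet_derivative g (at p)) (at p)"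
        by (rule has_derivative_transform_within_open [OF C1_on_has_derivative [OF g p] op(1)])
          (use 1 in auto)
      with 1 show ?thesis by simp
    next
      case 2
      have "(?f has_derivative (\<lambda>v. 0)) (at p)"
        by (rule has_derivative_transform_within_open [OF has_derivative_const op(2)]) (use 2 in auto)
      with 2 show ?thesis by simp
    next
      case 3
      have g0: "frechet_derivative g (at p) = (\<lambda>v. 0)"
        using 0(2) [OF p 3] by auto
      have "((\<lambda>q. (g q - g p - 0) /\<^sub>R norm (q - p)) \<longlongrightarrow> 0) (at p)"
        using C1_on_has_derivative [OF g p] unfolding has_derivative_at_within g0 by blast
      then have "((\<lambda>q. g q /\<^sub>R norm (q - p)) \<longlongrightarrow> 0) (at p)"
        using 0(1) [OF p 3] by simp
      then have "((\<lambda>q. ?f q /\<^sub>R norm (q - p)) \<longlongrightarrow> 0) (at p)"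
        by (rule Lim_null_comparison [OF always_eventually tendsto_norm_zero, rotated]) auto
      then have "(?f has_derivative (\<lambda>v. 0)) (at p)"
        unfolding has_derivative_at_within using 3 by simp
      with 3 show ?thesis by simp
    qed
  qed
  have "continuous_on U (\<lambda>p. ?f' p v)" for v
  proof -
    let ?h = "\<lambda>p. frechet_derivative g (at p) v"
    have h: "continuous_on U ?h"
      using g by (rule C1_on_continuous_derivative)
    have "continuous_on ({p\<in>U. t\<^sub>0 \<le> fst p} \<union> {p\<in>U. fst p \<le> t\<^sub>0}) (\<lambda>p. if fst p > t\<^sub>0 then ?h p else 0)"
    proof (rule continuous_on_cases_local)
      let ?S = "{p\<in>U. t\<^sub>0 \<le> fst p} \<union> {p\<in>U. fst p \<le> t\<^sub>0}"
      have "closed {p :: real \<times> 'a. t\<^sub>0 \<le> fst p}" "closed {p :: real \<times> 'a. fst p \<le> t\<^sub>0}"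
        by (intro closed_Collect_le continuous_intros)+
      then show "closedin (top_of_set ?S) {p\<in>U. t\<^sub>0 \<le> fst p}" "closedin (top_of_set ?S) {p\<in>U. fst p \<le> t\<^sub>0}"
        by (auto simp: closedin_closed)
      show "continuous_on {p\<in>U. t\<^sub>0 \<le> fst p} ?h"
        using h by (rule continuous_on_subset) auto
      show "?h p = 0" if "p \<in> {p\<in>U. t\<^sub>0 \<le> fst p} \<and> \<not> t\<^sub>0 < fst p \<or> p \<in> {p\<in>U. fst p \<le> t\<^sub>0} \<and> t\<^sub>0 < fst p" for p
        by (rule 0(2)) (use that in auto)
    qed auto
    moreover have "{p\<in>U. t\<^sub>0 \<le> fst p} \<union> {p\<in>U. fst p \<le> t\<^sub>0} = U" by auto
    ultimately show ?thesis by simp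
  qed
  with deriv show "C1_on U ?f" by (rule C1_onI)
qed

lemma has_real_derivative_pos_part_power:
  fixes s :: real
  assumes "n \<ge> 2"
  shows "((\<lambda>s. (max 0 s) ^ n) has_real_derivative n * (max 0 s) ^ (n - 1)) (at s)"
proof -
  consider "s > 0" | "s < 0" | "s = 0" by linarith
  then show ?thesis
  proof cases
    case 1
    have "((\<lambda>s. s ^ n) has_real_derivative n * s ^ (n - 1)) (at s)"
      by (auto intro!: derivative_eq_intros)
    then have "((\<lambda>s. (max 0 s) ^ n) has_real_derivative n * s ^ (n - 1)) (at s)"
      by (rule has_field_derivative_transform_within_open [where S = "{0<..}"]) (use 1 in auto)
    with 1 show ?thesis by simp
  next
    case 2
    have "((\<lambda>s. (max 0 s) ^ n) has_real_derivative 0) (at s)"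
      by (rule has_field_derivative_transform_within_open [OF DERIV_const, where S = "{..<0}"])
        (use 2 assms in \<open>auto simp: max_def\<close>)
    with 2 assms show ?thesis by (simp add: max_def power_0_left)
  next
    case 3
    have "((\<lambda>h. (max 0 h) ^ n / h) \<longlongrightarrow> 0) (at (0::real))"
    proof (rule Lim_null_comparison)
      show "\<forall>\<^sub>F h in at (0::real). norm ((max 0 h) ^ n / h) \<le> \<bar>h\<bar> ^ (n - 1)"
      proof (intro always_eventually allI)
        fix h :: real
        have "n = Suc (n - 1)" using assms by simp
        then have "(max 0 h) ^ n = max 0 h * (max 0 h) ^ (n - 1)"
          by (metis power_Suc)
        then show "norm ((max 0 h) ^ n / h) \<le> \<bar>h\<bar> ^ (n - 1)"
          by (cases "h > 0") (auto simp: max_def)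
      qed
      have "((\<lambda>h. \<bar>h\<bar> ^ (n - 1)) \<longlongrightarrow> \<bar>0\<bar> ^ (n - 1)) (at (0::real))"
        by (intro tendsto_intros)
      with assms show "((\<lambda>h. \<bar>h\<bar> ^ (n - 1)) \<longlongrightarrow> 0) (at (0::real))" by (simp add: power_0_left)
    qed
    with 3 assms show ?thesis by (simp add: DERIV_def power_0_left)
  qed
qed

lemma C1_on_pos_part_power:
  fixes f :: "'v::real_normed_vector \<Rightarrow> real"
  assumes "C1_on U f" "n \<ge> 2"
  shows "C1_on U (\<lambda>p. (max 0 (f p)) ^ n)"
    and "p \<in> U \<Longrightarrow> frechet_derivative (\<lambda>p. (max 0 (f p)) ^ n) (at p) v =
      n * (max 0 (f p)) ^ (n - 1) * frechet_derivative f (at p) v"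
proof -
  show "C1_on U (\<lambda>p. (max 0 (f p)) ^ n)"
    by (rule C1_on_compose_real [OF assms(1) has_real_derivative_pos_part_power [OF assms(2)]])
      (intro continuous_intros)
  assume "p \<in> U"
  have "((\<lambda>p. (max 0 (f p)) ^ n) has_derivative
      (\<lambda>v. n * (max 0 (f p)) ^ (n - 1) * frechet_derivative f (at p) v)) (at p)"
    by (rule has_derivative_compose [OF C1_on_has_derivative [OF assms(1) \<open>p \<in> U\<close>]
        has_field_derivative_imp_has_derivative [OF has_real_derivative_pos_part_power [OF assms(2)]]])
  then show "frechet_derivative (\<lambda>p. (max 0 (f p)) ^ n) (at p) v =
      n * (max 0 (f p)) ^ (n - 1) * frechet_derivative f (at p) v"
    using frechet_derivative_at by metis
qed

lemma divg_scaleR: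
  assumes "C1_on U w" "C1_on U Z" "p \<in> U"
  shows "divg (\<lambda>q. w q *\<^sub>R Z q) p = frechet_derivative w (at p) (Z p) + w p * divg Z p"
proof -
  have "((\<lambda>q. w q *\<^sub>R Z q) has_derivative (\<lambda>v. w p *\<^sub>R frechet_derivative Z (at p) v +
      frechet_derivative w (at p) v *\<^sub>R Z p)) (at p)"
    by (intro has_derivative_scaleR C1_on_has_derivative [OF assms(1,3)] C1_on_has_derivative [OF assms(2,3)])
  then have "frechet_derivative (\<lambda>q. w q *\<^sub>R Z q) (at p) = (\<lambda>v. w p *\<^sub>R frechet_derivative Z (at p) v +
      frechet_derivative w (at p) v *\<^sub>R Z p)"
    by (rule frechet_derivative_at [symmetric])
  moreover have "frechet_derivative w (at p) (Z p) = (\<Sum>b\<in>Basis. frechet_derivative w (at p) b * (Z p \<bullet> b))"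
    by (subst linear_eq_sum_Basis [OF C1_on_linear_derivative [OF assms(1,3)]]) (simp add: mult.commute)
  ultimately show ?thesis
    by (simp add: divg_def inner_add_left sum.distrib sum_distrib_left)
qed

section \<open>Normals and lifts along a hypersurface\<close>

lemma subspace_dim_le_1_multiple:
  fixes S :: "'e::euclidean_space set"
  assumes "subspace S" "dim S \<le> 1" "n \<in> S" "n \<noteq> 0" "m \<in> S"
  obtains k where "m = k *\<^sub>R n"
proof -
  have "S \<subseteq> span {n}"
    by (rule card_ge_dim_independent) (use assms in auto)
  then show thesis
    using assms(5) that by (auto simp: span_singleton)
qed

lemma kernel_multiple:
  fixes f :: "'e::euclidean_space \<Rightarrow> 'f::euclidean_space"
  assumes f: "linear f" and dim: "DIM('e) \<le> dim (range f) + 1"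
    and r: "f r = 0" "r \<noteq> 0" and v: "f v = 0"
  obtains k where "v = k *\<^sub>R r"
proof -
  define K where "K = {v. f v = 0}"
  have K: "subspace K"
    unfolding K_def by (rule linear_subspace_kernel [OF f])
  define O' where "O' = {y \<in> UNIV. \<forall>x\<in>K. orthogonal x y}"
  have "dim O' + dim K = DIM('e)"
    unfolding O'_def using dim_subspace_orthogonal_to_vectors [OF K subspace_UNIV] by simp
  moreover have "range f \<subseteq> f ` O'"
  proof clarify
    fix w
    obtain y z where yz: "y \<in> span K" "\<And>x. x \<in> span K \<Longrightarrow> orthogonal z x" "w = y + z"
      using orthogonal_subspace_decomp_exists [of K w] by metis
    have "y \<in> K" using yz(1) K by (simp add: span_eq_iff [THEN iffD2])
    then have "f w = f z" by (simp add: yz(3) linear_add [OF f] K_def)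
    moreover have "z \<in> O'"
      using yz(2) span_base by (auto simp: O'_def orthogonal_commute)
    ultimately show "f w \<in> f ` O'" by blast
  qed
  then have "dim (range f) \<le> dim O'"
    by (meson dim_image_le dim_subset f order_trans)
  ultimately have "dim K \<le> 1" using dim by linarith
  then show thesis
    using subspace_dim_le_1_multiple [OF K _ _ r(2), of v] r v that by (auto simp: K_def)
qed

definition flip :: "real \<times> 'a \<Rightarrow> real \<times> 'a::euclidean_space" where
  "flip w = (- fst w, snd w)"

lemma mink_eq_inner_flip: "mink u w = u \<bullet> flip w"
  by (simp add: mink_def flip_def inner_prod_def)

lemma mink_flip: "mink u (flip w) = u \<bullet> w"
  by (simp add: mink_def flip_def inner_prod_def)

lemma mink_eq_sum_Basis: "mink u w = (\<Sum>c\<in>Basis. mink c w * (u \<bullet> c))"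
  by (subst linear_eq_sum_Basis [OF linear_mink_left]) (simp add: mult.commute)

lemma mink_nondegenerate:
  assumes "\<And>w. mink w u = mink w u'" shows "u = u'"
proof -
  have "w \<bullet> flip u = w \<bullet> flip u'" for w
    using assms by (simp add: mink_eq_inner_flip)
  then have "flip u = flip u'"
    using vector_eq_ldot by blast
  then show ?thesis by (simp add: flip_def prod_eq_iff)
qed

lemma normal_unique_up_to_scale:
  fixes D :: "real \<times> 'a \<Rightarrow> real \<times> 'a::euclidean_space"
  assumes D: "linear D" "DIM('a) \<le> dim (range D)"
    and n: "\<And>v. mink (D v) n = 0" "n \<noteq> 0" and m: "\<And>v. mink (D v) m = 0"
  obtains k where "m = k *\<^sub>R n"
proof -
  define S where "S = {y \<in> UNIV. \<forall>x\<in>range D. orthogonal x y}"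
  have "dim S + dim (range D) = DIM(real \<times> 'a)"
    unfolding S_def
    using dim_subspace_orthogonal_to_vectors [OF linear_subspace_image [OF D(1) subspace_UNIV] subspace_UNIV]
    by simp
  then have "dim S \<le> 1" using D(2) by simp
  moreover have "subspace S"
    unfolding S_def subspace_def orthogonal_def by (auto simp: inner_add_right)
  moreover have "flip n \<in> S" "flip m \<in> S" "flip n \<noteq> 0"
    using n m by (auto simp: S_def orthogonal_def mink_eq_inner_flip flip_def prod_eq_iff)
  ultimately obtain k where "flip m = k *\<^sub>R flip n"
    using subspace_dim_le_1_multiple by blast
  then have "m = k *\<^sub>R n" by (auto simp: flip_def prod_eq_iff)
  then show thesis by (rule that)
qed

lemma unit_normal_unique_up_to_sign:
  fixes D :: "real \<times> 'a \<Rightarrow> real \<times> 'a::euclidean_space"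
  assumes "linear D" "DIM('a) \<le> dim (range D)"
    and "\<And>v. mink (D v) n = 0" "mink n n = 1" "\<And>v. mink (D v) m = 0" "mink m m = 1"
  shows "m = n \<or> m = - n"
proof -
  have "n \<noteq> 0" using assms(4) by (auto simp: mink_zero_left)
  obtain k where k: "m = k *\<^sub>R n"
    using normal_unique_up_to_scale [OF assms(1-3) \<open>n \<noteq> 0\<close> assms(5)] by blast
  then have "k * k = 1" using assms(4,6) by (simp add: mink_simps)
  then have "k = 1 \<or> k = -1" by (metis power2_eq_square power2_eq_1_iff)
  with k show ?thesis by auto
qed

text \<open>Local data along a hypersurface: a continuously differentiable unit normal \<open>\<nu>\<close>, and the lift
  \<open>B p w\<close> of the tangential part of an ambient vector \<open>w\<close> to the parameter domain. The parametrisation is constant along rays,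
  and the lift is made unique by being orthogonal to the radial direction. Vector fields of the
  ambient space thus act on functions of the parameters, and no basis of the tangent space is chosen.\<close>

locale frame =
  fixes \<phi> :: "real \<Rightarrow> 'a::euclidean_space \<Rightarrow> 'a" and W :: "(real \<times> 'a) set"
    and \<nu> :: "real \<times> 'a \<Rightarrow> real \<times> 'a" and B :: "real \<times> 'a \<Rightarrow> real \<times> 'a \<Rightarrow> real \<times> 'a"
  assumes open_W: "open W"
    and C1_param: "C1_on W (param \<phi>)"
    and C1_deriv: "C1_on W (\<lambda>p. frechet_derivative (param \<phi>) (at p) v)"
    and C1_normal: "C1_on W \<nu>"
    and unit: "p \<in> W \<Longrightarrow> mink (\<nu> p) (\<nu> p) = 1"
    and normal: "p \<in> W \<Longrightarrow> mink (frechet_derivative (param \<phi>) (at p) v) (\<nu> p) = 0"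
    and linear_lift: "p \<in> W \<Longrightarrow> linear (B p)"
    and C1_lift: "C1_on W (\<lambda>p. B p w)"
    and deriv_lift: "p \<in> W \<Longrightarrow> frechet_derivative (param \<phi>) (at p) (B p w) = w - mink w (\<nu> p) *\<^sub>R \<nu> p"
    and lift_tangent: "p \<in> W \<Longrightarrow> snd (B p w) \<bullet> snd p = 0"
    and lift_deriv: "p \<in> W \<Longrightarrow> snd v \<bullet> snd p = 0 \<Longrightarrow> B p (frechet_derivative (param \<phi>) (at p) v) = v"
begin

abbreviation D where "D p \<equiv> frechet_derivative (param \<phi>) (at p)"
abbreviation D\<nu> where "D\<nu> p \<equiv> frechet_derivative \<nu> (at p)"

lemma linear_D: "p \<in> W \<Longrightarrow> linear (D p)"
  using C1_on_linear_derivative [OF C1_param] .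

lemma linear_D\<nu>: "p \<in> W \<Longrightarrow> linear (D\<nu> p)"
  using C1_on_linear_derivative [OF C1_normal] .

lemma D\<nu>_normal: "p \<in> W \<Longrightarrow> mink (D\<nu> p \<xi>) (\<nu> p) = 0"
proof -
  assume p: "p \<in> W"
  have "((\<lambda>p. mink (\<nu> p) (\<nu> p)) has_derivative (\<lambda>\<xi>. mink (\<nu> p) (D\<nu> p \<xi>) + mink (D\<nu> p \<xi>) (\<nu> p))) (at p)"
    by (intro bounded_bilinear.FDERIV [OF bounded_bilinear_mink] C1_on_has_derivative [OF C1_normal p])
  moreover have "((\<lambda>p. mink (\<nu> p) (\<nu> p)) has_derivative (\<lambda>\<xi>. 0)) (at p)"
    by (rule has_derivative_transform_within_open [OF has_derivative_const open_W p]) (simp add: unit)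
  ultimately have "(\<lambda>\<xi>. mink (\<nu> p) (D\<nu> p \<xi>) + mink (D\<nu> p \<xi>) (\<nu> p)) = (\<lambda>\<xi>. 0)"
    by (rule has_derivative_unique)
  from fun_cong [OF this, of \<xi>] show ?thesis
    by (simp add: mink_commute [of "\<nu> p"])
qed

lemma weingarten:
  assumes p: "p \<in> W"
  shows "mink (frechet_derivative (\<lambda>q. D q \<eta>) (at p) \<xi>) (\<nu> p) = - mink (D\<nu> p \<xi>) (D p \<eta>)"
proof -
  have "((\<lambda>p. mink (D p \<eta>) (\<nu> p)) has_derivative
      (\<lambda>\<xi>. mink (D p \<eta>) (D\<nu> p \<xi>) + mink (frechet_derivative (\<lambda>q. D q \<eta>) (at p) \<xi>) (\<nu> p))) (at p)"
    by (intro bounded_bilinear.FDERIV [OF bounded_bilinear_mink] C1_on_has_derivative [OF C1_normal p]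
        C1_on_has_derivative [OF C1_deriv p])
  moreover have "((\<lambda>p. mink (D p \<eta>) (\<nu> p)) has_derivative (\<lambda>\<xi>. 0)) (at p)"
    by (rule has_derivative_transform_within_open [OF has_derivative_const open_W p]) (simp add: normal)
  ultimately have "(\<lambda>\<xi>. mink (D p \<eta>) (D\<nu> p \<xi>) +
      mink (frechet_derivative (\<lambda>q. D q \<eta>) (at p) \<xi>) (\<nu> p)) = (\<lambda>\<xi>. 0)"
    by (rule has_derivative_unique)
  from fun_cong [OF this, of \<xi>] show ?thesis
    by (simp add: mink_commute [of "D\<nu> p \<xi>"])
qed

lemma shape_symmetric:
  assumes p: "p \<in> W"
  shows "mink (D\<nu> p \<xi>) (D p \<eta>) = mink (D\<nu> p \<eta>) (D p \<xi>)"
  using weingarten [OF p, of \<eta> \<xi>] weingarten [OF p, of \<xi> \<eta>]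
    symmetric_second_derivative [OF open_W p C1_param C1_deriv, of \<eta> \<xi>] by simp

text \<open>The trace of the differential of the normal, computed in the ambient basis so that it depends
  continuously on the point.\<close>

definition trD :: "real \<times> 'a \<Rightarrow> real" where
  "trD p = (\<Sum>c\<in>Basis. D\<nu> p (B p c) \<bullet> c)"

lemma continuous_trD: "continuous_on W trD"
proof -
  have "continuous_on W (\<lambda>p. D\<nu> p (B p c))" for c
    by (rule continuous_on_linear_apply [where B = D\<nu> and f = "\<lambda>p. B p c"])
      (use linear_D\<nu> C1_on_imp_continuous_on [OF C1_lift] C1_on_continuous_derivative [OF C1_normal] in auto)
  then show ?thesis
    unfolding trD_def by (intro continuous_on_sum continuous_on_inner continuous_on_const)
qed

text \<open>Expanding the lift of each coordinate vector in the given orthogonal basis turns the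
  coordinate trace of the differential of the normal into the metric trace of the second
  fundamental form, up to sign.\<close>

lemma trD_eq:
  assumes p: "(t, x) \<in> W"
    and tr: "has_metric_trace (domain_tangent x) (first_form \<phi> t x) (second_form \<phi> t x (\<nu> (t, x))) H"
  shows "trD (t, x) = - H"
proof -
  let ?p = "(t, x)"
  let ?g = "first_form \<phi> t x"
  have g: "?g \<xi> \<eta> = mink (D ?p \<xi>) (D ?p \<eta>)" for \<xi> \<eta>
    by (simp add: first_form_def)
  have h: "second_form \<phi> t x (\<nu> ?p) \<xi> \<eta> = - mink (D\<nu> ?p \<xi>) (D ?p \<eta>)" for \<xi> \<eta>
    using weingarten [OF p, of \<eta> \<xi>] by (simp add: second_form_def)
  obtain \<B> where \<B>: "finite \<B>" "span \<B> = domain_tangent x" "pairwise (\<lambda>b c. ?g b c = 0) \<B>"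
      "\<And>b. b \<in> \<B> \<Longrightarrow> ?g b b \<noteq> 0" "H = (\<Sum>b\<in>\<B>. second_form \<phi> t x (\<nu> ?p) b b / ?g b b)"
    using tr unfolding has_metric_trace_def by blast
  have expand: "B ?p c = (\<Sum>b\<in>\<B>. (mink c (D ?p b) / ?g b b) *\<^sub>R b)" for c
  proof -
    have "B ?p c \<in> domain_tangent x"
      using lift_tangent [OF p, of c] by (auto simp: domain_tangent_def case_prod_beta)
    then have "B ?p c \<in> span \<B>" by (simp add: \<B>)
    then obtain u where u: "B ?p c = (\<Sum>b\<in>\<B>. u b *\<^sub>R b)"
      using \<B>(1) by (auto simp: span_finite)
    have "u b = mink c (D ?p b) / ?g b b" if b: "b \<in> \<B>" for b
    proof -
      have "mink c (D ?p b) = mink (D ?p (B ?p c)) (D ?p b)"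
        by (simp add: deriv_lift [OF p] mink_simps mink_commute [of "\<nu> ?p"] normal [OF p])
      also have "\<dots> = (\<Sum>b'\<in>\<B>. u b' * ?g b' b)"
        by (simp add: u linear_sum [OF linear_D [OF p]] linear_cmul [OF linear_D [OF p]] mink_sum_left
            mink_simps g)
      also have "\<dots> = (\<Sum>b'\<in>\<B>. if b' = b then u b * ?g b b else 0)"
        by (rule sum.cong [OF refl]) (use \<B>(3) b in \<open>auto simp: pairwise_def\<close>)
      also have "\<dots> = u b * ?g b b" using \<B>(1) b by simp
      finally show ?thesis using \<B>(4) [OF b] by simp
    qed
    then have "(\<Sum>b\<in>\<B>. u b *\<^sub>R b) = (\<Sum>b\<in>\<B>. (mink c (D ?p b) / ?g b b) *\<^sub>R b)"
      by (intro sum.cong refl arg_cong2 [where f = scaleR])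
    with u show ?thesis by (rule trans)
  qed
  have "trD ?p = (\<Sum>c\<in>Basis. \<Sum>b\<in>\<B>. (mink c (D ?p b) / ?g b b) * (D\<nu> ?p b \<bullet> c))"
    by (simp add: trD_def expand linear_sum [OF linear_D\<nu> [OF p]] linear_cmul [OF linear_D\<nu> [OF p]]
        inner_sum_left)
  also have "\<dots> = (\<Sum>b\<in>\<B>. \<Sum>c\<in>Basis. (mink c (D ?p b) * (D\<nu> ?p b \<bullet> c)) / ?g b b)"
    by (subst sum.swap) simp
  also have "\<dots> = (\<Sum>b\<in>\<B>. mink (D\<nu> ?p b) (D ?p b) / ?g b b)"
    by (simp only: sum_divide_distrib [symmetric] mink_eq_sum_Basis [symmetric])
  also have "\<dots> = - H"
    by (simp add: \<B>(5) h sum_negf)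
  finally show ?thesis .
qed

end

text \<open>Adding a fixed transversal vector in the radial direction makes the differential of the
  parametrisation invertible; normal and lift are then read off from the inverse.\<close>

lemma frame_exists:
  fixes \<phi> :: "real \<Rightarrow> 'a::euclidean_space \<Rightarrow> 'a"
  assumes U: "open U" "p\<^sub>0 \<in> U" "\<And>p. p \<in> U \<Longrightarrow> snd p \<noteq> 0"
    and C1: "C1_on U (param \<phi>)" and C2: "\<And>v. C1_on U (\<lambda>p. frechet_derivative (param \<phi>) (at p) v)"
    and radial: "\<And>p. p \<in> U \<Longrightarrow> frechet_derivative (param \<phi>) (at p) (0, snd p) = 0"
    and dim: "DIM('a) \<le> dim (range (frechet_derivative (param \<phi>) (at p\<^sub>0)))"
    and n\<^sub>0: "mink n\<^sub>0 n\<^sub>0 = 1" "\<And>v. mink (frechet_derivative (param \<phi>) (at p\<^sub>0) v) n\<^sub>0 = 0"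
  obtains W \<nu> B where "frame \<phi> W \<nu> B" "p\<^sub>0 \<in> W" "W \<subseteq> U" "\<nu> p\<^sub>0 = n\<^sub>0"
proof -
  let ?D = "\<lambda>p. frechet_derivative (param \<phi>) (at p)"
  define L where "L p v = ?D p v + (snd v \<bullet> snd p) *\<^sub>R n\<^sub>0" for p v
  have linD: "linear (?D p)" if "p \<in> U" for p
    using C1_on_linear_derivative [OF C1 that] .
  have linL: "linear (L p)" if "p \<in> U" for p
    unfolding L_def
    by (rule linearI) (simp_all add: linear_add [OF linD [OF that]] linear_cmul [OF linD [OF that]]
        algebra_simps)
  have C1snd: "C1_on U snd"
    by (rule C1_on_bounded_linear [OF bounded_linear_snd])
  have C1L: "C1_on U (\<lambda>p. L p v)" for v
    unfolding L_def by (intro C1_on_add C2 C1_on_scaleR C1_on_inner C1_on_const C1snd)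
  have "v = 0" if "L p\<^sub>0 v = 0" for v
  proof -
    have "mink (L p\<^sub>0 v) n\<^sub>0 = snd v \<bullet> snd p\<^sub>0"
      by (simp add: L_def mink_simps n\<^sub>0)
    then have tan: "snd v \<bullet> snd p\<^sub>0 = 0"
      using that by (simp add: mink_zero_left)
    then have "?D p\<^sub>0 v = 0" using that by (simp add: L_def)
    then obtain k where "v = k *\<^sub>R (0, snd p\<^sub>0)"
      using kernel_multiple [OF linD [OF U(2)] _ radial [OF U(2)], of v] dim U(2,3)
      by (auto simp: prod_eq_iff)
    with tan U(2,3) show ?thesis by (auto simp: zero_prod_def)
  qed
  then have inj: "inj (L p\<^sub>0)"
    using linear_injective_0 [OF linL [OF U(2)]] by blast
  obtain W\<^sub>0 K where W\<^sub>0: "open W\<^sub>0" "p\<^sub>0 \<in> W\<^sub>0" "W\<^sub>0 \<subseteq> U" and linK: "\<And>p. p \<in> W\<^sub>0 \<Longrightarrow> linear (K p)"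
    and LK: "\<And>p w. p \<in> W\<^sub>0 \<Longrightarrow> L p (K p w) = w" and KL: "\<And>p v. p \<in> W\<^sub>0 \<Longrightarrow> K p (L p v) = v"
    and C1K: "\<And>w. C1_on W\<^sub>0 (\<lambda>p. K p w)"
    by (rule C1_on_inverse_linear [where L = L and U = U and p\<^sub>0 = p\<^sub>0])
      (rule U linL C1L inj | assumption | blast)+
  define l where "l p w = snd (K p w) \<bullet> snd p" for p w
  have linl: "linear (l p)" if "p \<in> W\<^sub>0" for p
    unfolding l_def
    by (rule linearI) (simp_all add: linear_add [OF linK [OF that]] linear_cmul [OF linK [OF that]] inner_add_left)
  have KD: "K p (?D p v) = v" if "p \<in> W\<^sub>0" "snd v \<bullet> snd p = 0" for p v
    using KL [OF that(1), of v] that(2) by (simp add: L_def)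
  have lD: "l p (?D p v) = 0" if p: "p \<in> W\<^sub>0" for p v
  proof -
    define k where "k = (snd v \<bullet> snd p) / (snd p \<bullet> snd p)"
    have "snd p \<noteq> 0" using p W\<^sub>0 U(3) by blast
    then have 0: "snd (v - k *\<^sub>R (0, snd p)) \<bullet> snd p = 0"
      by (simp add: k_def inner_diff_left)
    have pU: "p \<in> U" using p W\<^sub>0(3) by blast
    note lin = linD [OF pU] and rad = radial [OF pU]
    have "?D p (v - k *\<^sub>R (0, snd p)) = ?D p v"
      by (simp only: linear_diff [OF lin] linear_cmul [OF lin] rad) simp
    then show ?thesis
      using KD [OF p 0] 0 by (simp add: l_def)
  qed
  have C1snd': "C1_on W\<^sub>0 snd"
    using C1snd W\<^sub>0(3) by (rule C1_on_subset)
  have C1l: "C1_on W\<^sub>0 (\<lambda>p. l p w)" for w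
  proof -
    have "C1_on W\<^sub>0 (\<lambda>p. snd (K p w))"
      by (rule C1_on_bounded_linear_compose [OF bounded_linear_snd C1K])
    then show ?thesis
      unfolding l_def by (rule C1_on_inner [OF _ C1snd'])
  qed
  define N where "N p = (\<Sum>c\<in>Basis. l p c *\<^sub>R flip c)" for p
  have C1N: "C1_on W\<^sub>0 N"
    unfolding N_def by (intro C1_on_sum C1_on_scaleR C1l C1_on_const)
  have mN: "mink w (N p) = l p w" if "p \<in> W\<^sub>0" for p w
    unfolding N_def
    by (subst linear_eq_sum_Basis [OF linl [OF that], of w])
      (simp add: mink_sum_right mink_simps mink_flip mult.commute)
  have N0: "N p\<^sub>0 = n\<^sub>0"
  proof (rule mink_nondegenerate)
    fix w
    define v where "v = K p\<^sub>0 w"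
    have "w = ?D p\<^sub>0 v + (snd v \<bullet> snd p\<^sub>0) *\<^sub>R n\<^sub>0"
      using LK [OF W\<^sub>0(2), of w] by (simp add: L_def v_def)
    then have "mink w n\<^sub>0 = mink (?D p\<^sub>0 v + (snd v \<bullet> snd p\<^sub>0) *\<^sub>R n\<^sub>0) n\<^sub>0" by simp
    also have "\<dots> = snd v \<bullet> snd p\<^sub>0" by (simp add: mink_simps n\<^sub>0)
    finally show "mink w (N p\<^sub>0) = mink w n\<^sub>0"
      by (simp add: mN [OF W\<^sub>0(2)] l_def v_def)
  qed
  define W where "W = {p\<in>W\<^sub>0. mink (N p) (N p) > 0}"
  have C1NN: "C1_on W\<^sub>0 (\<lambda>p. mink (N p) (N p))"
    by (rule C1_on_mink [OF C1N C1N])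
  have W: "open W" "p\<^sub>0 \<in> W" "W \<subseteq> W\<^sub>0"
    using continuous_open_preimage [OF C1_on_imp_continuous_on [OF C1NN] W\<^sub>0(1) open_greaterThan [of 0]]
      W\<^sub>0(2) by (auto simp: W_def N0 n\<^sub>0 vimage_def Int_def)
  have WU: "W \<subseteq> U" using W W\<^sub>0 by blast
  define \<nu> where "\<nu> p = (1 / sqrt (mink (N p) (N p))) *\<^sub>R N p" for p
  have C1\<nu>: "C1_on W \<nu>"
    unfolding \<nu>_def
  proof (rule C1_on_scaleR [OF C1_on_compose_real [where h = "\<lambda>s. 1 / sqrt s"]])
    show "C1_on W (\<lambda>p. mink (N p) (N p))" "C1_on W N"
      using C1NN C1N W(3) C1_on_subset by blast+
    show "((\<lambda>s. 1 / sqrt s) has_real_derivative - (1 / (2 * sqrt s)) / (sqrt s * sqrt s)) (at s)"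
      if "s \<in> (\<lambda>p. mink (N p) (N p)) ` W" for s
      using that by (auto intro!: derivative_eq_intros simp: W_def field_simps)
    show "continuous_on ((\<lambda>p. mink (N p) (N p)) ` W) (\<lambda>s. - (1 / (2 * sqrt s)) / (sqrt s * sqrt s))"
      by (intro continuous_intros) (auto simp: W_def)
  qed
  have pos: "mink (N p) (N p) > 0" if "p \<in> W" for p
    using that by (simp add: W_def)
  have unit: "mink (\<nu> p) (\<nu> p) = 1" if "p \<in> W" for p
    using pos [OF that] by (simp add: \<nu>_def mink_simps)
  have m\<nu>: "mink w (\<nu> p) = l p w / sqrt (mink (N p) (N p))" if "p \<in> W" for w p
    using mN [OF subsetD [OF W(3) that], of w] by (simp add: \<nu>_def mink_simps)
  define B where "B p w = K p (w - mink w (\<nu> p) *\<^sub>R \<nu> p)" for p w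
  have l0: "l p (w - mink w (\<nu> p) *\<^sub>R \<nu> p) = 0" if p: "p \<in> W" for p w
  proof -
    have "mink (w - mink w (\<nu> p) *\<^sub>R \<nu> p) (\<nu> p) = 0"
      by (simp add: mink_simps unit [OF p])
    then show ?thesis using m\<nu> [OF p] pos [OF p] by simp
  qed
  have fr: "frame \<phi> W \<nu> B"
  proof (rule frame.intro)
    show "open W" by (rule W)
    show "C1_on W (param \<phi>)" "C1_on W (\<lambda>p. ?D p v)" for v
      using C1 C2 WU C1_on_subset by blast+
    show "C1_on W \<nu>" by (rule C1\<nu>)
    show "C1_on W (\<lambda>p. B p w)" for w
      unfolding B_def
    proof (rule C1_on_linear_apply [where B = K, OF W(1)])
      show "C1_on W (\<lambda>p. K p v)" for v using C1K W(3) C1_on_subset by blast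
      show "C1_on W (\<lambda>p. w - mink w (\<nu> p) *\<^sub>R \<nu> p)"
        by (intro C1_on_diff C1_on_scaleR C1_on_mink C1_on_const C1\<nu>)
    qed (use linK W in auto)
    fix p assume p: "p \<in> W"
    then have p': "p \<in> W\<^sub>0" using W by auto
    show "mink (\<nu> p) (\<nu> p) = 1" by (rule unit [OF p])
    show nm: "mink (?D p v) (\<nu> p) = 0" for v
      by (simp add: m\<nu> [OF p] lD [OF p'])
    show "linear (B p)"
      unfolding B_def
      by (rule linearI)
        (simp_all add: linear_add [OF linK [OF p'], symmetric] linear_cmul [OF linK [OF p'], symmetric]
          mink_simps algebra_simps)
    show tan: "snd (B p w) \<bullet> snd p = 0" for w
      using l0 [OF p] by (simp add: l_def B_def)
    show "?D p (B p w) = w - mink w (\<nu> p) *\<^sub>R \<nu> p" for w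
      using LK [OF p', of "w - mink w (\<nu> p) *\<^sub>R \<nu> p"] tan [of w] by (simp add: L_def B_def)
    show "B p (?D p v) = v" if "snd v \<bullet> snd p = 0" for v
      using KD [OF p' that] by (simp add: B_def nm)
  qed
  have "\<nu> p\<^sub>0 = n\<^sub>0" by (simp add: \<nu>_def N0 n\<^sub>0)
  with fr W WU show thesis using that by blast
qed

section \<open>The energy current\<close>

text \<open>The energy-momentum tensor \<open>v \<otimes> v - \<langle>v, v\<rangle> / 2\<close> contracted with the time direction.\<close>

definition current :: "real \<times> 'a::euclidean_space \<Rightarrow> real \<times> 'a" where
  "current v = mink v (1, 0) *\<^sub>R v - (mink v v / 2) *\<^sub>R (1, 0)"

lemma norm_current_le: "norm (current v) \<le> 2 * (norm v)\<^sup>2" for v :: "real \<times> 'a::euclidean_space"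
proof -
  have n: "norm (flip w) = norm w" for w :: "real \<times> 'a"
    by (simp add: flip_def norm_prod_def)
  have m: "\<bar>mink u w\<bar> \<le> norm u * norm w" for u w :: "real \<times> 'a"
    using Cauchy_Schwarz_ineq2 [of u "flip w"] by (simp add: mink_eq_inner_flip n)
  have "norm (current v) \<le> norm (mink v (1, 0) *\<^sub>R v) + norm ((mink v v / 2) *\<^sub>R (1 :: real, 0 :: 'a))"
    unfolding current_def by (rule norm_triangle_ineq4)
  also have "\<dots> \<le> norm v * norm v + norm v * norm v / 2"
    using mult_right_mono [OF m [of v "(1, 0)"] norm_ge_zero [of v]] m [of v v]
    by (intro add_mono) (simp_all add: norm_Pair)
  also have "\<dots> \<le> 2 * (norm v)\<^sup>2" by (simp add: power2_eq_square)
  finally show ?thesis .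
qed

lemma C1_on_current:
  assumes f: "C1_on U f" shows "C1_on U (\<lambda>p. current (f p))"
proof -
  have "C1_on U (\<lambda>p. mink (f p) (f p) / 2)"
    unfolding divide_inverse by (rule C1_on_mult [OF C1_on_mink [OF f f] C1_on_const])
  then show ?thesis
    unfolding current_def
    by (rule C1_on_diff [OF C1_on_scaleR [OF C1_on_mink [OF f C1_on_const] f] C1_on_scaleR [OF _ C1_on_const]])
qed

lemma has_derivative_current:
  assumes f: "(f has_derivative f') (at p)"
  shows "((\<lambda>p. current (f p)) has_derivative (\<lambda>h. mink (f' h) (1, 0) *\<^sub>R f p + mink (f p) (1, 0) *\<^sub>R f' h
      - mink (f' h) (f p) *\<^sub>R (1, 0))) (at p)"
proof -
  note md = bounded_bilinear.FDERIV [OF bounded_bilinear_mink]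
  have "((\<lambda>p. mink (f p) (f p) * (1 / 2)) has_derivative
      (\<lambda>h. (mink (f p) (f' h) + mink (f' h) (f p)) * (1 / 2))) (at p)"
    by (rule has_derivative_mult_left [OF md [OF f f]])
  then have *: "((\<lambda>p. mink (f p) (f p) / 2) has_derivative (\<lambda>h. mink (f' h) (f p))) (at p)"
    by (simp add: mink_commute [of "f p"])
  have "((\<lambda>p. mink (f p) (1, 0)) has_derivative (\<lambda>h. mink (f p) 0 + mink (f' h) (1, 0))) (at p)"
    by (rule md [OF f has_derivative_const])
  then have **: "((\<lambda>p. mink (f p) (1, 0)) has_derivative (\<lambda>h. mink (f' h) (1, 0))) (at p)"
    by (simp add: mink_zero_right)
  show ?thesis
    unfolding current_def
    by (rule has_derivative_eq_rhs [OF has_derivative_diff [OF has_derivative_scaleR [OF ** f]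
          has_derivative_scaleR_left [OF *]]]) (simp add: fun_eq_iff add.commute)
qed

text \<open>The dominant energy condition: the flux of the current through a future causal direction is
  non-negative.\<close>

lemma mink_current_ge:
  "mink (current v) m \<ge> (fst m - norm (snd m)) * (norm v)\<^sup>2 / 2" for v m :: "real \<times> 'a::euclidean_space"
proof -
  define a x where "a = fst v" and "x = snd v"
  define b y where "b = fst m" and "y = snd m"
  have "mink (current v) m = b * (a\<^sup>2 + (norm x)\<^sup>2) / 2 - a * (x \<bullet> y)"
    by (simp add: current_def mink_def a_def x_def b_def y_def dot_square_norm power2_eq_square
        inner_diff_left field_simps)
  moreover have "a * (x \<bullet> y) \<le> norm y * ((a\<^sup>2 + (norm x)\<^sup>2) / 2)"
  proof -
    have "a * (x \<bullet> y) \<le> \<bar>a\<bar> * (norm x * norm y)"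
      using mult_left_mono [OF Cauchy_Schwarz_ineq2 [of x y] abs_ge_zero [of a]] abs_ge_self [of "a * (x \<bullet> y)"]
      by (simp add: abs_mult)
    also have "\<dots> = norm y * (\<bar>a\<bar> * norm x)" by simp
    also have "\<dots> \<le> norm y * ((a\<^sup>2 + (norm x)\<^sup>2) / 2)"
      using sum_squares_bound [of "\<bar>a\<bar>" "norm x"] by (intro mult_left_mono) auto
    finally show ?thesis .
  qed
  moreover have "(norm v)\<^sup>2 = a\<^sup>2 + (norm x)\<^sup>2"
    by (simp add: norm_prod_def a_def x_def)
  moreover have "(b - norm y) * S / 2 = b * S / 2 - norm y * (S / 2)" for S :: real
    by (simp add: field_simps)
  ultimately show ?thesis
    unfolding b_def [symmetric] y_def [symmetric] by simp
qed

lemma mink_self: "mink u u = (norm (snd u))\<^sup>2 - (fst u)\<^sup>2"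
  by (simp add: mink_def dot_square_norm power2_eq_square)

lemma unit_normal_norms:
  assumes "mink n n = 1"
  shows "(norm (snd n))\<^sup>2 = 1 + (fst n)\<^sup>2" "\<bar>fst n\<bar> * norm (snd n) \<le> 1 / 2 + (fst n)\<^sup>2"
proof -
  show *: "(norm (snd n))\<^sup>2 = 1 + (fst n)\<^sup>2"
    using assms by (simp add: mink_def dot_square_norm power2_eq_square)
  show "\<bar>fst n\<bar> * norm (snd n) \<le> 1 / 2 + (fst n)\<^sup>2"
    using sum_squares_bound [of "\<bar>fst n\<bar>" "norm (snd n)"] * by simp
qed

text \<open>With respect to the time direction, the projection of that direction to a time-like hyperplane
  stays away from the light cone, uniformly in the hyperplane. So the energy density controls all
  components of \<open>v\<close>, including the one normal to the hyperplane.\<close>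

lemma mink_current_time_projection:
  assumes "mink n n = 1"
  shows "mink (current v) ((1, 0) - mink (1, 0) n *\<^sub>R n) \<ge> (norm v)\<^sup>2 / 4"
proof -
  let ?m = "(1, 0) - mink (1, 0) n *\<^sub>R n"
  have "fst ?m = 1 + (fst n)\<^sup>2" "norm (snd ?m) = \<bar>fst n\<bar> * norm (snd n)"
    by (auto simp: mink_def power2_eq_square)
  then have "1 / 2 \<le> fst ?m - norm (snd ?m)"
    using unit_normal_norms(2) [OF assms] by linarith
  from mult_right_mono [OF this, of "(norm v)\<^sup>2 / 2"] mink_current_ge [of ?m v]
  show ?thesis by simp
qed

text \<open>The projection of a null direction is causal, since its square is minus the square of the normal
  component, and it still points to the future.\<close>

lemma mink_current_null_projection:
  assumes n: "mink n n = 1" and e: "norm e = 1"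
  shows "mink (current v) ((1, e) - mink (1, e) n *\<^sub>R n) \<ge> 0"
proof -
  define k where "k = mink (1, e) n"
  let ?m = "(1, e) - k *\<^sub>R n"
  have k: "k = e \<bullet> snd n - fst n" by (simp add: k_def mink_def)
  have "mink ?m ?m = mink (1, e) (1, e) - k * mink (1, e) n - k * (mink n (1, e) - k * mink n n)"
    by (simp only: mink_diff_left mink_diff_right mink_scaleR_left mink_scaleR_right)
      (simp add: algebra_simps)
  also have "mink (1, e) (1, e) = 0" using e by (simp add: mink_def norm_eq_1)
  also have "0 - k * mink (1, e) n - k * (mink n (1, e) - k * mink n n) = - (k\<^sup>2)"
    unfolding mink_commute [of n "(1, e)"] k_def [symmetric] n by (simp add: power2_eq_square)
  finally have "mink ?m ?m \<le> 0" by simp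
  then have "(norm (snd ?m))\<^sup>2 \<le> (fst ?m)\<^sup>2"
    unfolding mink_self by linarith
  moreover have "fst ?m \<ge> 0"
  proof -
    have "fst n * (e \<bullet> snd n) \<le> \<bar>fst n\<bar> * norm (snd n)"
      using mult_left_mono [OF Cauchy_Schwarz_ineq2 [of e "snd n"] abs_ge_zero [of "fst n"]]
        abs_ge_self [of "fst n * (e \<bullet> snd n)"] e
      by (simp add: abs_mult)
    then show ?thesis
      using unit_normal_norms(2) [OF n] by (simp add: k algebra_simps power2_eq_square)
  qed
  ultimately have "norm (snd ?m) \<le> fst ?m"
    using abs_le_square_iff [of "norm (snd ?m)" "fst ?m"] by simp
  then have "0 \<le> (fst ?m - norm (snd ?m)) * (norm v)\<^sup>2 / 2" by simp
  also have "\<dots> \<le> mink (current v) ?m" by (rule mink_current_ge)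
  finally show ?thesis by (simp add: k_def)
qed

context frame begin

text \<open>\<open>deviation P\<close> vanishes where the hypersurface agrees to first order with the hyperboloid of
  centre \<open>P\<close>, on which the position vector relative to \<open>P\<close> is the outward normal.\<close>

definition deviation :: "real \<times> 'a \<Rightarrow> real \<times> 'a \<Rightarrow> real \<times> 'a" where
  "deviation P p = \<nu> p + param \<phi> p - P"

definition flux :: "real \<times> 'a \<Rightarrow> real \<times> 'a \<Rightarrow> real \<times> 'a" where
  "flux P p = B p (current (deviation P p))"

lemma C1_deviation: "C1_on W (deviation P)"
  unfolding deviation_def by (rule C1_on_diff [OF C1_on_add [OF C1_normal C1_param] C1_on_const])

lemma has_derivative_deviation:
  "p \<in> W \<Longrightarrow> (deviation P has_derivative (\<lambda>h. D\<nu> p h + D p h)) (at p)"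
proof -
  assume p: "p \<in> W"
  have "((\<lambda>p. \<nu> p + param \<phi> p - P) has_derivative (\<lambda>h. D\<nu> p h + D p h - 0)) (at p)"
    by (intro has_derivative_diff has_derivative_add has_derivative_const
        C1_on_has_derivative [OF C1_normal p] C1_on_has_derivative [OF C1_param p])
  then show ?thesis by (simp add: deviation_def [abs_def])
qed

definition Dcurrent :: "real \<times> 'a \<Rightarrow> real \<times> 'a \<Rightarrow> real \<times> 'a \<Rightarrow> real \<times> 'a" where
  "Dcurrent P p h = mink (D\<nu> p h + D p h) (1, 0) *\<^sub>R deviation P p
      + mink (deviation P p) (1, 0) *\<^sub>R (D\<nu> p h + D p h) - mink (D\<nu> p h + D p h) (deviation P p) *\<^sub>R (1, 0)"

lemma has_derivative_current_deviation:
  "p \<in> W \<Longrightarrow> ((\<lambda>p. current (deviation P p)) has_derivative Dcurrent P p) (at p)"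
  unfolding Dcurrent_def [abs_def] by (rule has_derivative_current [OF has_derivative_deviation])

lemma C1_flux: "C1_on W (flux P)"
  unfolding flux_def
  by (rule C1_on_linear_apply [where B = B, OF open_W linear_lift C1_lift C1_on_current [OF C1_deviation]])

lemma has_derivative_flux:
  assumes p: "p \<in> W"
  shows "(flux P has_derivative (\<lambda>h. \<Sum>c\<in>Basis. (current (deviation P p) \<bullet> c) *\<^sub>R
      frechet_derivative (\<lambda>q. B q c) (at p) h + (Dcurrent P p h \<bullet> c) *\<^sub>R B p c)) (at p)"
proof (rule has_derivative_transform_within_open [OF _ open_W p])
  show "((\<lambda>q. \<Sum>c\<in>Basis. (current (deviation P q) \<bullet> c) *\<^sub>R B q c) has_derivative
      (\<lambda>h. \<Sum>c\<in>Basis. (current (deviation P p) \<bullet> c) *\<^sub>R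
      frechet_derivative (\<lambda>q. B q c) (at p) h + (Dcurrent P p h \<bullet> c) *\<^sub>R B p c)) (at p)"
    by (rule has_derivative_sum [OF has_derivative_scaleR [OF has_derivative_inner_left
            [OF has_derivative_current_deviation [OF p]] C1_on_has_derivative [OF C1_lift p]]])
  show "(\<Sum>c\<in>Basis. (current (deviation P q) \<bullet> c) *\<^sub>R B q c) = flux P q" if "q \<in> W" for q
    unfolding flux_def by (rule linear_eq_sum_Basis [OF linear_lift [OF that], symmetric])
qed

text \<open>The deviation has a symmetric differential, as the shape operator is symmetric, and a
  trace-free one, as the mean curvature is that of the hyperboloid. Hence the tangential trace of
  the differential of the current vanishes, and what remains is quadratic in the deviation: the
  differential of the lift, applied to the current.\<close>

lemma divg_flux:
  assumes p: "p \<in> W" and tr: "trD p = - real DIM('a)"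
  shows "divg (flux P) p = (\<Sum>c\<in>Basis. (current (deviation P p) \<bullet> c) * divg (\<lambda>q. B q c) p)"
proof -
  let ?V = "deviation P p"
  define E where "E = (1 :: real, 0 :: 'a)"
  define DV where "DV h = D\<nu> p h + D p h" for h
  have linDV: "linear DV"
    unfolding DV_def using linear_D [OF p] linear_D\<nu> [OF p] by (rule linear_compose_add [rotated])
  note linB = linear_lift [OF p]
  have DVn: "mink (DV h) (\<nu> p) = 0" for h
    by (simp add: DV_def mink_simps D\<nu>_normal [OF p] normal [OF p])
  have red: "mink (DV h) w = mink (DV h) (D p (B p w))" for h w
    by (simp add: deriv_lift [OF p] mink_simps DVn)
  have sym: "mink (DV (B p u)) w = mink (DV (B p w)) u" for u w
  proof -
    have "mink (DV (B p u)) w = mink (DV (B p u)) (D p (B p w))" by (rule red)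
    also have "\<dots> = mink (DV (B p w)) (D p (B p u))"
      unfolding DV_def mink_add_left using shape_symmetric [OF p] by (simp add: mink_commute)
    also have "\<dots> = mink (DV (B p w)) u" by (rule red [symmetric])
    finally show ?thesis .
  qed
  have trV: "(\<Sum>c\<in>Basis. DV (B p c) \<bullet> c) = 0"
  proof -
    have "(\<Sum>c\<in>Basis. D p (B p c) \<bullet> c) = (\<Sum>c\<in>Basis. c \<bullet> c - mink c (\<nu> p) * (\<nu> p \<bullet> c))"
      by (simp add: deriv_lift [OF p] inner_diff_left)
    also have "\<dots> = real DIM(real \<times> 'a) - mink (\<nu> p) (\<nu> p)"
      unfolding sum_subtractf mink_eq_sum_Basis [of "\<nu> p" "\<nu> p", symmetric] by simp
    finally have "(\<Sum>c\<in>Basis. D p (B p c) \<bullet> c) = real DIM('a)"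
      by (simp add: unit [OF p])
    then show ?thesis
      using tr by (simp add: DV_def trD_def inner_add_left sum.distrib)
  qed
  have linsum: "(\<Sum>c\<in>Basis. g c * (v \<bullet> c)) = g v" if "linear g" for g :: "real \<times> 'a \<Rightarrow> real" and v
    by (subst (2) linear_eq_sum_Basis [OF that]) (simp add: mult.commute)
  have linm: "linear (\<lambda>w. mink (DV (B p w)) u)" for u
    by (rule linearI) (simp_all add: linear_add [OF linB] linear_cmul [OF linB] linear_add [OF linDV]
        linear_cmul [OF linDV] mink_simps)
  have "(\<Sum>c\<in>Basis. Dcurrent P p (B p c) \<bullet> c) =
      (\<Sum>c\<in>Basis. mink (DV (B p c)) E * (?V \<bullet> c) + mink ?V E * (DV (B p c) \<bullet> c)
        - mink (DV (B p c)) ?V * (E \<bullet> c))"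
    by (simp add: Dcurrent_def E_def [symmetric] DV_def inner_add_left inner_diff_left)
  also have "\<dots> = mink (DV (B p ?V)) E + mink ?V E * 0 - mink (DV (B p E)) ?V"
    unfolding sum.distrib sum_subtractf sum_distrib_left [symmetric] trV
    by (simp only: linsum [OF linm])
  also have "\<dots> = 0" using sym [of ?V E] by simp
  finally have 0: "(\<Sum>c\<in>Basis. Dcurrent P p (B p c) \<bullet> c) = 0" .
  have linJ: "linear (Dcurrent P p)"
    using has_derivative_current_deviation [OF p] has_derivative_linear by blast
  have "divg (flux P) p = (\<Sum>b\<in>Basis. \<Sum>c\<in>Basis. (current ?V \<bullet> c) *
      (frechet_derivative (\<lambda>q. B q c) (at p) b \<bullet> b) + (Dcurrent P p b \<bullet> c) * (B p c \<bullet> b))"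
    unfolding divg_def frechet_derivative_at [OF has_derivative_flux [OF p], symmetric]
    by (simp add: inner_sum_left inner_add_left)
  also have "\<dots> = (\<Sum>c\<in>Basis. \<Sum>b\<in>Basis. (current ?V \<bullet> c) *
      (frechet_derivative (\<lambda>q. B q c) (at p) b \<bullet> b) + (Dcurrent P p b \<bullet> c) * (B p c \<bullet> b))"
    by (rule sum.swap)
  also have "\<dots> = (\<Sum>c\<in>Basis. (current ?V \<bullet> c) * divg (\<lambda>q. B q c) p) +
      (\<Sum>c\<in>Basis. Dcurrent P p (B p c) \<bullet> c)"
  proof -
    have "(\<Sum>b\<in>Basis. (Dcurrent P p b \<bullet> c) * (B p c \<bullet> b)) = Dcurrent P p (B p c) \<bullet> c" for c
      by (subst (2) linear_eq_sum_Basis [OF linJ]) (simp add: inner_sum_left mult.commute)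
    then show ?thesis
      by (simp add: sum.distrib divg_def sum_distrib_left)
  qed
  finally show ?thesis using 0 by simp
qed

lemma continuous_divg_lift: "continuous_on W (divg (\<lambda>q. B q c))"
  unfolding divg_def
  by (rule continuous_on_sum [OF continuous_on_inner [OF C1_on_continuous_derivative [OF C1_lift]
        continuous_on_const]])

lemma deriv_flux:
  assumes "p \<in> W"
  shows "mink (D p (flux P p)) l = mink (current (deviation P p)) (l - mink l (\<nu> p) *\<^sub>R \<nu> p)"
  by (simp add: flux_def deriv_lift [OF assms] mink_simps mink_commute [of l "\<nu> p"])

lemma frame_subset:
  assumes "open S" "S \<subseteq> W" shows "frame \<phi> S \<nu> B"
proof (rule frame.intro)
  show "open S" by (rule assms)
  show "C1_on S (param \<phi>)" "C1_on S (\<lambda>p. D p v)" "C1_on S \<nu>" "C1_on S (\<lambda>p. B p w)" for v w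
    by (rule C1_on_subset [OF _ assms(2)], rule C1_param C1_deriv C1_normal C1_lift)+
  fix p assume "p \<in> S"
  then have p: "p \<in> W" using assms(2) by blast
  show "mink (\<nu> p) (\<nu> p) = 1" "linear (B p)" "mink (D p v) (\<nu> p) = 0"
    "D p (B p w) = w - mink w (\<nu> p) *\<^sub>R \<nu> p" "snd (B p w) \<bullet> snd p = 0" for v w
    by (rule unit [OF p] linear_lift [OF p] normal [OF p] deriv_lift [OF p] lift_tangent [OF p])+
  show "B p (D p v) = v" if "snd v \<bullet> snd p = 0" for v
    by (rule lift_deriv [OF p that])
qed

end

section \<open>Time-like hypersurfaces of constant mean curvature\<close>

lemma has_metric_trace_transfer:
  assumes S: "linear S" "inj S" "S ` V = V'"
    and g: "\<And>u w. g' (S u) (S w) = g u w" and h: "\<And>u w. h' (S u) (S w) = h u w"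
    and tr: "has_metric_trace V g h r"
  shows "has_metric_trace V' g' h' r"
proof -
  obtain \<B> where \<B>: "finite \<B>" "independent \<B>" "span \<B> = V" "pairwise (\<lambda>b c. g b c = 0) \<B>"
      "\<forall>b\<in>\<B>. g b b \<noteq> 0" "r = (\<Sum>b\<in>\<B>. h b b / g b b)"
    using tr unfolding has_metric_trace_def by blast
  have inj: "inj_on S \<B>" using S(2) inj_on_subset by blast
  show ?thesis
    unfolding has_metric_trace_def
  proof (intro exI [of _ "S ` \<B>"] conjI)
    show "finite (S ` \<B>)" using \<B>(1) by simp
    show "independent (S ` \<B>)"
      using linear_independent_injective_image [OF S(1) \<B>(2)] S(2) inj_on_subset by blast
    show "span (S ` \<B>) = V'"
      using linear_span_image [OF S(1), of \<B>] \<B>(3) S(3) by simp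
    show "pairwise (\<lambda>b c. g' b c = 0) (S ` \<B>)"
      using \<B>(4) g by (auto simp: pairwise_def)
    show "\<forall>b\<in>S ` \<B>. g' b b \<noteq> 0" using \<B>(5) g by simp
    show "r = (\<Sum>b\<in>S ` \<B>. h' b b / g' b b)"
      using \<B>(6) by (simp add: sum.reindex [OF inj] g h)
  qed
qed

lemma has_metric_trace_uminus:
  "has_metric_trace V g h r \<Longrightarrow> has_metric_trace V g (\<lambda>u w. - h u w) (- r)"
  unfolding has_metric_trace_def by (fastforce simp: sum_negf)

lemma frechet_derivative_linear_change:
  assumes U: "open U" "p \<in> U" and S: "bounded_linear S" and eq: "\<And>q. q \<in> U \<Longrightarrow> f (S q) = g q"
    and f: "f differentiable (at (S p))"
  shows "frechet_derivative f (at (S p)) (S v) = frechet_derivative g (at p) v"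
proof -
  have "((\<lambda>q. f (S q)) has_derivative (\<lambda>v. frechet_derivative f (at (S p)) (S v))) (at p)"
    by (rule has_derivative_compose [OF bounded_linear_imp_has_derivative [OF S]
        frechet_derivative_works [THEN iffD1, OF f]])
  then have "(g has_derivative (\<lambda>v. frechet_derivative f (at (S p)) (S v))) (at p)"
    by (rule has_derivative_transform_within_open [OF _ U]) (simp add: eq)
  then show ?thesis using frechet_derivative_at by metis
qed

locale timelike_hypersurface =
  fixes t\<^sub>0 :: real and \<phi> :: "real \<Rightarrow> 'a::euclidean_space \<Rightarrow> 'a"
  assumes emb: "timelike_embedding t\<^sub>0 \<phi>"
begin

abbreviation \<Phi> where "\<Phi> \<equiv> param \<phi>"
abbreviation D where "D p \<equiv> frechet_derivative (param \<phi>) (at p)"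

definition t\<^sub>1 where "t\<^sub>1 = (SOME t\<^sub>1. t\<^sub>1 < t\<^sub>0 \<and> smooth_on ({t\<^sub>1<..} \<times> (- {0})) \<Phi>)"

definition dom :: "(real \<times> 'a) set" where "dom = {t\<^sub>1<..} \<times> (- {0})"

lemma t1: "t\<^sub>1 < t\<^sub>0" and smooth: "smooth_on dom \<Phi>"
proof -
  have "\<exists>t\<^sub>1. t\<^sub>1 < t\<^sub>0 \<and> smooth_on ({t\<^sub>1<..} \<times> (- {0})) \<Phi>"
    using emb by (auto simp: timelike_embedding_def)
  from someI_ex [OF this] show "t\<^sub>1 < t\<^sub>0" "smooth_on dom \<Phi>"
    by (auto simp: t\<^sub>1_def dom_def)
qed

lemma open_dom: "open dom"
  unfolding dom_def by (intro open_Times open_greaterThan open_Compl closed_singleton)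

lemma in_dom: "t\<^sub>0 \<le> fst p \<Longrightarrow> snd p \<noteq> 0 \<Longrightarrow> p \<in> dom"
  using t1 by (auto simp: dom_def mem_Times_iff)

lemma dom_snd: "p \<in> dom \<Longrightarrow> snd p \<noteq> 0"
  by (auto simp: dom_def)

lemma differentiable: "p \<in> dom \<Longrightarrow> iter_deriv vs \<Phi> differentiable (at p)"
  using smooth by (auto simp: smooth_on_def)

lemma C1_iter_deriv: "C1_on dom (iter_deriv vs \<Phi>)"
proof -
  have "continuous_on dom (iter_deriv (v # vs) \<Phi>)" for v
    by (intro continuous_at_imp_continuous_on ballI differentiable_imp_continuous_within differentiable)
  then show ?thesis
    by (simp add: C1_on_def differentiable)
qed

lemma C1_\<Phi>: "C1_on dom \<Phi>" and C1_D: "C1_on dom (\<lambda>p. D p v)"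
  using C1_iter_deriv [of "[]"] C1_iter_deriv [of "[v]"] by auto

lemma linear_D: "p \<in> dom \<Longrightarrow> linear (D p)"
  using C1_on_linear_derivative [OF C1_\<Phi>] .

text \<open>Curvature and normals are prescribed at unit vectors, while the energy estimate integrates over
  an open set of parameters; both are related by the invariance of the parametrisation under scaling.\<close>

definition scale :: "real \<Rightarrow> real \<times> 'a \<Rightarrow> real \<times> 'a" where "scale c p = (fst p, c *\<^sub>R snd p)"

lemma bounded_linear_scale: "bounded_linear (scale c)"
  unfolding scale_def [abs_def]
  by (intro bounded_linear_Pair bounded_linear_fst
      bounded_linear_compose [OF bounded_linear_scaleR_right bounded_linear_snd])

lemma scale_dom: "c > 0 \<Longrightarrow> p \<in> dom \<Longrightarrow> scale c p \<in> dom"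
  by (auto simp: dom_def scale_def)

lemma \<Phi>_scale: "c > 0 \<Longrightarrow> \<Phi> (scale c p) = \<Phi> p"
  by (simp add: param_def scale_def case_prod_beta sgn_scaleR)

lemma D_scale: "c > 0 \<Longrightarrow> p \<in> dom \<Longrightarrow> D (scale c p) (scale c v) = D p v"
  by (rule frechet_derivative_linear_change [where S = "scale c" and U = dom])
    (use open_dom bounded_linear_scale \<Phi>_scale differentiable [of _ "[]"] scale_dom in auto)

lemma D2_scale:
  assumes "c > 0" "p \<in> dom"
  shows "frechet_derivative (\<lambda>q. D q (scale c w)) (at (scale c p)) (scale c v) =
    frechet_derivative (\<lambda>q. D q w) (at p) v"
  by (rule frechet_derivative_linear_change [where S = "scale c" and U = dom])
    (use open_dom assms(2) bounded_linear_scale D_scale [OF assms(1)]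
      differentiable [of _ "[scale c w]"] scale_dom [OF assms] in auto)

lemma D_radial:
  assumes p: "p \<in> dom" shows "D p (0, snd p) = 0"
proof -
  have "((\<lambda>s. p + s *\<^sub>R (0, snd p)) has_derivative (\<lambda>s. s *\<^sub>R (0, snd p))) (at (0::real))"
    by (auto intro!: derivative_eq_intros)
  moreover have "(\<Phi> has_derivative D p) (at (p + 0 *\<^sub>R (0, snd p)))"
    using C1_on_has_derivative [OF C1_\<Phi> p] by (simp flip: zero_prod_def)
  ultimately have "((\<lambda>s. \<Phi> (p + s *\<^sub>R (0, snd p))) has_derivative (\<lambda>s. D p (s *\<^sub>R (0, snd p)))) (at (0::real))"
    by (rule has_derivative_compose)
  moreover have "((\<lambda>s. \<Phi> (p + s *\<^sub>R (0, snd p))) has_derivative (\<lambda>s. 0)) (at (0::real))"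
  proof (rule has_derivative_transform_within_open [OF has_derivative_const])
    show "open {-1<..<1::real}" "0 \<in> {-1<..<1::real}" by auto
    show "\<Phi> p = \<Phi> (p + s *\<^sub>R (0, snd p))" if "s \<in> {-1<..<1}" for s
      using \<Phi>_scale [of "1 + s" p] that by (simp add: scale_def scaleR_left_distrib plus_prod_def)
  qed
  ultimately have "(\<lambda>s. D p (s *\<^sub>R (0, snd p))) = (\<lambda>s. 0)"
    by (rule has_derivative_unique)
  from fun_cong [OF this, of 1] show ?thesis by simp
qed

lemma fst_\<Phi> [simp]: "fst (\<Phi> p) = fst p"
  by (simp add: param_def case_prod_beta)

lemma fst_D: "p \<in> dom \<Longrightarrow> fst (D p v) = fst v"
proof -
  assume p: "p \<in> dom"
  have "((\<lambda>p. fst (\<Phi> p)) has_derivative (\<lambda>v. fst (D p v))) (at p)"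
    by (rule bounded_linear.has_derivative [OF bounded_linear_fst C1_on_has_derivative [OF C1_\<Phi> p]])
  moreover have "((\<lambda>p. fst (\<Phi> p)) has_derivative fst) (at p)"
    by (simp add: bounded_linear_imp_has_derivative bounded_linear_fst)
  ultimately have "(\<lambda>v. fst (D p v)) = fst" by (rule has_derivative_unique)
  then show ?thesis by (rule fun_cong)
qed

lemma sgn_scale: "snd p \<noteq> 0 \<Longrightarrow> scale (norm (snd p)) (fst p, sgn (snd p)) = p"
  by (simp add: scale_def sgn_div_norm)

lemma range_D:
  assumes "t\<^sub>0 \<le> fst p" "snd p \<noteq> 0"
  shows "range (D p) = tangent_space \<phi> (fst p) (sgn (snd p))"
proof -
  let ?c = "norm (snd p)"
  let ?q = "(fst p, sgn (snd p))"
  have q: "?q \<in> dom" using assms by (intro in_dom) (auto simp: sgn_zero_iff)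
  have c: "?c > 0" using assms by simp
  have "D p (scale ?c v) = D ?q v" for v
    using D_scale [OF c q, of v] by (simp add: sgn_scale [OF assms(2)])
  moreover have "surj (scale ?c)"
    using c by (intro surjI [where f = "\<lambda>v. (fst v, snd v /\<^sub>R ?c)"]) (simp add: scale_def)
  ultimately show ?thesis
    unfolding tangent_space_def by (metis (no_types, lifting) image_cong image_image)
qed

lemma dim_range_D:
  assumes "t\<^sub>0 \<le> fst p" "snd p \<noteq> 0"
  shows "dim (range (D p)) = DIM('a)" "\<exists>v. timelike (D p v)"
proof -
  have "sgn (snd p) \<in> sphere 0 1" using assms by (simp add: norm_sgn)
  then have "dim (tangent_space \<phi> (fst p) (sgn (snd p))) = DIM('a) \<and>
      (\<exists>u\<in>tangent_space \<phi> (fst p) (sgn (snd p)). timelike u)"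
    using emb assms unfolding timelike_embedding_def by blast
  then show "dim (range (D p)) = DIM('a)" "\<exists>v. timelike (D p v)"
    by (auto simp: range_D [OF assms, symmetric])
qed

end

locale cmc_hypersurface = timelike_hypersurface +
  fixes H :: real
  assumes H_pos: "H > 0"
    and cmc: "\<And>t \<omega>. t \<ge> t\<^sub>0 \<Longrightarrow> \<omega> \<in> sphere 0 1 \<Longrightarrow> has_mean_curvature \<phi> t \<omega> H"
begin

text \<open>The forms are evaluated at \<open>snd p\<close> itself, not at its projection to the sphere.\<close>

definition is_normal :: "real \<times> 'a \<Rightarrow> real \<times> 'a \<Rightarrow> bool" where
  "is_normal p n \<longleftrightarrow> inward_unit_normal \<phi> (fst p) (sgn (snd p)) n \<and>
     has_metric_trace (domain_tangent (snd p)) (first_form \<phi> (fst p) (snd p))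
       (second_form \<phi> (fst p) (snd p) n) H"

definition inward :: "real \<times> 'a \<Rightarrow> real \<times> 'a" where "inward p = (SOME n. is_normal p n)"

lemma is_normal_inward:
  assumes p: "t\<^sub>0 \<le> fst p" "snd p \<noteq> 0" shows "is_normal p (inward p)"
  unfolding inward_def
proof (rule someI_ex)
  let ?\<omega> = "sgn (snd p)" let ?c = "norm (snd p)" let ?q = "(fst p, sgn (snd p))"
  have \<omega>: "?\<omega> \<in> sphere 0 1" using p by (simp add: norm_sgn)
  obtain n where n: "inward_unit_normal \<phi> (fst p) ?\<omega> n"
    and tr: "has_metric_trace (domain_tangent ?\<omega>) (first_form \<phi> (fst p) ?\<omega>) (second_form \<phi> (fst p) ?\<omega> n) H"
    using cmc [OF p(1) \<omega>] unfolding has_mean_curvature_def by blast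
  have c: "?c > 0" and q: "?q \<in> dom"
    using p by (auto intro!: in_dom simp: sgn_zero_iff)
  have sc: "scale ?c ?q = p" by (rule sgn_scale [OF p(2)])
  have "has_metric_trace (domain_tangent (snd p)) (first_form \<phi> (fst p) (snd p))
       (second_form \<phi> (fst p) (snd p) n) H"
  proof (rule has_metric_trace_transfer [OF _ _ _ _ _ tr])
    show "linear (scale ?c)" using bounded_linear_scale by (rule bounded_linear.linear)
    show "inj (scale ?c)" using c by (auto simp: inj_def scale_def prod_eq_iff)
    show "scale ?c ` domain_tangent ?\<omega> = domain_tangent (snd p)"
    proof (rule antisym)
      show "scale ?c ` domain_tangent ?\<omega> \<subseteq> domain_tangent (snd p)"
        by (auto simp: domain_tangent_def scale_def sgn_div_norm)
      show "domain_tangent (snd p) \<subseteq> scale ?c ` domain_tangent ?\<omega>"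
      proof
        fix v assume "v \<in> domain_tangent (snd p)"
        then have "(fst v, snd v /\<^sub>R ?c) \<in> domain_tangent ?\<omega>" "v = scale ?c (fst v, snd v /\<^sub>R ?c)"
          using c by (auto simp: domain_tangent_def scale_def sgn_div_norm)
        then show "v \<in> scale ?c ` domain_tangent ?\<omega>" by blast
      qed
    qed
    show "first_form \<phi> (fst p) (snd p) (scale ?c u) (scale ?c w) = first_form \<phi> (fst p) ?\<omega> u w" for u w
      using D_scale [OF c q] by (simp add: first_form_def sc)
    show "second_form \<phi> (fst p) (snd p) n (scale ?c u) (scale ?c w) = second_form \<phi> (fst p) ?\<omega> n u w" for u w
      using D2_scale [OF c q] by (simp add: second_form_def sc)
  qed
  with n show "\<exists>n. is_normal p n" unfolding is_normal_def by blast
qed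

lemma is_normal_unit: "is_normal p n \<Longrightarrow> mink n n = 1"
  by (simp add: is_normal_def inward_unit_normal_def)

lemma is_normal_normal:
  "t\<^sub>0 \<le> fst p \<Longrightarrow> snd p \<noteq> 0 \<Longrightarrow> is_normal p n \<Longrightarrow> mink (D p v) n = 0"
  using range_D [of p] by (auto simp: is_normal_def inward_unit_normal_def)

text \<open>A local normal is the inward one or its negative, and the sign of its trace tells which.\<close>

lemma trace_normal:
  assumes fr: "frame \<phi> W \<nu> B" and p: "p \<in> W" "t\<^sub>0 \<le> fst p" "snd p \<noteq> 0"
  shows "inward p = \<nu> p \<and> frame.trD \<nu> B p = - H \<or> inward p = - \<nu> p \<and> frame.trD \<nu> B p = H"
proof -
  interpret fr: frame \<phi> W \<nu> B by fact
  note n = is_normal_inward [OF p(2,3)]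
  have tr: "has_metric_trace (domain_tangent (snd p)) (first_form \<phi> (fst p) (snd p))
       (second_form \<phi> (fst p) (snd p) (inward p)) H"
    using n by (simp add: is_normal_def)
  have "inward p = \<nu> p \<or> inward p = - \<nu> p"
  proof (rule unit_normal_unique_up_to_sign)
    show "linear (D p)" "DIM('a) \<le> dim (range (D p))"
      using linear_D in_dom p dim_range_D [OF p(2,3)] by auto
  qed (use fr.normal fr.unit p n is_normal_unit is_normal_normal in auto)
  then show ?thesis
  proof
    assume eq: "inward p = \<nu> p"
    then show ?thesis
      using fr.trD_eq [of "fst p" "snd p" H] tr p(1) by simp
  next
    assume eq: "inward p = - \<nu> p"
    have "second_form \<phi> (fst p) (snd p) (\<nu> p) = (\<lambda>u w. - second_form \<phi> (fst p) (snd p) (inward p) u w)"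
      by (intro ext) (simp add: second_form_def eq mink_simps)
    then have "frame.trD \<nu> B p = H"
      using fr.trD_eq [of "fst p" "snd p" "- H"] has_metric_trace_uminus [OF tr] p(1) by simp
    with eq show ?thesis by simp
  qed
qed

text \<open>The trace of the differential of a local normal takes only the values \<open>\<plusminus> H\<close> on the
  hypersurface, so by continuity the inward normal is locally a single continuously differentiable field.\<close>

lemma cmc_frame:
  assumes p: "t\<^sub>0 \<le> fst p" "snd p \<noteq> 0"
  obtains W \<nu> B where "frame \<phi> W \<nu> B" "p \<in> W" "W \<subseteq> dom"
    "\<And>q. q \<in> W \<Longrightarrow> t\<^sub>0 \<le> fst q \<Longrightarrow> inward q = \<nu> q"
    "\<And>q. q \<in> W \<Longrightarrow> t\<^sub>0 \<le> fst q \<Longrightarrow> frame.trD \<nu> B q = - H"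
proof -
  note n = is_normal_inward [OF p]
  have d: "DIM('a) \<le> dim (range (D p))" using dim_range_D [OF p] by simp
  obtain W \<nu> B where fr: "frame \<phi> W \<nu> B" and W: "p \<in> W" "W \<subseteq> dom" "\<nu> p = inward p"
    using frame_exists [OF open_dom in_dom [OF p] dom_snd C1_\<Phi> C1_D D_radial d
        is_normal_unit [OF n] is_normal_normal [OF p n]] by metis
  interpret fr: frame \<phi> W \<nu> B by fact
  have "inward p \<noteq> - inward p"
    using is_normal_unit [OF n] by (auto simp: mink_zero_left eq_neg_iff_add_eq_0 simp flip: scaleR_2)
  then have "fr.trD p = - H"
    using trace_normal [OF fr W(1) p] W(3) by auto
  define W' where "W' = {q\<in>W. fr.trD q < 0}"
  have W': "open W'" "p \<in> W'" "W' \<subseteq> W"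
    using continuous_open_preimage [OF fr.continuous_trD fr.open_W open_lessThan [of 0]]
      W \<open>fr.trD p = - H\<close> H_pos by (auto simp: W'_def vimage_def Int_def)
  have "inward q = \<nu> q \<and> fr.trD q = - H" if "q \<in> W'" "t\<^sub>0 \<le> fst q" for q
  proof -
    have q: "q \<in> W" "fr.trD q < 0" using that(1) by (simp_all add: W'_def)
    then have "snd q \<noteq> 0" using W(2) dom_snd by blast
    note q this
    then show ?thesis using trace_normal [OF fr, of q] that(2) H_pos by auto
  qed
  then show thesis
    using that [OF fr.frame_subset [OF W'(1,3)] W'(2)] W' W by blast
qed

definition lift :: "real \<times> 'a \<Rightarrow> real \<times> 'a \<Rightarrow> real \<times> 'a" where
  "lift p w = (SOME v. snd v \<bullet> snd p = 0 \<and> D p v = w - mink w (inward p) *\<^sub>R inward p)"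

lemma lift_eq:
  assumes fr: "frame \<phi> W \<nu> B" and p: "p \<in> W" "inward p = \<nu> p"
  shows "lift p w = B p w"
proof -
  interpret fr: frame \<phi> W \<nu> B by fact
  have ex: "snd (B p w) \<bullet> snd p = 0 \<and> D p (B p w) = w - mink w (inward p) *\<^sub>R inward p"
    using fr.lift_tangent [OF p(1)] fr.deriv_lift [OF p(1)] p(2) by simp
  have "snd (lift p w) \<bullet> snd p = 0 \<and> D p (lift p w) = w - mink w (inward p) *\<^sub>R inward p"
    unfolding lift_def by (rule someI [of _ "B p w"]) (rule ex)
  then show ?thesis
    using ex fr.lift_deriv [OF p(1)] by metis
qed

end

section \<open>The energy estimate\<close>

lemma compact_locally_bounded:
  fixes f g :: "'v::topological_space \<Rightarrow> real"
  assumes K: "compact K" and g: "\<And>q. g q \<ge> 0"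
    and loc: "\<And>p. p \<in> K \<Longrightarrow> \<exists>W C. open W \<and> p \<in> W \<and> (\<forall>q\<in>W. Q q \<longrightarrow> f q \<le> C * g q)"
  shows "\<exists>C\<ge>0. \<forall>q\<in>K. Q q \<longrightarrow> f q \<le> C * g q"
proof -
  obtain W C where W: "\<And>p. p \<in> K \<Longrightarrow> open (W p)" "\<And>p. p \<in> K \<Longrightarrow> p \<in> W p"
    and C: "\<And>p q. p \<in> K \<Longrightarrow> q \<in> W p \<Longrightarrow> Q q \<Longrightarrow> f q \<le> C p * g q"
    using loc by metis
  obtain S where S: "S \<subseteq> K" "finite S" "K \<subseteq> (\<Union>p\<in>S. W p)"
    by (rule compactE_image [OF K, of K W]) (use W in auto)
  have "f q \<le> (\<Sum>p\<in>S. \<bar>C p\<bar>) * g q" if "q \<in> K" "Q q" for q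
  proof -
    obtain p where p: "p \<in> S" "q \<in> W p" using S(3) \<open>q \<in> K\<close> by blast
    have "f q \<le> C p * g q" using C [of p q] p S that by auto
    also have "\<dots> \<le> (\<Sum>p\<in>S. \<bar>C p\<bar>) * g q"
    proof (rule mult_right_mono [OF _ g])
      have "C p \<le> \<bar>C p\<bar>" by simp
      also have "\<dots> \<le> (\<Sum>p\<in>S. \<bar>C p\<bar>)" by (rule member_le_sum) (use p S in auto)
      finally show "C p \<le> (\<Sum>p\<in>S. \<bar>C p\<bar>)" .
    qed
    finally show ?thesis .
  qed
  then show ?thesis by (intro exI [of _ "\<Sum>p\<in>S. \<bar>C p\<bar>"]) (auto simp: sum_nonneg)
qed

lemma frechet_derivative_cong_open:
  assumes "open W" "p \<in> W" "\<And>q. q \<in> W \<Longrightarrow> f q = g q"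
  shows "frechet_derivative f (at p) = frechet_derivative g (at p)"
proof -
  have "(f has_derivative f') (at p) \<longleftrightarrow> (g has_derivative f') (at p)" for f'
    using has_derivative_transform_within_open [OF _ assms(1,2), of f f' UNIV g]
      has_derivative_transform_within_open [OF _ assms(1,2), of g f' UNIV f] assms(3) by auto
  then show ?thesis by (simp add: frechet_derivative_def)
qed

lemma divg_cong_open:
  assumes "open W" "p \<in> W" "\<And>q. q \<in> W \<Longrightarrow> f q = g q"
  shows "divg f p = divg g p"
  by (simp only: divg_def frechet_derivative_cong_open [OF assms])

lemma divg_zero: "divg (\<lambda>q. 0) p = 0"
  by (simp add: divg_def)

context cmc_hypersurface begin

definition deviation :: "real \<times> 'a \<Rightarrow> real \<times> 'a \<Rightarrow> real \<times> 'a" where "deviation P p = inward p + \<Phi> p - P"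

definition flux :: "real \<times> 'a \<Rightarrow> real \<times> 'a \<Rightarrow> real \<times> 'a" where "flux P p = lift p (current (deviation P p))"

lemma cmc_frame_flux:
  assumes p: "t\<^sub>0 \<le> fst p" "snd p \<noteq> 0"
  obtains W \<nu> B where "frame \<phi> W \<nu> B" "p \<in> W" "W \<subseteq> dom"
    "\<And>q. q \<in> W \<Longrightarrow> t\<^sub>0 \<le> fst q \<Longrightarrow> frame.trD \<nu> B q = - H"
    "\<And>q. q \<in> W \<Longrightarrow> t\<^sub>0 \<le> fst q \<Longrightarrow> deviation P q = frame.deviation \<phi> \<nu> P q"
    "\<And>q. q \<in> W \<Longrightarrow> t\<^sub>0 \<le> fst q \<Longrightarrow> flux P q = frame.flux \<phi> \<nu> B P q"
proof -
  obtain W \<nu> B where fr: "frame \<phi> W \<nu> B" and W: "p \<in> W" "W \<subseteq> dom"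
    and inward: "\<And>q. q \<in> W \<Longrightarrow> t\<^sub>0 \<le> fst q \<Longrightarrow> inward q = \<nu> q"
    and tr: "\<And>q. q \<in> W \<Longrightarrow> t\<^sub>0 \<le> fst q \<Longrightarrow> frame.trD \<nu> B q = - H"
    by (rule cmc_frame [OF p]) blast
  interpret fr: frame \<phi> W \<nu> B by fact
  have deviation: "deviation P q = fr.deviation P q" if "q \<in> W" "t\<^sub>0 \<le> fst q" for q
    by (simp add: deviation_def fr.deviation_def inward [OF that])
  have "flux P q = fr.flux P q" if "q \<in> W" "t\<^sub>0 \<le> fst q" for q
    using lift_eq [OF fr that(1) inward [OF that]] by (simp add: flux_def fr.flux_def deviation [OF that])
  with fr W tr deviation show thesis by (rule that)
qed

lemma divg_flux_bound:
  assumes H: "H = DIM('a)" and K: "compact K" "\<And>p. p \<in> K \<Longrightarrow> t\<^sub>0 \<le> fst p \<and> snd p \<noteq> 0"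
  shows "\<exists>C\<ge>0. \<forall>q\<in>K. t\<^sub>0 < fst q \<longrightarrow> \<bar>divg (flux P) q\<bar> \<le> C * (norm (deviation P q))\<^sup>2"
proof (rule compact_locally_bounded [OF K(1)])
  fix p assume "p \<in> K"
  then have p: "t\<^sub>0 \<le> fst p" "snd p \<noteq> 0" using K(2) by auto
  obtain W \<nu> B where fr: "frame \<phi> W \<nu> B" and W: "p \<in> W" "W \<subseteq> dom"
    and tr: "\<And>q. q \<in> W \<Longrightarrow> t\<^sub>0 \<le> fst q \<Longrightarrow> frame.trD \<nu> B q = - H"
    and deviation: "\<And>q. q \<in> W \<Longrightarrow> t\<^sub>0 \<le> fst q \<Longrightarrow> deviation P q = frame.deviation \<phi> \<nu> P q"
    and flux: "\<And>q. q \<in> W \<Longrightarrow> t\<^sub>0 \<le> fst q \<Longrightarrow> flux P q = frame.flux \<phi> \<nu> B P q"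
    by (rule cmc_frame_flux [OF p, of P]) blast
  interpret fr: frame \<phi> W \<nu> B by fact
  define s where "s q = (\<Sum>c\<in>Basis. \<bar>divg (\<lambda>q. B q c) q\<bar>)" for q
  have "continuous_on W s"
    unfolding s_def by (intro continuous_on_sum continuous_on_rabs fr.continuous_divg_lift)
  from continuous_open_preimage [OF this fr.open_W open_lessThan [of "s p + 1"]]
  have op: "open {q\<in>W. s q < s p + 1}" by (simp add: vimage_def Int_def)
  have "\<bar>divg (flux P) q\<bar> \<le> (2 * (s p + 1)) * (norm (deviation P q))\<^sup>2"
    if q: "q \<in> W" "s q < s p + 1" "t\<^sub>0 < fst q" for q
  proof -
    let ?J = "current (fr.deviation P q)"
    have q': "t\<^sub>0 \<le> fst q" using q by simp
    have "open (W \<inter> {q. t\<^sub>0 < fst q})"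
      by (intro open_Int fr.open_W open_Collect_less continuous_intros)
    then have "divg (flux P) q = divg (fr.flux P) q"
      by (rule divg_cong_open) (use q flux in auto)
    also have "\<dots> = (\<Sum>c\<in>Basis. (?J \<bullet> c) * divg (\<lambda>q. B q c) q)"
      by (rule fr.divg_flux [OF q(1)]) (simp add: tr [OF q(1) q'] H)
    finally have "\<bar>divg (flux P) q\<bar> \<le> (\<Sum>c\<in>Basis. \<bar>(?J \<bullet> c) * divg (\<lambda>q. B q c) q\<bar>)"
      using sum_abs by metis
    also have "\<dots> \<le> (\<Sum>c\<in>Basis. norm ?J * \<bar>divg (\<lambda>q. B q c) q\<bar>)"
      unfolding abs_mult by (intro sum_mono mult_right_mono Basis_le_norm) auto
    also have "\<dots> = norm ?J * s q" by (simp add: s_def sum_distrib_left)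
    also have "\<dots> \<le> (2 * (norm (fr.deviation P q))\<^sup>2) * (s p + 1)"
      by (intro mult_mono norm_current_le) (use q in \<open>auto simp: s_def sum_nonneg\<close>)
    also have "\<dots> = (2 * (s p + 1)) * (norm (deviation P q))\<^sup>2"
      by (simp add: deviation [OF q(1) q'])
    finally show ?thesis .
  qed
  then show "\<exists>W C. open W \<and> p \<in> W \<and> (\<forall>q\<in>W. t\<^sub>0 < fst q \<longrightarrow> \<bar>divg (flux P) q\<bar> \<le> C * (norm (deviation P q))\<^sup>2)"
    using op W by (intro exI [of _ "{q\<in>W. s q < s p + 1}"] exI [of _ "2 * (s p + 1)"]) auto
qed simp

text \<open>Weighted with cut-offs in time, in the null direction \<open>(1, e)\<close> and in the radial direction, the
  energy current has non-negative divergence: the first cut-off beats the error terms, the second one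
  decreases along the future, and the current has no radial component. The divergence theorem
  then makes the deviation vanish.\<close>

theorem deviation_eq_0:
  assumes H: "H = DIM('a)" and e: "norm e = 1"
    and init: "\<And>x. x \<noteq> 0 \<Longrightarrow> mink (\<Phi> (t\<^sub>0, x) - P) (1, e) > 0 \<Longrightarrow> deviation P (t\<^sub>0, x) = 0"
    and z: "t\<^sub>0 \<le> fst z" "snd z \<noteq> 0" "mink (\<Phi> z - P) (1, e) > 0"
  shows "deviation P z = 0"
proof (cases "fst z = t\<^sub>0")
  case True
  then show ?thesis using init [of "snd z"] z by (metis prod.collapse)
next
  case False
  define F where "F q = mink (\<Phi> q - P) (1, e)" for q
  \<comment> \<open>the cut-offs are positive at \<open>z\<close>, and supported in times before \<open>T\<close> and radii between
    \<open>sqrt a\<close> and \<open>sqrt b\<close>\<close>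
  define T where "T = fst z + 1"
  define a b where "a = (snd z \<bullet> snd z) / 2" and "b = 2 * (snd z \<bullet> snd z)"
  have ab: "0 < a" "a < snd z \<bullet> snd z" "snd z \<bullet> snd z < b" "a < b"
    using z(2) by (simp_all add: a_def b_def)
  define G where "G q = (snd q \<bullet> snd q - a) * (b - snd q \<bullet> snd q)" for q :: "real \<times> 'a"
  define K where "K = {t\<^sub>0..T} \<times> {x :: 'a. a \<le> x \<bullet> x \<and> x \<bullet> x \<le> b}"
  have "compact {x :: 'a. a \<le> x \<bullet> x \<and> x \<bullet> x \<le> b}"
    unfolding compact_eq_bounded_closed
  proof
    have "norm x \<le> sqrt b" if "x \<bullet> x \<le> b" for x :: 'a
      using that by (simp add: norm_eq_sqrt_inner)
    then show "bounded {x :: 'a. a \<le> x \<bullet> x \<and> x \<bullet> x \<le> b}"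
      by (auto simp: bounded_iff)
    show "closed {x :: 'a. a \<le> x \<bullet> x \<and> x \<bullet> x \<le> b}"
      by (intro closed_Collect_conj closed_Collect_le continuous_intros)
  qed
  then have "compact K"
    unfolding K_def by (intro compact_Times) auto
  moreover have "t\<^sub>0 \<le> fst p \<and> snd p \<noteq> 0" if "p \<in> K" for p
    using that ab by (auto simp: K_def)
  ultimately obtain C where C: "C \<ge> 0"
    "\<And>q. q \<in> K \<Longrightarrow> t\<^sub>0 < fst q \<Longrightarrow> \<bar>divg (flux P) q\<bar> \<le> C * (norm (deviation P q))\<^sup>2"
    using divg_flux_bound [OF H, of K P] by blast
  \<comment> \<open>the \<open>N\<close>-th power of \<open>T - t\<close> decays at the rate \<open>N / (T - t)\<close>, which is at least
    \<open>N / (T - t\<^sub>0)\<close> and has to exceed \<open>4 * C\<close>\<close>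
  obtain N\<^sub>0 :: nat where "4 * C * (T - t\<^sub>0) < N\<^sub>0" using reals_Archimedean2 by blast
  then obtain N :: nat where N: "N \<ge> 2" "4 * C * (T - t\<^sub>0) < N"
    by (intro that [of "N\<^sub>0 + 2"]) auto
  define m where "m q = max 0 (T - fst q)" for q :: "real \<times> 'a"
  define \<alpha> \<beta> \<gamma> where "\<alpha> q = m q ^ N" and "\<beta> q = (max 0 (F q))\<^sup>2" and "\<gamma> q = (max 0 (G q))\<^sup>2" for q
  define w where "w q = \<alpha> q * \<beta> q * \<gamma> q" for q
  define f where "f q = (if t\<^sub>0 < fst q then w q *\<^sub>R flux P q else 0)" for q
  have dT: "((\<lambda>q. T - fst q) has_derivative (\<lambda>v. - fst v)) (at q)" for q :: "real \<times> 'a"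
    by (auto intro!: derivative_eq_intros)
  have C1T: "C1_on UNIV (\<lambda>q :: real \<times> 'a. T - fst q)"
    by (rule C1_onI [OF dT]) (intro continuous_intros)
  have dG: "(G has_derivative (\<lambda>v. 2 * (snd v \<bullet> snd q) * (b - snd q \<bullet> snd q)
      - (snd q \<bullet> snd q - a) * (2 * (snd v \<bullet> snd q)))) (at q)" for q
    unfolding G_def by (auto intro!: derivative_eq_intros simp: inner_commute algebra_simps)
  have C1G: "C1_on UNIV G"
    by (rule C1_onI [OF dG]) (intro continuous_intros)
  have dF: "(F has_derivative (\<lambda>v. mink (D q v) (1, e))) (at q)" if "q \<in> dom" for q
  proof -
    have "((\<lambda>q. mink (\<Phi> q - P) (1, e)) has_derivative
        (\<lambda>v. mink (\<Phi> q - P) 0 + mink (D q v - 0) (1, e))) (at q)"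
      by (intro bounded_bilinear.FDERIV [OF bounded_bilinear_mink] has_derivative_diff has_derivative_const
          C1_on_has_derivative [OF C1_\<Phi> that])
    then show ?thesis by (simp add: F_def [abs_def] mink_zero_right)
  qed
  have C1F: "C1_on dom F"
    unfolding F_def by (rule C1_on_mink [OF C1_on_diff [OF C1_\<Phi> C1_on_const] C1_on_const])
  have \<alpha>: "C1_on UNIV \<alpha>" "frechet_derivative \<alpha> (at q) v = - (N * m q ^ (N - 1) * fst v)" for q v
    using C1_on_pos_part_power [OF C1T N(1)] frechet_derivative_at [OF dT, of q, symmetric]
    by (simp_all add: \<alpha>_def [abs_def] m_def [abs_def])
  have \<beta>: "C1_on dom \<beta>" "q \<in> dom \<Longrightarrow> frechet_derivative \<beta> (at q) v = 2 * max 0 (F q) * mink (D q v) (1, e)" for q v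
    using C1_on_pos_part_power [OF C1F, of 2] frechet_derivative_at [OF dF, of q, symmetric]
    by (simp_all add: \<beta>_def [abs_def])
  have \<gamma>: "C1_on UNIV \<gamma>" "snd v \<bullet> snd q = 0 \<Longrightarrow> frechet_derivative \<gamma> (at q) v = 0" for q v
    using C1_on_pos_part_power [OF C1G, of 2] frechet_derivative_at [OF dG, of q, symmetric]
    by (simp_all add: \<gamma>_def [abs_def])
  have C1w: "C1_on dom w"
    unfolding w_def
    by (rule C1_on_mult [OF C1_on_mult [OF C1_on_subset [OF \<alpha>(1)] \<beta>(1)] C1_on_subset [OF \<gamma>(1)]]) auto
  have Dw: "frechet_derivative w (at q) v = \<alpha> q * \<beta> q * frechet_derivative \<gamma> (at q) v +
      (\<alpha> q * frechet_derivative \<beta> (at q) v + frechet_derivative \<alpha> (at q) v * \<beta> q) * \<gamma> q"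
    if q: "q \<in> dom" for q v
  proof -
    have "(w has_derivative (\<lambda>v. \<alpha> q * \<beta> q * frechet_derivative \<gamma> (at q) v +
      (\<alpha> q * frechet_derivative \<beta> (at q) v + frechet_derivative \<alpha> (at q) v * \<beta> q) * \<gamma> q)) (at q)"
      unfolding w_def
      by (rule has_derivative_mult [OF has_derivative_mult [OF C1_on_has_derivative [OF \<alpha>(1)]
              C1_on_has_derivative [OF \<beta>(1) q]] C1_on_has_derivative [OF \<gamma>(1)]]) auto
    from fun_cong [OF frechet_derivative_at [OF this], of v] show ?thesis by simp
  qed
  have zero: "\<exists>W. open W \<and> p \<in> W \<and> (\<forall>q\<in>W. f q = 0)" if "fst p < t\<^sub>0 \<or> snd p \<bullet> snd p < a" for p
    using that
  proof
    assume "fst p < t\<^sub>0"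
    moreover have "open {q :: real \<times> 'a. fst q < t\<^sub>0}"
      by (intro open_Collect_less continuous_intros)
    ultimately show ?thesis
      by (intro exI [of _ "{q. fst q < t\<^sub>0}"]) (auto simp: f_def)
  next
    assume "snd p \<bullet> snd p < a"
    moreover have "open {q :: real \<times> 'a. snd q \<bullet> snd q < a}"
      by (intro open_Collect_less continuous_intros)
    moreover have "f q = 0" if "snd q \<bullet> snd q < a" for q
    proof -
      have "G q \<le> 0" unfolding G_def
        by (rule mult_nonpos_nonneg) (use that ab in auto)
      then show ?thesis by (simp add: f_def w_def \<gamma>_def)
    qed
    ultimately show ?thesis
      by (intro exI [of _ "{q. snd q \<bullet> snd q < a}"]) auto
  qed
  have local: "\<exists>W. open W \<and> p \<in> W \<and> C1_on W f \<and> (fst p = t\<^sub>0 \<longrightarrow> divg f p = 0) \<and>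
      (t\<^sub>0 < fst p \<longrightarrow> divg f p \<ge> \<beta> p * \<gamma> p * m p ^ (N - 1) * ((norm (deviation P p))\<^sup>2 * (N / 4)) - w p * \<bar>divg (flux P) p\<bar>)"
    if p: "t\<^sub>0 \<le> fst p" "snd p \<noteq> 0" for p
  proof -
    obtain W \<nu> B where fr: "frame \<phi> W \<nu> B" and W: "p \<in> W" "W \<subseteq> dom"
      and deviation: "\<And>q. q \<in> W \<Longrightarrow> t\<^sub>0 \<le> fst q \<Longrightarrow> deviation P q = frame.deviation \<phi> \<nu> P q"
      and flux: "\<And>q. q \<in> W \<Longrightarrow> t\<^sub>0 \<le> fst q \<Longrightarrow> flux P q = frame.flux \<phi> \<nu> B P q"
      by (rule cmc_frame_flux [OF p, of P]) blast
    interpret fr: frame \<phi> W \<nu> B by fact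
    have C1w': "C1_on W w" using C1w W(2) by (rule C1_on_subset)
    define g where "g q = w q *\<^sub>R fr.flux P q" for q
    have C1g: "C1_on W g"
      unfolding g_def by (rule C1_on_scaleR [OF C1w' fr.C1_flux])
    have Dg: "frechet_derivative g (at q) v = w q *\<^sub>R frechet_derivative (fr.flux P) (at q) v +
        frechet_derivative w (at q) v *\<^sub>R fr.flux P q" if "q \<in> W" for q v
    proof -
      have "(g has_derivative (\<lambda>v. w q *\<^sub>R frechet_derivative (fr.flux P) (at q) v +
        frechet_derivative w (at q) v *\<^sub>R fr.flux P q)) (at q)"
        unfolding g_def by (rule has_derivative_scaleR [OF C1_on_has_derivative [OF C1w' that]
              C1_on_has_derivative [OF fr.C1_flux that]])
      from fun_cong [OF frechet_derivative_at [OF this], of v] show ?thesis by simp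
    qed
    \<comment> \<open>at the initial time either the deviation vanishes, and the flux is quadratic in it, or the
      cut-off in the null direction vanishes to second order\<close>
    have 0: "g q = 0 \<and> frechet_derivative g (at q) v = 0" if q: "q \<in> W" "fst q = t\<^sub>0" for q v
    proof (cases "F q > 0")
      case True
      have "q \<in> dom" using q W by blast
      then have "deviation P q = 0"
        using init [of "snd q"] dom_snd [of q] True q(2) by (auto simp: F_def)
      then have V: "fr.deviation P q = 0" using deviation [OF q(1)] q(2) by simp
      then have J: "current (fr.deviation P q) = 0" by (simp add: current_def mink_zero_left zero_prod_def [symmetric])
      have "fr.Dcurrent P q h = 0" for h
        by (simp add: fr.Dcurrent_def V mink_zero_left mink_zero_right zero_prod_def [symmetric])
      then have "frechet_derivative (fr.flux P) (at q) v = 0"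
        unfolding frechet_derivative_at [OF fr.has_derivative_flux [OF q(1)], symmetric]
        by (simp add: J)
      moreover have "fr.flux P q = 0"
        by (simp add: fr.flux_def J linear_0 [OF fr.linear_lift [OF q(1)]])
      ultimately show ?thesis using Dg [OF q(1)] by (simp add: g_def)
    next
      case False
      have q': "q \<in> dom" using q W by blast
      from False have "w q = 0" "frechet_derivative w (at q) v = 0"
        by (simp_all add: w_def \<beta>_def Dw [OF q'] \<beta>(2) [OF q'])
      then show ?thesis using Dg [OF q(1)] by (simp add: g_def)
    qed
    have fg: "(if t\<^sub>0 < fst q then g q else 0) = f q" if "q \<in> W" for q
      using flux [OF that] by (simp add: f_def g_def)
    have "C1_on W f"
      by (rule C1_on_cong [OF fr.open_W fg C1_on_truncate [OF fr.open_W C1g]]) (use 0 in auto)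
    moreover have Df: "frechet_derivative f (at p) v = (if t\<^sub>0 < fst p then frechet_derivative g (at p) v else 0)" for v
    proof -
      have "((\<lambda>q. if t\<^sub>0 < fst q then g q else 0) has_derivative
          (\<lambda>v. if t\<^sub>0 < fst p then frechet_derivative g (at p) v else 0)) (at p)"
        by (rule has_derivative_truncate [OF fr.open_W C1g _ _ W(1)]) (use 0 in auto)
      then have "(f has_derivative (\<lambda>v. if t\<^sub>0 < fst p then frechet_derivative g (at p) v else 0)) (at p)"
        by (rule has_derivative_transform_within_open [OF _ fr.open_W W(1) fg])
      from fun_cong [OF frechet_derivative_at [OF this], of v] show ?thesis by simp
    qed
    moreover have "divg f p = 0" if "fst p = t\<^sub>0"
      by (simp add: divg_def Df that)
    moreover have "divg f p \<ge> \<beta> p * \<gamma> p * m p ^ (N - 1) * ((norm (deviation P p))\<^sup>2 * (N / 4)) - w p * \<bar>divg (flux P) p\<bar>"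
      if p0: "t\<^sub>0 < fst p"
    proof -
      let ?Z = "fr.flux P p" and ?V = "fr.deviation P p"
      have pd: "p \<in> dom" using W by blast
      have tan: "snd ?Z \<bullet> snd p = 0" by (simp add: fr.flux_def fr.lift_tangent [OF W(1)])
      have fZ: "- fst ?Z \<ge> (norm ?V)\<^sup>2 / 4"
      proof -
        have "- fst ?Z = mink (D p ?Z) (1, 0)" by (simp add: mink_def fst_D [OF pd])
        also have "\<dots> \<ge> (norm ?V)\<^sup>2 / 4"
          unfolding fr.deriv_flux [OF W(1)] by (rule mink_current_time_projection [OF fr.unit [OF W(1)]])
        finally show ?thesis .
      qed
      have nZ: "mink (D p ?Z) (1, e) \<ge> 0"
        unfolding fr.deriv_flux [OF W(1)] by (rule mink_current_null_projection [OF fr.unit [OF W(1)] e])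
      have op: "open (W \<inter> {q. t\<^sub>0 < fst q})"
        by (intro open_Int fr.open_W open_Collect_less continuous_intros)
      have eq: "divg (fr.flux P) p = divg (flux P) p"
        by (rule divg_cong_open [OF op]) (use W p0 flux in auto)
      have "divg f p = divg g p"
        by (simp add: divg_def Df p0)
      moreover have "divg g p = frechet_derivative w (at p) ?Z + w p * divg (flux P) p"
        unfolding g_def eq [symmetric] by (rule divg_scaleR [OF C1w' fr.C1_flux W(1)])
      moreover have "frechet_derivative w (at p) ?Z = \<alpha> p * (2 * max 0 (F p) * mink (D p ?Z) (1, e)) * \<gamma> p
          + (N * m p ^ (N - 1) * (- fst ?Z)) * \<beta> p * \<gamma> p"
        by (simp add: Dw [OF pd] \<gamma>(2) [OF tan] \<beta>(2) [OF pd] \<alpha>(2) algebra_simps)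
      moreover have "\<alpha> p * (2 * max 0 (F p) * mink (D p ?Z) (1, e)) * \<gamma> p \<ge> 0"
        using nZ by (intro mult_nonneg_nonneg) (auto simp: \<alpha>_def m_def \<gamma>_def)
      moreover have "(N * m p ^ (N - 1) * (- fst ?Z)) * \<beta> p * \<gamma> p \<ge>
          \<beta> p * \<gamma> p * m p ^ (N - 1) * ((norm (deviation P p))\<^sup>2 * (N / 4))"
      proof -
        have "\<beta> p * \<gamma> p * m p ^ (N - 1) * N * ((norm ?V)\<^sup>2 / 4) \<le> \<beta> p * \<gamma> p * m p ^ (N - 1) * N * (- fst ?Z)"
          by (rule mult_left_mono [OF fZ]) (auto simp: \<beta>_def \<gamma>_def m_def)
        then show ?thesis by (simp add: deviation [OF W(1) p(1)] mult_ac)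
      qed
      moreover have "w p * divg (flux P) p \<ge> - (w p * \<bar>divg (flux P) p\<bar>)"
      proof -
        have "w p \<ge> 0" by (simp add: w_def \<alpha>_def \<beta>_def \<gamma>_def m_def)
        then have "w p * (- \<bar>divg (flux P) p\<bar>) \<le> w p * divg (flux P) p"
          by (intro mult_left_mono) auto
        then show ?thesis by simp
      qed
      ultimately show ?thesis by linarith
    qed
    ultimately show ?thesis using fr.open_W W(1) by blast
  qed
  have below: "divg f p \<ge> \<beta> p * \<gamma> p * m p ^ (N - 1) * (norm (deviation P p))\<^sup>2 * (N / 4 - C * (T - t\<^sub>0))"
    if p: "t\<^sub>0 < fst p" "snd p \<noteq> 0" for p
  proof (cases "p \<in> K")
    case True
    have "w p * \<bar>divg (flux P) p\<bar> \<le> w p * (C * (norm (deviation P p))\<^sup>2)"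
      by (rule mult_left_mono [OF C(2) [OF True p(1)]]) (simp add: w_def \<alpha>_def \<beta>_def \<gamma>_def m_def)
    also have "\<dots> = \<beta> p * \<gamma> p * m p ^ (N - 1) * (C * (norm (deviation P p))\<^sup>2) * m p"
    proof -
      have "m p ^ N = m p * m p ^ (N - 1)" using N(1) by (cases N) auto
      then show ?thesis by (simp add: w_def \<alpha>_def mult_ac)
    qed
    also have "\<dots> \<le> \<beta> p * \<gamma> p * m p ^ (N - 1) * (C * (norm (deviation P p))\<^sup>2) * (T - t\<^sub>0)"
      by (rule mult_left_mono) (use True C(1) p in \<open>auto simp: \<beta>_def \<gamma>_def m_def K_def\<close>)
    finally have "w p * \<bar>divg (flux P) p\<bar> \<le>
        \<beta> p * \<gamma> p * m p ^ (N - 1) * (C * (norm (deviation P p))\<^sup>2) * (T - t\<^sub>0)" .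
    moreover have "divg f p \<ge> \<beta> p * \<gamma> p * m p ^ (N - 1) * ((norm (deviation P p))\<^sup>2 * (N / 4)) - w p * \<bar>divg (flux P) p\<bar>"
      using local [of p] p by auto
    moreover have "Q * n * (N / 4 - C * (T - t\<^sub>0)) = Q * (n * (N / 4)) - Q * (C * n) * (T - t\<^sub>0)" for Q n
      by (simp add: algebra_simps)
    ultimately show ?thesis by simp
  next
    case False
    then have *: "m p = 0 \<or> \<gamma> p = 0"
    proof -
      from False p consider "fst p > T" | "snd p \<bullet> snd p < a" | "snd p \<bullet> snd p > b"
        by (auto simp: K_def mem_Times_iff)
      then show ?thesis
      proof cases
        case 1 then show ?thesis by (simp add: m_def)
      next
        case 2
        then have "G p \<le> 0" unfolding G_def using ab by (intro mult_nonpos_nonneg) auto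
        then show ?thesis by (simp add: \<gamma>_def)
      next
        case 3
        then have "G p \<le> 0" unfolding G_def using ab by (intro mult_nonneg_nonpos) auto
        then show ?thesis by (simp add: \<gamma>_def)
      qed
    qed
    moreover have "m p ^ (N - 1) = 0" "m p ^ N = 0" if "m p = 0" using that N(1) by auto
    ultimately have 0: "\<beta> p * \<gamma> p * m p ^ (N - 1) = 0" "w p = 0" by (auto simp: w_def \<alpha>_def)
    have "divg f p \<ge> \<beta> p * \<gamma> p * m p ^ (N - 1) * ((norm (deviation P p))\<^sup>2 * (N / 4)) - w p * \<bar>divg (flux P) p\<bar>"
      using local [of p] p by auto
    then show ?thesis unfolding 0 by simp
  qed
  have pos: "N / 4 - C * (T - t\<^sub>0) > 0" using N(2) by simp
  have nonneg: "divg f p \<ge> 0" for p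
  proof -
    consider "fst p < t\<^sub>0 \<or> snd p \<bullet> snd p < a" | "fst p = t\<^sub>0" "snd p \<noteq> 0" | "fst p > t\<^sub>0" "snd p \<noteq> 0"
      using ab(1) by force
    then show ?thesis
    proof cases
      case 1
      then obtain W where "open W" "p \<in> W" "\<forall>q\<in>W. f q = 0" using zero by blast
      then show ?thesis using divg_cong_open [of W p f "\<lambda>q. 0"] by (simp add: divg_zero)
    next
      case 2 then show ?thesis using local [of p] by auto
    next
      case 3
      have "0 \<le> \<beta> p * \<gamma> p * m p ^ (N - 1) * (norm (deviation P p))\<^sup>2 * (N / 4 - C * (T - t\<^sub>0))"
        using pos by (intro mult_nonneg_nonneg) (auto simp: \<beta>_def \<gamma>_def m_def)
      with below [OF 3] show ?thesis by linarith
    qed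
  qed
  have C1f: "C1_on UNIV f"
  proof (rule C1_on_locally)
    fix p
    show "\<exists>W. open W \<and> p \<in> W \<and> C1_on W f"
    proof (cases "fst p < t\<^sub>0 \<or> snd p \<bullet> snd p < a")
      case True
      then obtain W where W: "open W" "p \<in> W" "\<forall>q\<in>W. f q = 0" using zero by blast
      have "C1_on W f" by (rule C1_on_cong [OF W(1) _ C1_on_const [of W 0]]) (use W in auto)
      with W show ?thesis by blast
    next
      case False
      then have "t\<^sub>0 \<le> fst p" "snd p \<noteq> 0" using ab(1) by auto
      then show ?thesis using local [of p] by blast
    qed
  qed
  have supp: "bounded {p. f p \<noteq> 0}"
  proof (rule bounded_subset [OF compact_imp_bounded [OF \<open>compact K\<close>]], clarify)
    fix t x assume nz: "f (t, x) \<noteq> 0"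
    then have t: "t\<^sub>0 < t" "w (t, x) \<noteq> 0" by (auto simp: f_def split: if_splits)
    then have "m (t, x) > 0" "G (t, x) > 0"
      using N(1) by (auto simp: w_def \<alpha>_def \<gamma>_def m_def max_def power_0_left split: if_splits)
    then have "t < T" "G (t, x) > 0" by (auto simp: m_def)
    moreover have "a < x \<bullet> x \<and> x \<bullet> x < b"
      using \<open>G (t, x) > 0\<close> ab(4) by (auto simp: G_def zero_less_mult_iff)
    ultimately show "(t, x) \<in> K" using t by (auto simp: K_def)
  qed
  have "divg f z = 0" by (rule divg_nonneg_imp_eq_0 [OF C1f supp nonneg])
  then have "\<beta> z * \<gamma> z * m z ^ (N - 1) * (norm (deviation P z))\<^sup>2 * (N / 4 - C * (T - t\<^sub>0)) \<le> 0"
    using below [of z] z False by simp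
  moreover have "m z = 1" by (simp add: m_def T_def)
  moreover have "\<beta> z > 0" using z(3) by (simp add: \<beta>_def F_def)
  moreover have "\<gamma> z > 0" using ab by (simp add: \<gamma>_def G_def)
  ultimately have "(norm (deviation P z))\<^sup>2 \<le> 0"
    using pos by (simp add: mult_le_0_iff)
  then show ?thesis by simp
qed

end

section \<open>Causal curves in a time-like hypersurface\<close>

lemma real_continuation:
  fixes G :: "real set"
  assumes "a \<le> b" and G: "closed G" "G \<subseteq> {a..b}" "a \<in> G"
    and step: "\<And>t. t \<in> G \<Longrightarrow> t < b \<Longrightarrow> \<exists>t'\<in>G. t < t'"
  shows "b \<in> G"
proof -
  have bdd: "bdd_above G" using G(2) by (meson bdd_above_Icc bdd_above_mono)
  then have S: "Sup G \<in> G" using G closed_contains_Sup by blast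
  have "\<not> Sup G < b"
  proof
    assume "Sup G < b"
    then obtain t' where "t' \<in> G" "Sup G < t'" using step [OF S] by blast
    then show False using cSup_upper [OF _ bdd] by fastforce
  qed
  moreover have "Sup G \<le> b" using S G(2) by auto
  ultimately show ?thesis using S by simp
qed

lemma real_continuation_down:
  fixes G :: "real set"
  assumes "a \<le> b" and G: "closed G" "G \<subseteq> {a..b}" "b \<in> G"
    and step: "\<And>t. t \<in> G \<Longrightarrow> a < t \<Longrightarrow> \<exists>t'\<in>G. t' < t"
  shows "a \<in> G"
proof -
  have "- a \<in> uminus ` G"
  proof (rule real_continuation [where a = "- b" and b = "- a"])
    show "closed (uminus ` G)" using G(1) by (rule closed_negations)
    fix t assume "t \<in> uminus ` G" "t < - a"
    then have "- t \<in> G" "a < - t" by auto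
    then obtain t' where "t' \<in> G" "t' < - t" using step by blast
    then show "\<exists>t'\<in>uminus ` G. t < t'" by (intro bexI [of _ "- t'"]) auto
  qed (use assms in \<open>auto simp: image_iff\<close>)
  then show ?thesis by auto
qed

context timelike_hypersurface begin

lemma \<phi>_eq: "\<omega> \<in> sphere 0 1 \<Longrightarrow> \<phi> t \<omega> = snd (\<Phi> (t, \<omega>))"
  by (simp add: param_def sgn_div_norm)

lemma snd_\<Phi>: "snd (\<Phi> p) = \<phi> (fst p) (sgn (snd p))"
  by (simp add: param_def case_prod_beta)

lemma continuous_\<phi>: "continuous_on (sphere 0 1 \<times> {t\<^sub>0..}) (\<lambda>p. \<phi> (snd p) (fst p))"
proof -
  have "continuous_on (sphere 0 1 \<times> {t\<^sub>0..}) (\<lambda>p. snd (\<Phi> (snd p, fst p)))"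
    by (intro continuous_on_snd continuous_on_compose2 [OF C1_on_imp_continuous_on [OF C1_\<Phi>]]
        continuous_intros) (auto intro!: in_dom)
  then show ?thesis
    by (rule continuous_on_eq) (auto simp: \<phi>_eq)
qed

text \<open>The parameter curves need not be time-like, but some direction in the tangent space is; a curve
  in that direction moves more slowly than light for a short time.\<close>

lemma local_causal_curve:
  assumes t: "t\<^sub>0 \<le> t" and \<omega>: "\<omega> \<in> sphere 0 1"
  shows "\<exists>\<delta>>0. \<forall>r. \<bar>r\<bar> < \<delta> \<longrightarrow> (\<exists>\<omega>'\<in>sphere 0 1. norm (\<phi> (t + r) \<omega>' - \<phi> t \<omega>) \<le> \<bar>r\<bar>)"
proof -
  let ?p = "(t, \<omega>)"
  have p: "t\<^sub>0 \<le> fst ?p" "snd ?p \<noteq> 0" using assms by auto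
  have pd: "?p \<in> dom" by (rule in_dom [OF p])
  obtain w where w: "timelike (D ?p w)" using dim_range_D(2) [OF p] by blast
  then have ws: "(norm (snd (D ?p w)))\<^sup>2 < (fst w)\<^sup>2"
    by (simp add: timelike_def mink_self fst_D [OF pd])
  then have nz: "fst w \<noteq> 0" by auto
  define v where "v = w /\<^sub>R fst w"
  define u where "u = snd (D ?p v)"
  have "norm u = norm (snd (D ?p w)) / \<bar>fst w\<bar>"
    by (simp add: u_def v_def linear_cmul [OF linear_D [OF pd]] divide_inverse mult.commute)
  moreover have "norm (snd (D ?p w)) < \<bar>fst w\<bar>"
    using ws abs_le_square_iff [of "fst w" "norm (snd (D ?p w))"] by (simp add: not_le [symmetric])
  ultimately have u1: "norm u < 1" using nz by simp
  have fv: "fst v = 1" using nz by (simp add: v_def)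
  define g where "g r = snd (\<Phi> (?p + r *\<^sub>R v))" for r
  have "((\<lambda>r. ?p + r *\<^sub>R v) has_derivative (\<lambda>r. r *\<^sub>R v)) (at (0::real))"
    by (auto intro!: derivative_eq_intros)
  moreover have "(\<Phi> has_derivative D ?p) (at (?p + 0 *\<^sub>R v))"
    using C1_on_has_derivative [OF C1_\<Phi> pd] by (simp flip: zero_prod_def)
  ultimately have "((\<lambda>r. \<Phi> (?p + r *\<^sub>R v)) has_derivative (\<lambda>r. D ?p (r *\<^sub>R v))) (at (0::real))"
    by (rule has_derivative_compose)
  then have "(g has_derivative (\<lambda>r. snd (D ?p (r *\<^sub>R v)))) (at 0)"
    unfolding g_def by (rule bounded_linear.has_derivative [OF bounded_linear_snd])
  then have "(g has_derivative (\<lambda>r. r *\<^sub>R u)) (at 0)"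
    by (simp add: linear_cmul [OF linear_D [OF pd]] u_def)
  then have "\<forall>\<^sub>F r in at 0. norm (g r - g 0 - (r - 0) *\<^sub>R u) \<le> (1 - norm u) * norm (r - 0)"
    unfolding has_derivative_within_alt2 using u1 by auto
  then obtain d where d: "d > 0" "\<And>r. r \<noteq> 0 \<Longrightarrow> \<bar>r\<bar> < d \<Longrightarrow> norm (g r - g 0 - r *\<^sub>R u) \<le> (1 - norm u) * \<bar>r\<bar>"
    unfolding eventually_at by (auto simp: dist_real_def)
  have g0: "g 0 = \<phi> t \<omega>" using \<phi>_eq [OF \<omega>, of t] by (simp add: g_def flip: zero_prod_def)
  have gle: "norm (g r - \<phi> t \<omega>) \<le> \<bar>r\<bar>" if "\<bar>r\<bar> < d" for r
  proof (cases "r = 0")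
    case True then show ?thesis by (simp add: g0)
  next
    case False
    have "norm (g r - g 0) \<le> norm (g r - g 0 - r *\<^sub>R u) + norm (r *\<^sub>R u)"
      using norm_triangle_ineq [of "g r - g 0 - r *\<^sub>R u" "r *\<^sub>R u"] by simp
    also have "\<dots> \<le> (1 - norm u) * \<bar>r\<bar> + \<bar>r\<bar> * norm u"
      using d(2) [OF False that] by simp
    also have "\<dots> = \<bar>r\<bar>" by (simp add: algebra_simps)
    finally show ?thesis by (simp add: g0)
  qed
  define \<delta> where "\<delta> = min d (1 / (norm (snd v) + 1))"
  have "\<delta> > 0" using d(1) by (auto simp: \<delta>_def intro!: divide_pos_pos add_nonneg_pos)
  moreover have "\<exists>\<omega>'\<in>sphere 0 1. norm (\<phi> (t + r) \<omega>' - \<phi> t \<omega>) \<le> \<bar>r\<bar>" if r: "\<bar>r\<bar> < \<delta>" for r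
  proof (intro bexI)
    have "\<bar>r\<bar> * (norm (snd v) + 1) < 1"
      using r by (simp add: \<delta>_def pos_less_divide_eq add_nonneg_pos)
    moreover have "\<bar>r\<bar> * norm (snd v) \<le> \<bar>r\<bar> * (norm (snd v) + 1)" by (intro mult_left_mono) auto
    ultimately have "norm (r *\<^sub>R snd v) < 1" by simp
    moreover have "norm \<omega> = 1" using \<omega> by simp
    ultimately have "\<omega> + r *\<^sub>R snd v \<noteq> 0"
      by (metis add_eq_0_iff less_irrefl norm_minus_cancel)
    then show "sgn (\<omega> + r *\<^sub>R snd v) \<in> sphere 0 1" by (simp add: norm_sgn)
    show "norm (\<phi> (t + r) (sgn (\<omega> + r *\<^sub>R snd v)) - \<phi> t \<omega>) \<le> \<bar>r\<bar>"
      using gle [of r] r by (simp add: g_def snd_\<Phi> fv \<delta>_def)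
  qed
  ultimately show ?thesis by blast
qed

text \<open>Following such curves in either time direction, one reaches every time slice.\<close>

lemma causally_connected:
  assumes s: "t\<^sub>0 \<le> s" and \<omega>: "\<omega> \<in> sphere 0 1" and t: "t\<^sub>0 \<le> t"
  shows "\<exists>\<omega>'\<in>sphere 0 1. norm (\<phi> t \<omega>' - \<phi> s \<omega>) \<le> \<bar>t - s\<bar>"
proof -
  define R where "R = {t. t\<^sub>0 \<le> t \<and> (\<exists>\<omega>'\<in>sphere 0 1. norm (\<phi> t \<omega>' - \<phi> s \<omega>) \<le> \<bar>t - s\<bar>)}"
  let ?h = "\<lambda>p. norm (\<phi> (snd p) (fst p) - \<phi> s \<omega>) - \<bar>snd p - s\<bar>"
  have "continuous_on (sphere 0 1 \<times> {t\<^sub>0..}) ?h"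
    by (intro continuous_intros continuous_\<phi>)
  from continuous_closedin_preimage [OF this closed_atMost [of 0]]
  have "closedin (top_of_set {t\<^sub>0..}) {y. \<exists>x. x \<in> sphere 0 1 \<and> (x, y) \<in> (sphere 0 1 \<times> {t\<^sub>0..}) \<inter> ?h -` {..0}}"
    by (rule closedin_compact_projection [OF compact_sphere])
  also have "{y. \<exists>x. x \<in> sphere 0 1 \<and> (x, y) \<in> (sphere 0 1 \<times> {t\<^sub>0..}) \<inter> ?h -` {..0}} = R"
    by (auto simp: R_def)
  finally have R: "closed R"
    by (rule closedin_closed_trans) simp
  have step: "\<exists>\<delta>>0. \<forall>r'. \<bar>r' - r\<bar> < \<delta> \<and> t\<^sub>0 \<le> r' \<and> \<bar>r' - s\<bar> = \<bar>r - s\<bar> + \<bar>r' - r\<bar> \<longrightarrow> r' \<in> R" if rR: "r \<in> R" for r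
  proof -
    obtain \<omega>' where r: "t\<^sub>0 \<le> r" "\<omega>' \<in> sphere 0 1" "norm (\<phi> r \<omega>' - \<phi> s \<omega>) \<le> \<bar>r - s\<bar>"
      using rR by (auto simp: R_def)
    obtain \<delta> where \<delta>: "\<delta> > 0" "\<And>h. \<bar>h\<bar> < \<delta> \<Longrightarrow> \<exists>\<omega>''\<in>sphere 0 1. norm (\<phi> (r + h) \<omega>'' - \<phi> r \<omega>') \<le> \<bar>h\<bar>"
      using local_causal_curve [OF r(1,2)] by blast
    have "r' \<in> R" if r': "\<bar>r' - r\<bar> < \<delta>" "t\<^sub>0 \<le> r'" "\<bar>r' - s\<bar> = \<bar>r - s\<bar> + \<bar>r' - r\<bar>" for r'
    proof -
      obtain \<omega>'' where \<omega>'': "\<omega>'' \<in> sphere 0 1" "norm (\<phi> r' \<omega>'' - \<phi> r \<omega>') \<le> \<bar>r' - r\<bar>"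
        using \<delta>(2) [OF r'(1)] by auto
      have "norm (\<phi> r' \<omega>'' - \<phi> s \<omega>) \<le> norm (\<phi> r' \<omega>'' - \<phi> r \<omega>') + norm (\<phi> r \<omega>' - \<phi> s \<omega>)"
        using norm_triangle_ineq [of "\<phi> r' \<omega>'' - \<phi> r \<omega>'" "\<phi> r \<omega>' - \<phi> s \<omega>"] by simp
      also have "\<dots> \<le> \<bar>r' - s\<bar>" using \<omega>''(2) r(3) r'(3) by linarith
      finally show ?thesis using \<omega>''(1) r'(2) unfolding R_def by blast
    qed
    then show ?thesis using \<delta>(1) by blast
  qed
  have sR: "s \<in> R" using s \<omega> by (auto simp: R_def)
  have "t \<in> R"
  proof (cases "s \<le> t")
    case True
    have "t \<in> R \<inter> {s..t}"
    proof (rule real_continuation [OF True])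
      fix r assume r: "r \<in> R \<inter> {s..t}" "r < t"
      obtain \<delta> where \<delta>: "\<delta> > 0" "\<And>r'. \<bar>r' - r\<bar> < \<delta> \<and> t\<^sub>0 \<le> r' \<and> \<bar>r' - s\<bar> = \<bar>r - s\<bar> + \<bar>r' - r\<bar> \<Longrightarrow> r' \<in> R"
        using step [of r] r by blast
      define r' where "r' = min t (r + \<delta> / 2)"
      have "r < r'" "r' \<le> t" "r' - r < \<delta>" using r \<delta>(1) by (auto simp: r'_def min_def)
      then show "\<exists>r'\<in>R \<inter> {s..t}. r < r'" using r s by (intro bexI [of _ r']) (auto intro!: \<delta>(2))
    qed (use sR R True in auto)
    then show ?thesis by simp
  next
    case False
    have "t \<in> R \<inter> {t..s}"
    proof (rule real_continuation_down [where a = t and b = s])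
      fix r assume r: "r \<in> R \<inter> {t..s}" "t < r"
      obtain \<delta> where \<delta>: "\<delta> > 0" "\<And>r'. \<bar>r' - r\<bar> < \<delta> \<and> t\<^sub>0 \<le> r' \<and> \<bar>r' - s\<bar> = \<bar>r - s\<bar> + \<bar>r' - r\<bar> \<Longrightarrow> r' \<in> R"
        using step [of r] r by blast
      define r' where "r' = max t (r - \<delta> / 2)"
      have "r' < r" "t \<le> r'" "r - r' < \<delta>" using r \<delta>(1) by (auto simp: r'_def max_def)
      then show "\<exists>r'\<in>R \<inter> {t..s}. r' < r" using r t by (intro bexI [of _ r']) (auto intro!: \<delta>(2))
    qed (use sR R False in auto)
    then show ?thesis by simp
  qed
  then show ?thesis by (auto simp: R_def)
qed

end

section \<open>Uniqueness in the past of a null hyperplane\<close>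

lemma has_derivative_sgn:
  fixes x :: "'a::real_inner"
  assumes "x \<noteq> 0"
  shows "(sgn has_derivative (\<lambda>h. (h - (h \<bullet> sgn x) *\<^sub>R sgn x) /\<^sub>R norm x)) (at x)"
proof -
  have "((\<lambda>x. inverse (norm x)) has_derivative
      (\<lambda>h. - (inverse (norm x) * (h \<bullet> sgn x) * inverse (norm x)))) (at x)"
    by (rule Deriv.has_derivative_inverse [OF _ has_derivative_norm]) (use assms in auto)
  from has_derivative_scaleR [OF this has_derivative_ident]
  have "((\<lambda>x. inverse (norm x) *\<^sub>R x) has_derivative
      (\<lambda>h. inverse (norm x) *\<^sub>R h + - (inverse (norm x) * (h \<bullet> sgn x) * inverse (norm x)) *\<^sub>R x)) (at x)" .
  moreover have "inverse (norm x) *\<^sub>R h + - (inverse (norm x) * (h \<bullet> sgn x) * inverse (norm x)) *\<^sub>R x =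
      (h - (h \<bullet> sgn x) *\<^sub>R sgn x) /\<^sub>R norm x" for h
  proof -
    define \<sigma> where "\<sigma> = sgn x"
    have \<sigma>: "inverse (norm x) *\<^sub>R x = \<sigma>" by (simp add: \<sigma>_def sgn_div_norm)
    have "- (inverse (norm x) * (h \<bullet> \<sigma>) * inverse (norm x)) *\<^sub>R x =
        - (inverse (norm x) * (h \<bullet> \<sigma>)) *\<^sub>R (inverse (norm x) *\<^sub>R x)" by simp
    then show ?thesis
      unfolding \<sigma>_def [symmetric] \<sigma> by (simp add: scaleR_diff_right)
  qed
  moreover have "sgn = (\<lambda>x :: 'a. inverse (norm x) *\<^sub>R x)"
    by (intro ext) (simp add: sgn_div_norm)
  ultimately show ?thesis by simp
qed

text \<open>The open outer ray through a point of a star-shaped sphere misses the sphere and is unbounded.\<close>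

lemma star_shaped_outside:
  fixes X :: "'a::euclidean_space \<Rightarrow> 'a"
  assumes X: "\<And>\<omega>. \<omega> \<in> sphere 0 1 \<Longrightarrow> X \<omega> = \<rho> \<omega> *\<^sub>R \<omega> \<and> \<rho> \<omega> > 0" and \<omega>: "\<omega> \<in> sphere 0 1" and c: "c > 1"
  shows "c *\<^sub>R X \<omega> \<notin> inside (X ` sphere 0 1)"
proof
  assume ins: "c *\<^sub>R X \<omega> \<in> inside (X ` sphere 0 1)"
  define A where "A = (\<lambda>s. s *\<^sub>R X \<omega>) ` {1<..}"
  have disj: "A \<subseteq> - X ` sphere 0 1"
  proof clarify
    fix y \<omega>' assume y: "X \<omega>' \<in> A" "\<omega>' \<in> sphere 0 1"
    then obtain s where s: "s > 1" "X \<omega>' = s *\<^sub>R X \<omega>" by (auto simp: A_def)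
    have sgnX: "sgn (X y) = y" if "y \<in> sphere 0 1" for y
      using X [OF that] that by (simp add: sgn_scaleR) (simp add: sgn_div_norm)
    have "sgn (s *\<^sub>R X \<omega>) = sgn (X \<omega>)" using s(1) by (simp add: sgn_scaleR)
    then have "\<omega>' = \<omega>"
      using sgnX [OF y(2)] sgnX [OF \<omega>] s(2) by metis
    then have "(s - 1) *\<^sub>R X \<omega> = 0" using s(2) by (simp add: scaleR_left_diff_distrib)
    then show False using X [OF \<omega>] s(1) \<omega> by auto
  qed
  have "connected A"
    unfolding A_def by (intro connected_continuous_image continuous_intros connected_Ioi)
  moreover have "c *\<^sub>R X \<omega> \<in> A" using c by (auto simp: A_def)
  ultimately have "A \<subseteq> connected_component_set (- X ` sphere 0 1) (c *\<^sub>R X \<omega>)"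
    using disj by (intro connected_component_maximal)
  moreover have "bounded (connected_component_set (- X ` sphere 0 1) (c *\<^sub>R X \<omega>))"
    using ins by (simp add: inside_def)
  ultimately have "bounded A" by (rule bounded_subset [rotated])
  then obtain b where b: "\<And>x. x \<in> A \<Longrightarrow> norm x \<le> b" by (auto simp: bounded_iff)
  have pos: "norm (X \<omega>) > 0" using X [OF \<omega>] \<omega> by auto
  define s where "s = max 2 (b / norm (X \<omega>) + 1)"
  have "s *\<^sub>R X \<omega> \<in> A" by (auto simp: A_def s_def)
  then have "s * norm (X \<omega>) \<le> b" using b [of "s *\<^sub>R X \<omega>"] by (simp add: s_def)
  moreover have "s * norm (X \<omega>) > b"
  proof -
    have "s > b / norm (X \<omega>)" by (simp add: s_def)
    then show ?thesis using pos by (simp add: pos_divide_less_eq)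
  qed
  ultimately show False by simp
qed

context cmc_hypersurface begin

text \<open>Position and tangent direction determine the normal up to sign, so it is the position vector
  relative to the centre or its negative. The former points outward.\<close>

lemma deviation_eq_0_at_data:
  assumes star: "\<And>\<omega>. \<omega> \<in> sphere 0 1 \<Longrightarrow> \<phi> t\<^sub>0 \<omega> = \<rho> \<omega> *\<^sub>R \<omega> \<and> \<rho> \<omega> > 0"
    and data: "\<And>\<omega>. \<omega> \<in> sphere 0 1 \<Longrightarrow> \<phi> t\<^sub>0 \<omega> \<bullet> e > t\<^sub>0 - \<tau> \<Longrightarrow>
      \<phi> t\<^sub>0 \<omega> = dS_position (t\<^sub>0 - \<tau>) \<omega> \<and> (1, dS_velocity (t\<^sub>0 - \<tau>) \<omega>) \<in> tangent_space \<phi> t\<^sub>0 \<omega>"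
    and x: "x \<noteq> 0" "mink (\<Phi> (t\<^sub>0, x) - (\<tau>, 0)) (1, e) > 0"
  shows "deviation (\<tau>, 0) (t\<^sub>0, x) = 0"
proof -
  let ?p = "(t\<^sub>0, x)" and ?\<omega> = "sgn x"
  define s R where "s = t\<^sub>0 - \<tau>" and "R = sqrt (1 + s\<^sup>2)"
  have R: "R > 0" "R\<^sup>2 = 1 + s\<^sup>2" by (auto simp: R_def add_pos_nonneg)
  have F: "mink (\<Phi> (t\<^sub>0, y) - (\<tau>, 0)) (1, e) = \<phi> t\<^sub>0 (sgn y) \<bullet> e - s" for y
    by (simp add: mink_def param_def s_def)
  have p: "t\<^sub>0 \<le> fst ?p" "snd ?p \<noteq> 0" using x by auto
  have pd: "?p \<in> dom" by (rule in_dom [OF p])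
  have \<omega>: "?\<omega> \<in> sphere 0 1" using x by (simp add: norm_sgn)
  have pos: "\<phi> t\<^sub>0 (sgn y) = R *\<^sub>R sgn y" if "y \<noteq> 0" "mink (\<Phi> (t\<^sub>0, y) - (\<tau>, 0)) (1, e) > 0" for y
    using data [of "sgn y"] that by (simp add: F dS_position_def R_def s_def norm_sgn)
  have pos': "\<phi> t\<^sub>0 ?\<omega> = R *\<^sub>R ?\<omega>" by (rule pos [OF x])
  have vel: "(1, (s / R) *\<^sub>R ?\<omega>) \<in> tangent_space \<phi> t\<^sub>0 ?\<omega>"
    using data [OF \<omega>] x(2) by (simp add: F dS_velocity_def R_def s_def)
  define n where "n = inward ?p"
  have n: "is_normal ?p n" unfolding n_def by (rule is_normal_inward [OF p])
  have un: "mink n n = 1" by (rule is_normal_unit [OF n])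
  \<comment> \<open>near \<open>x\<close> the initial slice is a round sphere, whose tangent vectors are known\<close>
  have Dp: "D ?p (0, h) = (0, R *\<^sub>R ((h - (h \<bullet> ?\<omega>) *\<^sub>R ?\<omega>) /\<^sub>R norm x))" for h
  proof -
    have "((\<lambda>y. (t\<^sub>0, y)) has_derivative (\<lambda>h. (0, h))) (at x)"
      by (auto intro!: derivative_eq_intros)
    from has_derivative_compose [OF this C1_on_has_derivative [OF C1_\<Phi> pd]]
    have 1: "((\<lambda>y. \<Phi> (t\<^sub>0, y)) has_derivative (\<lambda>h. D ?p (0, h))) (at x)" .
    have 2: "((\<lambda>y. (t\<^sub>0, R *\<^sub>R sgn y)) has_derivative (\<lambda>h. (0, R *\<^sub>R ((h - (h \<bullet> ?\<omega>) *\<^sub>R ?\<omega>) /\<^sub>R norm x)))) (at x)"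
      by (intro has_derivative_Pair has_derivative_const has_derivative_scaleR_right has_derivative_sgn x)
    define U where "U = {y \<in> - {0}. mink (\<Phi> (t\<^sub>0, y) - (\<tau>, 0)) (1, e) > 0}"
    have "continuous_on (- {0}) (\<lambda>y. mink (\<Phi> (t\<^sub>0, y) - (\<tau>, 0)) (1, e))"
      by (intro bounded_bilinear.continuous_on [OF bounded_bilinear_mink] continuous_on_diff continuous_on_const
          continuous_on_compose2 [OF C1_on_imp_continuous_on [OF C1_\<Phi>]] continuous_on_Pair continuous_on_id)
        (auto intro!: in_dom)
    from continuous_open_preimage [OF this _ open_greaterThan [of 0]]
    have U: "open U" "x \<in> U" using x by (auto simp: U_def vimage_def Int_def open_Compl)
    have "((\<lambda>y. \<Phi> (t\<^sub>0, y)) has_derivative (\<lambda>h. (0, R *\<^sub>R ((h - (h \<bullet> ?\<omega>) *\<^sub>R ?\<omega>) /\<^sub>R norm x)))) (at x)"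
    proof (rule has_derivative_transform_within_open [OF 2 U])
      fix y assume "y \<in> U"
      then have "\<phi> t\<^sub>0 (sgn y) = R *\<^sub>R sgn y" unfolding U_def by (intro pos) blast+
      then show "(t\<^sub>0, R *\<^sub>R sgn y) = \<Phi> (t\<^sub>0, y)" by (simp add: param_def)
    qed
    from fun_cong [OF has_derivative_unique [OF 1 this], of h] show ?thesis .
  qed
  define b where "b = snd n \<bullet> ?\<omega>"
  have oo: "?\<omega> \<bullet> ?\<omega> = 1" using x by (simp add: norm_sgn flip: norm_eq_1)
  define h where "h = snd n - b *\<^sub>R ?\<omega>"
  have ho: "h \<bullet> ?\<omega> = 0" by (simp add: h_def inner_diff_left b_def oo)
  have "mink (D ?p (0, h)) n = 0" by (rule is_normal_normal [OF p n])
  then have "h \<bullet> snd n = 0" using R(1) x(1) by (simp add: Dp ho mink_def)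
  moreover have "h \<bullet> snd n = h \<bullet> h"
    using ho by (simp add: h_def inner_diff_right)
  ultimately have sn: "snd n = b *\<^sub>R ?\<omega>" by (simp add: h_def)
  have "mink (1, (s / R) *\<^sub>R ?\<omega>) n = 0"
    using n vel by (auto simp: is_normal_def inward_unit_normal_def)
  then have fn: "fst n = b * s / R" by (simp add: mink_def sn oo)
  have "- (b * s / R)\<^sup>2 + b\<^sup>2 = 1"
    using un by (simp add: mink_def fn sn oo power2_eq_square)
  then have "b\<^sup>2 * (R\<^sup>2 - s\<^sup>2) = R\<^sup>2"
    using R(1) by (simp add: field_simps power_mult_distrib power_divide)
  then have "b\<^sup>2 = R\<^sup>2" using R(2) by simp
  then have "b = R \<or> b = - R" by (simp add: power2_eq_iff)
  moreover have "b \<noteq> R"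
  proof
    assume b: "b = R"
    have "\<forall>\<^sub>F \<sigma> in at_right 0. \<phi> t\<^sub>0 ?\<omega> + \<sigma> *\<^sub>R snd n \<in> inside (\<phi> t\<^sub>0 ` sphere 0 1)"
      using n by (simp add: is_normal_def inward_unit_normal_def)
    moreover have "\<forall>\<^sub>F \<sigma> in at_right (0::real). \<sigma> > 0" by (rule eventually_at_right_less)
    ultimately have "\<forall>\<^sub>F \<sigma> in at_right (0::real). False"
    proof eventually_elim
      case (elim \<sigma>)
      have "\<phi> t\<^sub>0 ?\<omega> + \<sigma> *\<^sub>R snd n = (1 + \<sigma>) *\<^sub>R \<phi> t\<^sub>0 ?\<omega>"
        by (simp add: pos' sn b algebra_simps)
      then show False using star_shaped_outside [OF star \<omega>, of "1 + \<sigma>"] elim by simp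
    qed
    then show False by simp
  qed
  ultimately have b: "b = - R" by blast
  then have "n = (- s, - R *\<^sub>R ?\<omega>)" using fn sn R(1) by (simp add: prod_eq_iff)
  then show ?thesis
    by (simp add: deviation_def n_def [symmetric] param_def pos' s_def zero_prod_def)
qed

text \<open>Data which are those of a hyperboloid beyond the null hyperplane with normal \<open>(1, e)\<close> through
  its centre determine the generator of the hyperboloid in the direction \<open>e\<close>: the part of a time
  slice beyond the hyperplane lies on the hyperboloid, so if this part is non-empty then its
  point farthest in the direction \<open>e\<close> is the point of the generator, which stays beyond the hyperplane.\<close>

theorem generator_in_hypersurface:
  assumes H: "H = DIM('a)" and e: "e \<in> sphere 0 1" and \<tau>: "\<tau> < t\<^sub>0"
    and star: "\<And>\<omega>. \<omega> \<in> sphere 0 1 \<Longrightarrow> \<phi> t\<^sub>0 \<omega> = \<rho> \<omega> *\<^sub>R \<omega> \<and> \<rho> \<omega> > 0"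
    and data: "\<And>\<omega>. \<omega> \<in> sphere 0 1 \<Longrightarrow> \<phi> t\<^sub>0 \<omega> \<bullet> e > t\<^sub>0 - \<tau> \<Longrightarrow>
      \<phi> t\<^sub>0 \<omega> = dS_position (t\<^sub>0 - \<tau>) \<omega> \<and> (1, dS_velocity (t\<^sub>0 - \<tau>) \<omega>) \<in> tangent_space \<phi> t\<^sub>0 \<omega>"
    and start: "\<phi> t\<^sub>0 e \<bullet> e > t\<^sub>0 - \<tau>" and t: "t\<^sub>0 \<le> t"
  shows "\<exists>\<omega>\<in>sphere 0 1. \<phi> t \<omega> = dS_position (t - \<tau>) e"
proof -
  have F: "mink (\<Phi> p - (\<tau>, 0)) (1, e) = \<phi> (fst p) (sgn (snd p)) \<bullet> e - (fst p - \<tau>)" for p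
    by (simp add: mink_def param_def case_prod_beta)
  have deviation_0: "deviation (\<tau>, 0) p = 0"
    if "t\<^sub>0 \<le> fst p" "snd p \<noteq> 0" "mink (\<Phi> p - (\<tau>, 0)) (1, e) > 0" for p
  proof (rule deviation_eq_0 [OF H _ _ that])
    show "norm e = 1" using e by simp
    show "deviation (\<tau>, 0) (t\<^sub>0, x) = 0" if "x \<noteq> 0" "mink (\<Phi> (t\<^sub>0, x) - (\<tau>, 0)) (1, e) > 0" for x
      by (rule deviation_eq_0_at_data [OF star data that])
  qed
  have cont: "continuous_on (sphere 0 1) (\<phi> t)" if "t\<^sub>0 \<le> t" for t
    by (rule continuous_on_compose2 [OF continuous_\<phi>, of _ "\<lambda>\<omega>. (\<omega>, t)", simplified])
      (use that in \<open>auto intro!: continuous_intros\<close>)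
  have tip: "\<exists>\<omega>\<in>sphere 0 1. \<phi> t \<omega> = dS_position (t - \<tau>) e"
    if t: "t\<^sub>0 \<le> t" and ex: "\<exists>\<omega>\<in>sphere 0 1. \<phi> t \<omega> \<bullet> e > t - \<tau>" for t
  proof -
    have "\<exists>x\<in>sphere 0 1. \<forall>y\<in>sphere 0 1. \<phi> t y \<bullet> e \<le> \<phi> t x \<bullet> e"
      by (rule continuous_attains_sup) (use e cont [OF t] in \<open>auto intro!: continuous_intros\<close>)
    then obtain x where x: "x \<in> sphere 0 1" "\<And>y. y \<in> sphere 0 1 \<Longrightarrow> \<phi> t y \<bullet> e \<le> \<phi> t x \<bullet> e"
      by blast
    have big: "\<phi> t x \<bullet> e > t - \<tau>" using ex x(2) by force
    let ?p = "(t, x)"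
    have x0: "x \<noteq> 0" and sx: "sgn x = x" using x(1) by (auto simp: sgn_div_norm)
    have p: "t\<^sub>0 \<le> fst ?p" "snd ?p \<noteq> 0" using t x0 by auto
    have pd: "?p \<in> dom" by (rule in_dom [OF p])
    have "deviation (\<tau>, 0) ?p = 0" by (rule deviation_0 [OF p]) (simp add: F sx big)
    then have n: "inward ?p = (\<tau>, 0) - \<Phi> ?p" by (simp add: deviation_def algebra_simps add_eq_0_iff)
    note inward = is_normal_inward [OF p]
    have un: "mink (inward ?p) (inward ?p) = 1" by (rule is_normal_unit [OF inward])
    have norm\<phi>: "(norm (\<phi> t x))\<^sup>2 = 1 + (t - \<tau>)\<^sup>2"
      using un by (simp add: n mink_self param_def sx power2_commute)
    have crit: "snd (D ?p (0, h)) \<bullet> e = 0" for h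
    proof -
      have "((\<lambda>y. (t, y)) has_derivative (\<lambda>h. (0, h))) (at x)"
        by (auto intro!: derivative_eq_intros)
      from has_derivative_compose [OF this C1_on_has_derivative [OF C1_\<Phi> pd]]
      have "((\<lambda>y. snd (\<Phi> (t, y)) \<bullet> e) has_derivative (\<lambda>h. snd (D ?p (0, h)) \<bullet> e)) (at x)"
        by (intro has_derivative_inner_left bounded_linear.has_derivative [OF bounded_linear_snd])
      moreover have "snd (\<Phi> (t, y)) \<bullet> e \<le> snd (\<Phi> (t, x)) \<bullet> e" if "y \<in> - {0}" for y
        using x(2) [of "sgn y"] that by (simp add: param_def sx norm_sgn)
      ultimately have "(\<lambda>h. snd (D ?p (0, h)) \<bullet> e) = (\<lambda>h. 0)"
        using differential_zero_maxmin [of x "- {0}"] x0 by (metis (no_types, lifting) ComplI open_Compl closed_singleton singletonD)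
      then show ?thesis by (rule fun_cong)
    qed
    \<comment> \<open>at the farthest point \<open>(\<mu>, e)\<close> is normal to the hypersurface\<close>
    define \<mu> where "\<mu> = snd (D ?p (1, 0)) \<bullet> e"
    have "mink (D ?p v) (\<mu>, e) = 0" for v
    proof -
      have "D ?p (fst v *\<^sub>R (1, 0) + (0, snd v)) = fst v *\<^sub>R D ?p (1, 0) + D ?p (0, snd v)"
        by (simp only: linear_add [OF linear_D [OF pd]] linear_cmul [OF linear_D [OF pd]])
      moreover have "fst v *\<^sub>R (1, 0) + (0, snd v) = v" by (simp add: prod_eq_iff)
      ultimately have "D ?p v = fst v *\<^sub>R D ?p (1, 0) + D ?p (0, snd v)" by (rule subst [rotated])
      then have "snd (D ?p v) \<bullet> e = fst v * \<mu>"
        by (simp add: inner_add_left crit \<mu>_def)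
      then show ?thesis by (simp add: mink_def fst_D [OF pd])
    qed
    moreover have "inward ?p \<noteq> 0" using un by (auto simp: mink_zero_left)
    moreover have "DIM('a) \<le> dim (range (D ?p))" using dim_range_D(1) [OF p] by simp
    ultimately obtain k where k: "(\<mu>, e) = k *\<^sub>R inward ?p"
      using normal_unique_up_to_scale [OF linear_D [OF pd]] is_normal_normal [OF p inward] by metis
    then have ek: "e = - k *\<^sub>R \<phi> t x" by (simp add: n param_def sx)
    have "k \<noteq> 0" using ek e by auto
    define c where "c = - inverse k"
    have \<phi>c: "\<phi> t x = c *\<^sub>R e" using \<open>k \<noteq> 0\<close> by (simp add: ek c_def)
    have ee: "e \<bullet> e = 1" using e by (simp flip: norm_eq_1)
    have "c > t - \<tau>" using big by (simp add: \<phi>c ee)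
    then have "c > 0" using \<tau> t by simp
    moreover have "c\<^sup>2 = 1 + (t - \<tau>)\<^sup>2" using norm\<phi> e by (simp add: \<phi>c power_mult_distrib)
    ultimately have "c = sqrt (1 + (t - \<tau>)\<^sup>2)" by (simp add: real_sqrt_unique)
    then show ?thesis using x(1) \<phi>c by (auto simp: dS_position_def)
  qed
  define A where "A = {t \<in> {t\<^sub>0..}. \<exists>\<omega>\<in>sphere 0 1. \<phi> t \<omega> = dS_position (t - \<tau>) e}"
  have gt: "dS_position (t - \<tau>) e \<bullet> e > t - \<tau>" for t
  proof -
    have "e \<bullet> e = 1" using e by (simp flip: norm_eq_1)
    moreover have "t - \<tau> < sqrt (1 + (t - \<tau>)\<^sup>2)"
      by (rule real_less_rsqrt) simp
    ultimately show ?thesis by (simp add: dS_position_def)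
  qed
  have A2: "A = (\<Union>\<omega>\<in>sphere 0 1. {t \<in> {t\<^sub>0..}. \<phi> t \<omega> \<bullet> e > t - \<tau>})"
  proof (rule antisym)
    show "A \<subseteq> (\<Union>\<omega>\<in>sphere 0 1. {t \<in> {t\<^sub>0..}. \<phi> t \<omega> \<bullet> e > t - \<tau>})"
    proof
      fix t assume "t \<in> A"
      then obtain \<omega> where "t\<^sub>0 \<le> t" "\<omega> \<in> sphere 0 1" "\<phi> t \<omega> = dS_position (t - \<tau>) e"
        by (auto simp: A_def)
      then show "t \<in> (\<Union>\<omega>\<in>sphere 0 1. {t \<in> {t\<^sub>0..}. \<phi> t \<omega> \<bullet> e > t - \<tau>})"
        using gt [of t] by (intro UN_I [of \<omega>]) simp_all
    qed
    show "(\<Union>\<omega>\<in>sphere 0 1. {t \<in> {t\<^sub>0..}. \<phi> t \<omega> \<bullet> e > t - \<tau>}) \<subseteq> A"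
    proof
      fix t assume "t \<in> (\<Union>\<omega>\<in>sphere 0 1. {t \<in> {t\<^sub>0..}. \<phi> t \<omega> \<bullet> e > t - \<tau>})"
      then show "t \<in> A" using tip [of t] unfolding A_def by blast
    qed
  qed
  have "openin (top_of_set {t\<^sub>0..}) A"
    unfolding A2
  proof (rule openin_Union, clarify)
    fix \<omega> :: 'a assume \<omega>: "\<omega> \<in> sphere 0 1"
    have "continuous_on {t\<^sub>0..} (\<lambda>t. \<phi> t \<omega>)"
      by (rule continuous_on_compose2 [OF continuous_\<phi>, of _ "\<lambda>t. (\<omega>, t)", simplified])
        (use \<omega> in \<open>auto intro!: continuous_intros\<close>)
    then have "continuous_on {t\<^sub>0..} (\<lambda>t. \<phi> t \<omega> \<bullet> e - (t - \<tau>))"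
      by (intro continuous_intros)
    from continuous_openin_preimage_gen [OF this open_greaterThan [of 0]]
    show "openin (top_of_set {t\<^sub>0..}) {t \<in> {t\<^sub>0..}. \<phi> t \<omega> \<bullet> e > t - \<tau>}"
      by (simp add: vimage_def Int_def)
  qed
  moreover have "closedin (top_of_set {t\<^sub>0..}) A"
  proof -
    let ?h = "\<lambda>p. \<phi> (snd p) (fst p) - dS_position (snd p - \<tau>) e"
    have "continuous_on (sphere 0 1 \<times> {t\<^sub>0..}) ?h"
      unfolding dS_position_def by (intro continuous_intros continuous_\<phi>)
    from continuous_closedin_preimage [OF this closed_singleton [of 0]]
    have "closedin (top_of_set {t\<^sub>0..}) {y. \<exists>x. x \<in> sphere 0 1 \<and> (x, y) \<in> (sphere 0 1 \<times> {t\<^sub>0..}) \<inter> ?h -` {0}}"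
      by (rule closedin_compact_projection [OF compact_sphere])
    also have "{y. \<exists>x. x \<in> sphere 0 1 \<and> (x, y) \<in> (sphere 0 1 \<times> {t\<^sub>0..}) \<inter> ?h -` {0}} = A"
      by (auto simp: A_def)
    finally show ?thesis .
  qed
  moreover have "t\<^sub>0 \<in> A" using start e by (auto simp: A2)
  moreover have "connected {t\<^sub>0..}" by (rule connected_Ici)
  ultimately have "A = {t\<^sub>0..}" unfolding connected_clopen by blast
  then have "t \<in> A" using t by simp
  then show ?thesis by (simp add: A_def)
qed

end

section \<open>Distance from a light cone\<close>

lemma mono_tendsto_SUP_ereal:
  fixes f :: "real \<Rightarrow> ereal"
  assumes "\<And>s t. a \<le> s \<Longrightarrow> s \<le> t \<Longrightarrow> f s \<le> f t"
  shows "(f \<longlongrightarrow> (SUP t\<in>{a..}. f t)) at_top"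
proof (rule increasing_tendsto)
  show "\<forall>\<^sub>F t in at_top. f t \<le> (SUP t\<in>{a..}. f t)"
    using eventually_ge_at_top [of a] by eventually_elim (auto intro: SUP_upper)
  fix x assume "x < (SUP t\<in>{a..}. f t)"
  then obtain s where s: "a \<le> s" "x < f s" by (auto simp: less_SUP_iff)
  show "\<forall>\<^sub>F t in at_top. x < f t"
    using eventually_ge_at_top [of s]
    by eventually_elim (use s assms less_le_trans in blast)
qed

lemma antimono_tendsto_INF_ereal:
  fixes f :: "real \<Rightarrow> ereal"
  assumes "\<And>s t. a \<le> s \<Longrightarrow> s \<le> t \<Longrightarrow> f t \<le> f s"
  shows "(f \<longlongrightarrow> (INF t\<in>{a..}. f t)) at_top"
proof (rule decreasing_tendsto)
  show "\<forall>\<^sub>F t in at_top. (INF t\<in>{a..}. f t) \<le> f t"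
    using eventually_ge_at_top [of a] by eventually_elim (auto intro: INF_lower)
  fix x assume "(INF t\<in>{a..}. f t) < x"
  then obtain s where s: "a \<le> s" "f s < x" by (auto simp: INF_less_iff)
  show "\<forall>\<^sub>F t in at_top. f t < x"
    using eventually_ge_at_top [of s]
    by eventually_elim (use s assms le_less_trans in blast)
qed

lemma norm_dS_position_asymptotics:
  assumes e: "e \<in> sphere 0 1"
  shows "((\<lambda>t. norm (dS_position (t - \<sigma>) e - \<xi>) - t) \<longlongrightarrow> - \<sigma> - \<xi> \<bullet> e) at_top"
proof -
  have ee: "e \<bullet> e = 1" using e by (simp flip: norm_eq_1)
  define k c where "k = \<xi> \<bullet> e" and "c = \<xi> \<bullet> \<xi>"
  have "norm (dS_position (t - \<sigma>) e - \<xi>) = sqrt (1 + (t - \<sigma>)\<^sup>2 - 2 * k * sqrt (1 + (t - \<sigma>)\<^sup>2) + c)" for t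
  proof -
    have "e \<bullet> \<xi> = k" by (simp add: k_def inner_commute)
    then have "(R *\<^sub>R e - \<xi>) \<bullet> (R *\<^sub>R e - \<xi>) = R\<^sup>2 - 2 * k * R + c" for R
      by (simp add: inner_diff_left inner_diff_right ee k_def [symmetric] c_def [symmetric] power2_eq_square
          algebra_simps)
    from this [of "sqrt (1 + (t - \<sigma>)\<^sup>2)"] show ?thesis
      unfolding norm_eq_sqrt_inner dS_position_def by (simp add: add_nonneg_nonneg)
  qed
  moreover have "((\<lambda>t. sqrt (1 + (t - \<sigma>)\<^sup>2 - 2 * k * sqrt (1 + (t - \<sigma>)\<^sup>2) + c) - t) \<longlongrightarrow> - \<sigma> - k) at_top"
    by real_asymp
  ultimately show ?thesis by (simp add: k_def)
qed

context timelike_hypersurface begin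

lemma slice: "t\<^sub>0 \<le> t \<Longrightarrow> {x. (t, x) \<in> hypersurface_of t\<^sub>0 \<phi>} = \<phi> t ` sphere 0 1"
  by (auto simp: hypersurface_of_def)

text \<open>Along causal curves of the hypersurface \<open>|x - \<xi>| - t\<close> does not increase, so its supremum
  and infimum over the time slices are monotone.\<close>

lemma cone_distance_converges:
  "\<exists>L. ((\<lambda>t. SUP x\<in>{x. (t, x) \<in> hypersurface_of t\<^sub>0 \<phi>}. ereal \<bar>norm (x - \<xi>) - t + \<tau>\<bar>) \<longlongrightarrow> L) at_top"
proof -
  define r where "r t \<omega> = norm (\<phi> t \<omega> - \<xi>) - t + \<tau>" for t \<omega>
  define A B where "A t = (SUP \<omega>\<in>sphere 0 1. ereal (r t \<omega>))"
    and "B t = (SUP \<omega>\<in>sphere 0 1. ereal (- r t \<omega>))" for t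
  have conn: "\<exists>\<omega>'\<in>sphere 0 1. norm (\<phi> t \<omega>' - \<xi>) \<le> norm (\<phi> s \<omega> - \<xi>) + \<bar>t - s\<bar> \<and>
      norm (\<phi> s \<omega> - \<xi>) \<le> norm (\<phi> t \<omega>' - \<xi>) + \<bar>t - s\<bar>"
    if st: "t\<^sub>0 \<le> s" "\<omega> \<in> sphere 0 1" "t\<^sub>0 \<le> t" for s t \<omega>
  proof -
    obtain \<omega>' where \<omega>': "\<omega>' \<in> sphere 0 1" "norm (\<phi> t \<omega>' - \<phi> s \<omega>) \<le> \<bar>t - s\<bar>"
      using causally_connected [OF st] by blast
    moreover have "norm (\<phi> t \<omega>' - \<xi>) \<le> norm (\<phi> s \<omega> - \<xi>) + norm (\<phi> t \<omega>' - \<phi> s \<omega>)"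
      using norm_triangle_ineq [of "\<phi> s \<omega> - \<xi>" "\<phi> t \<omega>' - \<phi> s \<omega>"] by simp
    moreover have "norm (\<phi> s \<omega> - \<xi>) \<le> norm (\<phi> t \<omega>' - \<xi>) + norm (\<phi> t \<omega>' - \<phi> s \<omega>)"
      using norm_triangle_ineq4 [of "\<phi> t \<omega>' - \<xi>" "\<phi> t \<omega>' - \<phi> s \<omega>"] by simp
    ultimately show ?thesis by (intro bexI [of _ \<omega>']) auto
  qed
  have A: "(A \<longlongrightarrow> (INF t\<in>{t\<^sub>0..}. A t)) at_top"
  proof (rule antimono_tendsto_INF_ereal)
    fix s t assume st: "t\<^sub>0 \<le> s" "s \<le> t"
    show "A t \<le> A s"
      unfolding A_def
    proof (rule SUP_mono)
      fix \<omega> :: 'a assume "\<omega> \<in> sphere 0 1"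
      then obtain \<omega>' where "\<omega>' \<in> sphere 0 1" "norm (\<phi> t \<omega> - \<xi>) \<le> norm (\<phi> s \<omega>' - \<xi>) + \<bar>s - t\<bar>"
        using conn [of t \<omega> s] st by auto
      then show "\<exists>\<omega>'\<in>sphere 0 1. ereal (r t \<omega>) \<le> ereal (r s \<omega>')"
        using st by (intro bexI [of _ \<omega>']) (auto simp: r_def)
    qed
  qed
  have B: "(B \<longlongrightarrow> (SUP t\<in>{t\<^sub>0..}. B t)) at_top"
  proof (rule mono_tendsto_SUP_ereal)
    fix s t assume st: "t\<^sub>0 \<le> s" "s \<le> t"
    show "B s \<le> B t"
      unfolding B_def
    proof (rule SUP_mono)
      fix \<omega> :: 'a assume "\<omega> \<in> sphere 0 1"
      then obtain \<omega>' where "\<omega>' \<in> sphere 0 1" "norm (\<phi> t \<omega>' - \<xi>) \<le> norm (\<phi> s \<omega> - \<xi>) + \<bar>t - s\<bar>"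
        using conn [of s \<omega> t] st by auto
      then show "\<exists>\<omega>'\<in>sphere 0 1. ereal (- r s \<omega>) \<le> ereal (- r t \<omega>')"
        using st by (intro bexI [of _ \<omega>']) (auto simp: r_def)
    qed
  qed
  have "((\<lambda>t. max (A t) (B t)) \<longlongrightarrow> max (INF t\<in>{t\<^sub>0..}. A t) (SUP t\<in>{t\<^sub>0..}. B t)) at_top"
    by (rule tendsto_max [OF A B])
  moreover have "\<forall>\<^sub>F t in at_top. max (A t) (B t) =
      (SUP x\<in>{x. (t, x) \<in> hypersurface_of t\<^sub>0 \<phi>}. ereal \<bar>norm (x - \<xi>) - t + \<tau>\<bar>)"
    using eventually_ge_at_top [of t\<^sub>0]
  proof eventually_elim
    case (elim t)
    have "(SUP x\<in>{x. (t, x) \<in> hypersurface_of t\<^sub>0 \<phi>}. ereal \<bar>norm (x - \<xi>) - t + \<tau>\<bar>) =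
        (SUP \<omega>\<in>sphere 0 1. ereal \<bar>r t \<omega>\<bar>)"
      unfolding slice [OF elim] by (simp add: image_image r_def)
    also have "\<dots> = (SUP \<omega>\<in>sphere 0 1. sup (ereal (r t \<omega>)) (ereal (- r t \<omega>)))"
      by (intro SUP_cong refl) (auto simp: sup_max max_def)
    also have "\<dots> = max (A t) (B t)"
      unfolding A_def B_def sup_max [symmetric] by (rule complete_lattice_class.SUP_sup_distrib [symmetric])
    finally show ?case by simp
  qed
  ultimately have "((\<lambda>t. SUP x\<in>{x. (t, x) \<in> hypersurface_of t\<^sub>0 \<phi>}. ereal \<bar>norm (x - \<xi>) - t + \<tau>\<bar>)
      \<longlongrightarrow> max (INF t\<in>{t\<^sub>0..}. A t) (SUP t\<in>{t\<^sub>0..}. B t)) at_top"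
    by (rule Lim_transform_eventually)
  then show ?thesis by blast
qed

text \<open>A generator in direction \<open>e\<close> of the hyperboloid with centre \<open>(\<sigma>, 0)\<close> approaches the light cone with
  apex \<open>(\<tau>, \<xi>)\<close> only under one linear condition on the apex.\<close>

lemma apex_of_asymptotic_cone:
  assumes lim: "((\<lambda>t. SUP x\<in>{x. (t, x) \<in> hypersurface_of t\<^sub>0 \<phi>}. ereal \<bar>norm (x - \<xi>) - t + \<tau>\<bar>) \<longlongrightarrow> L) at_top"
    and L: "\<not> L > 0" and e: "e \<in> sphere 0 1"
    and gen: "\<And>t. t\<^sub>0 \<le> t \<Longrightarrow> \<exists>\<omega>\<in>sphere 0 1. \<phi> t \<omega> = dS_position (t - \<sigma>) e"
  shows "\<xi> \<bullet> e = \<tau> - \<sigma>"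
proof -
  define h where "h t = \<bar>norm (dS_position (t - \<sigma>) e - \<xi>) - t + \<tau>\<bar>" for t
  let ?g = "\<lambda>t. SUP x\<in>{x. (t, x) \<in> hypersurface_of t\<^sub>0 \<phi>}. ereal \<bar>norm (x - \<xi>) - t + \<tau>\<bar>"
  have ev: "\<forall>\<^sub>F t in at_top. ereal (h t) \<le> ?g t"
    using eventually_ge_at_top [of t\<^sub>0]
  proof eventually_elim
    case (elim t)
    then have "dS_position (t - \<sigma>) e \<in> {x. (t, x) \<in> hypersurface_of t\<^sub>0 \<phi>}"
      using gen [OF elim] unfolding slice [OF elim] by (metis image_eqI)
    then show ?case unfolding h_def by (rule SUP_upper)
  qed
  have "((\<lambda>t. \<bar>(norm (dS_position (t - \<sigma>) e - \<xi>) - t) + \<tau>\<bar>) \<longlongrightarrow> \<bar>(- \<sigma> - \<xi> \<bullet> e) + \<tau>\<bar>) at_top"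
    by (intro tendsto_intros norm_dS_position_asymptotics e)
  then have h: "(h \<longlongrightarrow> \<bar>- \<sigma> - \<xi> \<bullet> e + \<tau>\<bar>) at_top" by (simp add: h_def [abs_def])
  then have "((\<lambda>t. ereal (h t)) \<longlongrightarrow> ereal \<bar>- \<sigma> - \<xi> \<bullet> e + \<tau>\<bar>) at_top" by simp
  from tendsto_le [OF _ lim this ev] have "ereal \<bar>- \<sigma> - \<xi> \<bullet> e + \<tau>\<bar> \<le> L" by simp
  also have "L \<le> 0" using L by simp
  finally show ?thesis by simp
qed

end

section \<open>Smooth initial data interpolating between two hyperboloids\<close>

text \<open>Differentiability of order \<open>n\<close>, by recursion on the first derivative taken rather than on the
  last one as in \<open>iter_deriv\<close>: the product and chain rules then pass to higher orders by induction.\<close>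

fun Cn :: "'v::real_normed_vector set \<Rightarrow> nat \<Rightarrow> ('v \<Rightarrow> 'w::real_normed_vector) \<Rightarrow> bool" where
  "Cn S 0 f \<longleftrightarrow> True"
| "Cn S (Suc n) f \<longleftrightarrow> (\<forall>x\<in>S. f differentiable (at x)) \<and> (\<forall>v. Cn S n (\<lambda>x. frechet_derivative f (at x) v))"

lemma iter_deriv_snoc: "iter_deriv (vs @ [v]) f = iter_deriv vs (\<lambda>x. frechet_derivative f (at x) v)"
  by (induction vs) auto

lemma Cn_imp_iter_deriv_differentiable:
  "Cn S n f \<Longrightarrow> length vs < n \<Longrightarrow> x \<in> S \<Longrightarrow> iter_deriv vs f differentiable (at x)"
proof (induction vs arbitrary: f n rule: rev_induct)
  case Nil then show ?case by (cases n) auto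
next
  case (snoc v vs)
  then obtain k where "n = Suc k" by (cases n) auto
  with snoc show ?case by (auto simp: iter_deriv_snoc)
qed

lemma smooth_onI: "(\<And>n. Cn S n f) \<Longrightarrow> smooth_on S f"
  unfolding smooth_on_def using Cn_imp_iter_deriv_differentiable lessI by blast

lemma Cn_cong:
  assumes S: "open S" and eq: "\<And>x. x \<in> S \<Longrightarrow> f x = g x" and f: "Cn S n f"
  shows "Cn S n g"
  using eq f
proof (induction n arbitrary: f g)
  case (Suc n)
  have "frechet_derivative f (at x) = frechet_derivative g (at x)" if "x \<in> S" for x
    by (rule frechet_derivative_cong_open [OF S that Suc.prems(1)])
  moreover have "g differentiable (at x)" if x: "x \<in> S" for x
  proof -
    obtain f' where "(f has_derivative f') (at x)"
      using Suc.prems(2) x by (auto simp: differentiable_def)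
    from has_derivative_transform_within_open [OF this S x Suc.prems(1)]
    show ?thesis by (auto simp: differentiable_def)
  qed
  moreover have "Cn S n (\<lambda>x. frechet_derivative f (at x) v)" for v
    using Suc.prems(2) by simp
  ultimately show ?case
    using Suc.IH [of "\<lambda>x. frechet_derivative f (at x) v" "\<lambda>x. frechet_derivative g (at x) v" for v] by simp
qed simp

lemma Cn_SucI:
  assumes S: "open S" and f: "\<And>x. x \<in> S \<Longrightarrow> (f has_derivative f' x) (at x)"
    and f': "\<And>v. Cn S n (\<lambda>x. f' x v)"
  shows "Cn S (Suc n) f"
proof -
  have "Cn S n (\<lambda>x. frechet_derivative f (at x) v)" for v
    by (rule Cn_cong [OF S _ f' [of v]]) (simp add: frechet_derivative_at [OF f, symmetric])
  then show ?thesis using f by (auto simp: differentiable_def)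
qed

lemma Cn_Suc_D: "Cn S (Suc n) f \<Longrightarrow> Cn S n f"
  by (induction n arbitrary: f) auto

lemma Cn_has_derivative:
  "Cn S (Suc n) f \<Longrightarrow> x \<in> S \<Longrightarrow> (f has_derivative frechet_derivative f (at x)) (at x)"
  by (simp add: frechet_derivative_works)

lemma Cn_const: "Cn S n (\<lambda>x. c)"
  by (induction n arbitrary: c) auto

lemma Cn_bounded_linear: "open S \<Longrightarrow> bounded_linear L \<Longrightarrow> Cn S n L"
  by (cases n) (auto intro!: Cn_SucI [where f' = "\<lambda>x. L"] bounded_linear_imp_has_derivative Cn_const
      simp del: Cn.simps(2))

lemma Cn_add:
  assumes S: "open S" shows "Cn S n f \<Longrightarrow> Cn S n g \<Longrightarrow> Cn S n (\<lambda>x. f x + g x)"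
proof (induction n arbitrary: f g)
  case (Suc n)
  show ?case
  proof (rule Cn_SucI [OF S])
    show "((\<lambda>x. f x + g x) has_derivative
        (\<lambda>v. frechet_derivative f (at x) v + frechet_derivative g (at x) v)) (at x)" if "x \<in> S" for x
      by (rule has_derivative_add [OF Cn_has_derivative [OF Suc.prems(1) that]
            Cn_has_derivative [OF Suc.prems(2) that]])
    show "Cn S n (\<lambda>x. frechet_derivative f (at x) v + frechet_derivative g (at x) v)" for v
      using Suc by simp
  qed
qed simp

lemma (in bounded_bilinear) Cn_prod:
  assumes S: "open S" shows "Cn S n f \<Longrightarrow> Cn S n g \<Longrightarrow> Cn S n (\<lambda>x. prod (f x) (g x))"
proof (induction n arbitrary: f g)
  case (Suc n)
  show ?case
  proof (rule Cn_SucI [OF S])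
    show "((\<lambda>x. prod (f x) (g x)) has_derivative (\<lambda>v. prod (f x) (frechet_derivative g (at x) v) +
        prod (frechet_derivative f (at x) v) (g x))) (at x)" if "x \<in> S" for x
      by (rule FDERIV [OF Cn_has_derivative [OF Suc.prems(1) that] Cn_has_derivative [OF Suc.prems(2) that]])
    show "Cn S n (\<lambda>x. prod (f x) (frechet_derivative g (at x) v) + prod (frechet_derivative f (at x) v) (g x))" for v
      using Suc.prems Cn_Suc_D [OF Suc.prems(1)] Cn_Suc_D [OF Suc.prems(2)]
      by (intro Cn_add [OF S] Suc.IH) simp_all
  qed
qed simp

lemmas Cn_scaleR = bounded_bilinear.Cn_prod [OF bounded_bilinear_scaleR]
lemmas Cn_mult = bounded_bilinear.Cn_prod [OF bounded_bilinear_mult]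
lemmas Cn_inner = bounded_bilinear.Cn_prod [OF bounded_bilinear_inner]

lemma Cn_compose_real:
  fixes f :: "'v::real_normed_vector \<Rightarrow> real" and h :: "real \<Rightarrow> real"
  assumes S: "open S" "f ` S \<subseteq> U"
  shows "Cn U n h \<Longrightarrow> Cn S n f \<Longrightarrow> Cn S n (\<lambda>x. h (f x))"
proof (induction n arbitrary: h)
  case (Suc n)
  show ?case
  proof (rule Cn_SucI [OF S(1)])
    fix x assume x: "x \<in> S"
    then have hx: "(h has_derivative frechet_derivative h (at (f x))) (at (f x))"
      using Suc.prems(1) S(2) by (intro Cn_has_derivative) auto
    have *: "((\<lambda>x. h (f x)) has_derivative (\<lambda>v. frechet_derivative h (at (f x)) (frechet_derivative f (at x) v))) (at x)"
      by (rule has_derivative_compose [OF Cn_has_derivative [OF Suc.prems(2) x] hx])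
    have "frechet_derivative h (at (f x)) r = r * frechet_derivative h (at (f x)) 1" for r
      using linear_cmul [OF has_derivative_linear [OF hx], of r 1] by simp
    then show "((\<lambda>x. h (f x)) has_derivative
        (\<lambda>v. frechet_derivative f (at x) v * frechet_derivative h (at (f x)) 1)) (at x)"
      by (intro has_derivative_eq_rhs [OF *] ext)
  next
    fix v
    have "Cn S n (\<lambda>x. frechet_derivative h (at (f x)) 1)"
      by (rule Suc.IH [OF _ Cn_Suc_D [OF Suc.prems(2)]]) (use Suc.prems(1) in simp)
    moreover have "Cn S n (\<lambda>x. frechet_derivative f (at x) v)" using Suc.prems(2) by simp
    ultimately show "Cn S n (\<lambda>x. frechet_derivative f (at x) v * frechet_derivative h (at (f x)) 1)"
      by (intro Cn_mult [OF S(1)])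
  qed
qed simp

lemma Cn_real_SucI:
  fixes h :: "real \<Rightarrow> real"
  assumes "open S" "\<And>s. s \<in> S \<Longrightarrow> (h has_real_derivative h' s) (at s)" "Cn S n h'"
  shows "Cn S (Suc n) h"
  by (rule Cn_SucI [OF assms(1) has_field_derivative_imp_has_derivative [OF assms(2)]])
    (use Cn_mult [OF assms(1,3) Cn_const] in auto)

lemma Cn_inverse: "Cn (- {0}) n (inverse :: real \<Rightarrow> real)"
proof (induction n)
  case (Suc n)
  have op: "open (- {0 :: real})" by (simp add: open_Compl)
  show ?case
  proof (rule Cn_real_SucI [OF op])
    show "(inverse has_real_derivative (-1) * (inverse s * inverse s)) (at s)" if "s \<in> - {0}" for s
      using that DERIV_inverse [of s] by (simp add: power2_eq_square power_Suc numeral_2_eq_2)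
    show "Cn (- {0 :: real}) n (\<lambda>s. (-1) * (inverse s * inverse s))"
      by (intro Cn_mult [OF op] Cn_const Suc)
  qed
qed simp

lemma Cn_sqrt: "Cn {0<..} n sqrt"
proof (induction n)
  case (Suc n)
  have op: "open {0 :: real<..}" by simp
  show ?case
  proof (rule Cn_real_SucI [OF op])
    show "(sqrt has_real_derivative inverse (sqrt s) / 2) (at s)" if "s \<in> {0<..}" for s
      using that DERIV_real_sqrt [of s] by simp
    show "Cn {0<..} n (\<lambda>s. inverse (sqrt s) / 2)"
      unfolding divide_inverse
      by (intro Cn_mult [OF op] Cn_const Cn_compose_real [OF op _ Cn_inverse Suc]) auto
  qed
qed simp

lemma Cn_sgn: "Cn (- {0}) n (sgn :: 'a::euclidean_space \<Rightarrow> 'a)"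
proof -
  have op: "open (- {0 :: 'a})" by (simp add: open_Compl)
  have id: "Cn (- {0}) n (\<lambda>x :: 'a. x)" by (rule Cn_bounded_linear [OF op bounded_linear_ident])
  have "Cn (- {0}) n (\<lambda>x :: 'a. sqrt (x \<bullet> x))"
    by (rule Cn_compose_real [OF op _ Cn_sqrt Cn_inner [OF op id id]]) auto
  then have "Cn (- {0}) n (\<lambda>x :: 'a. inverse (sqrt (x \<bullet> x)))"
    by (rule Cn_compose_real [OF op _ Cn_inverse, rotated]) auto
  from Cn_scaleR [OF op this id] show ?thesis
    by (simp add: sgn_div_norm [abs_def] norm_eq_sqrt_inner)
qed

text \<open>The derivative of a member of this family is a linear combination of two others, so it suffices to
  differentiate once.\<close>

definition flat :: "nat \<Rightarrow> real \<Rightarrow> real" where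
  "flat k s = (if s > 0 then exp (- inverse s) * inverse s ^ k else 0)"

lemma flat_tendsto_0: "(flat k \<longlongrightarrow> 0) (at 0)"
proof -
  have "((\<lambda>s. inverse s ^ k / exp (inverse s)) \<longlongrightarrow> 0) (at_right (0::real))"
    by (rule filterlim_compose [OF tendsto_power_div_exp_0 filterlim_inverse_at_top_right])
  moreover have "\<forall>\<^sub>F s in at_right (0::real). inverse s ^ k / exp (inverse s) = flat k s"
    using eventually_at_right_less [of "0::real"]
    by eventually_elim (simp add: flat_def exp_minus divide_inverse mult.commute)
  ultimately have right: "(flat k \<longlongrightarrow> 0) (at_right 0)"
    by (rule Lim_transform_eventually)
  have "\<forall>\<^sub>F s in at_left (0::real). 0 = flat k s"
    unfolding eventually_at_filter by (rule always_eventually) (simp add: flat_def)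
  then have "(flat k \<longlongrightarrow> 0) (at_left 0)"
    by (rule Lim_transform_eventually [OF tendsto_const])
  with right show ?thesis by (simp add: filterlim_at_split)
qed

lemma flat_derivative: "(flat k has_real_derivative flat (k + 2) s + (- real k) * flat (k + 1) s) (at s)"
proof -
  consider "s > 0" | "s < 0" | "s = 0" by linarith
  then show ?thesis
  proof cases
    case 1
    have "((\<lambda>s. exp (- inverse s) * inverse s ^ k) has_real_derivative flat (k + 2) s + (- real k) * flat (k + 1) s) (at s)"
    proof -
      define y where "y = inverse s"
      have dy: "(inverse has_real_derivative - (y * y)) (at s)"
        using 1 DERIV_inverse [of s] by (simp add: y_def power2_eq_square)
      have "((\<lambda>s. exp (- inverse s)) has_real_derivative exp (- y) * (y * y)) (at s)"
        using DERIV_chain2 [OF DERIV_exp DERIV_minus [OF dy]] by (simp add: y_def)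
      moreover have "((\<lambda>s. inverse s ^ k) has_real_derivative real k * (- (y * y) * y ^ (k - Suc 0))) (at s)"
        using DERIV_power [OF dy, of k] by (simp add: y_def)
      ultimately have "((\<lambda>s. exp (- inverse s) * inverse s ^ k) has_real_derivative
          exp (- y) * (y * y) * y ^ k + real k * (- (y * y) * y ^ (k - Suc 0)) * exp (- y)) (at s)"
        using DERIV_mult by (fastforce simp: y_def)
      moreover have "exp (- y) * (y * y) * y ^ k + real k * (- (y * y) * y ^ (k - Suc 0)) * exp (- y) =
          flat (k + 2) s + (- real k) * flat (k + 1) s"
        using 1 by (cases k) (simp_all add: flat_def y_def [symmetric] algebra_simps)
      ultimately show ?thesis by simp
    qed
    then show ?thesis
      by (rule has_field_derivative_transform_within_open [where S = "{0<..}"]) (use 1 in \<open>auto simp: flat_def\<close>)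
  next
    case 2
    have "(flat k has_real_derivative 0) (at s)"
      by (rule has_field_derivative_transform_within_open [OF DERIV_const, where S = "{..<0}"])
        (use 2 in \<open>auto simp: flat_def\<close>)
    with 2 show ?thesis by (simp add: flat_def)
  next
    case 3
    have eq: "flat (k + 1) = (\<lambda>h. (flat k (0 + h) - flat k 0) / h)"
      by (intro ext) (simp add: flat_def divide_inverse mult_ac)
    have "(flat k has_real_derivative 0) (at 0)"
      unfolding DERIV_def by (rule flat_tendsto_0 [of "k + 1", unfolded eq])
    with 3 show ?thesis by (simp add: flat_def)
  qed
qed

lemma Cn_flat: "Cn UNIV n (flat k)"
proof (induction n arbitrary: k)
  case (Suc n)
  show ?case
    by (rule Cn_real_SucI [OF open_UNIV flat_derivative])
      (intro Cn_add [OF open_UNIV] Cn_mult [OF open_UNIV] Cn_const Suc)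
qed simp

definition smooth_step :: "real \<Rightarrow> real" where
  "smooth_step s = flat 0 s * inverse (flat 0 s + flat 0 (1 - s))"

lemma flat_nonneg: "flat k s \<ge> 0" and flat_pos: "s > 0 \<Longrightarrow> flat k s > 0"
  by (auto simp: flat_def)

lemma step_denominator_pos: "flat 0 s + flat 0 (1 - s) > 0"
proof (cases "s > 0")
  case True then show ?thesis by (intro add_pos_nonneg flat_pos flat_nonneg)
next
  case False then show ?thesis by (intro add_nonneg_pos flat_pos flat_nonneg) simp
qed

lemma Cn_smooth_step: "Cn UNIV n smooth_step"
proof -
  have lin: "Cn UNIV n (\<lambda>s :: real. 1 + (-1) * s)"
    by (intro Cn_add Cn_mult Cn_const open_UNIV Cn_bounded_linear bounded_linear_ident)
  have "Cn UNIV n (\<lambda>s. flat 0 (1 + (-1) * s))"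
    by (rule Cn_compose_real [OF open_UNIV _ Cn_flat lin]) simp
  then have "Cn UNIV n (\<lambda>s. flat 0 s + flat 0 (1 + (-1) * s))"
    by (rule Cn_add [OF open_UNIV Cn_flat])
  then have "Cn UNIV n (\<lambda>s. flat 0 s + flat 0 (1 - s))" by simp
  then have "Cn UNIV n (\<lambda>s. inverse (flat 0 s + flat 0 (1 - s)))"
    by (rule Cn_compose_real [OF open_UNIV _ Cn_inverse, rotated])
      (use step_denominator_pos in \<open>auto simp: less_le\<close>)
  then show ?thesis
    unfolding smooth_step_def [abs_def] by (rule Cn_mult [OF open_UNIV Cn_flat])
qed

lemma smooth_step_0: "s \<le> 0 \<Longrightarrow> smooth_step s = 0"
  and smooth_step_1: "s \<ge> 1 \<Longrightarrow> smooth_step s = 1"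
  and smooth_step_nonneg: "smooth_step s \<ge> 0" and smooth_step_le_1: "smooth_step s \<le> 1"
proof -
  show "smooth_step s = 0" if "s \<le> 0" using that by (simp add: smooth_step_def flat_def)
  show "smooth_step s = 1" if "s \<ge> 1"
    using that flat_pos [of s 0] by (simp add: smooth_step_def flat_def [of 0 "1 - s"])
  show "smooth_step s \<ge> 0"
    unfolding smooth_step_def using step_denominator_pos [of s] flat_nonneg [of 0 s] by simp
  show "smooth_step s \<le> 1"
    unfolding smooth_step_def divide_inverse [symmetric]
    using step_denominator_pos [of s] flat_nonneg [of 0 "1 - s"] by simp
qed

lemma iter_deriv_scaleR:
  assumes S: "open S" "smooth_on S g" and x: "x \<in> S"
  shows "iter_deriv vs (\<lambda>x. c *\<^sub>R g x) x = c *\<^sub>R iter_deriv vs g x"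
  using x
proof (induction vs arbitrary: x)
  case (Cons v vs)
  have "(iter_deriv vs g has_derivative frechet_derivative (iter_deriv vs g) (at x)) (at x)"
    using S(2) Cons.prems by (simp add: smooth_on_def flip: frechet_derivative_works)
  then have "((\<lambda>x. c *\<^sub>R iter_deriv vs g x) has_derivative
      (\<lambda>v. c *\<^sub>R frechet_derivative (iter_deriv vs g) (at x) v)) (at x)"
    by (rule has_derivative_scaleR_right)
  from frechet_derivative_at [OF this]
    frechet_derivative_cong_open [OF S(1) Cons.prems Cons.IH]
  show ?case by (simp add: fun_eq_iff)
qed simp

text \<open>There are only finitely many derivatives to bound, each of them continuous on the compact
  sphere.\<close>

lemma iter_deriv_bounded_on_sphere:
  fixes g :: "'a::euclidean_space \<Rightarrow> 'w::real_normed_vector"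
  assumes g: "smooth_on (- {0}) g"
  shows "\<exists>C>0. \<forall>vs. set vs \<subseteq> Basis \<and> length vs \<le> k \<longrightarrow>
    (\<forall>\<omega>\<in>sphere 0 1. norm (iter_deriv vs g \<omega>) \<le> C)"
proof -
  define \<V> where "\<V> = {vs :: 'a list. set vs \<subseteq> Basis \<and> length vs \<le> k}"
  have fin: "finite \<V>" unfolding \<V>_def by (rule finite_lists_length_le) simp
  have "\<exists>C. \<forall>\<omega>\<in>sphere 0 1. norm (iter_deriv vs g \<omega>) \<le> C" for vs :: "'a list"
  proof -
    have "continuous_on (sphere 0 1) (iter_deriv vs g)"
    proof (intro continuous_at_imp_continuous_on ballI differentiable_imp_continuous_within)
      fix x :: 'a assume "x \<in> sphere 0 1"
      then have "x \<in> - {0}" by auto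
      then show "iter_deriv vs g differentiable (at x)" using g unfolding smooth_on_def by blast
    qed
    then have "bounded (iter_deriv vs g ` sphere 0 1)"
      by (intro compact_imp_bounded compact_continuous_image compact_sphere)
    then show ?thesis by (auto simp: bounded_iff)
  qed
  then obtain C where C: "\<And>vs \<omega>. \<omega> \<in> sphere 0 1 \<Longrightarrow> norm (iter_deriv vs g \<omega>) \<le> C vs"
    by metis
  have "norm (iter_deriv vs g \<omega>) \<le> (\<Sum>vs\<in>\<V>. \<bar>C vs\<bar>) + 1" if "vs \<in> \<V>" "\<omega> \<in> sphere 0 1" for vs \<omega>
  proof -
    have "norm (iter_deriv vs g \<omega>) \<le> \<bar>C vs\<bar>" using C [OF that(2), of vs] by simp
    also have "\<dots> \<le> (\<Sum>vs\<in>\<V>. \<bar>C vs\<bar>)" by (rule member_le_sum) (use that fin in auto)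
    finally show ?thesis by simp
  qed
  moreover have "(\<Sum>vs\<in>\<V>. \<bar>C vs\<bar>) + 1 > 0" by (simp add: add_nonneg_pos sum_nonneg)
  ultimately show ?thesis unfolding \<V>_def by blast
qed

text \<open>The coefficient equals \<open>a\<close> on the half-sphere around \<open>e\<close> and \<open>b\<close> near \<open>- e\<close>.\<close>

definition blend :: "'a::euclidean_space \<Rightarrow> real \<Rightarrow> real \<Rightarrow> real \<Rightarrow> 'a \<Rightarrow> real" where
  "blend e c a b \<omega> = a + (b - a) * smooth_step (- (\<omega> \<bullet> e) / c)"

lemma blend_eq_left: "c > 0 \<Longrightarrow> \<omega> \<bullet> e \<ge> 0 \<Longrightarrow> blend e c a b \<omega> = a"
  by (simp add: blend_def smooth_step_0)

lemma blend_eq_right: "c > 0 \<Longrightarrow> \<omega> \<bullet> e \<le> - c \<Longrightarrow> blend e c a b \<omega> = b"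
proof -
  assume "c > 0" "\<omega> \<bullet> e \<le> - c"
  then have "1 \<le> - (\<omega> \<bullet> e) / c" by (subst pos_le_divide_eq) auto
  from smooth_step_1 [OF this] show ?thesis unfolding blend_def by simp
qed

lemma blend_between:
  assumes "b \<le> a" shows "b \<le> blend e c a b \<omega>" "blend e c a b \<omega> \<le> a"
proof -
  define s where "s = smooth_step (- (\<omega> \<bullet> e) / c)"
  have s: "0 \<le> s" "s \<le> 1" by (simp_all add: s_def smooth_step_nonneg smooth_step_le_1)
  have eq: "blend e c a b \<omega> = a - (a - b) * s" by (simp add: blend_def s_def algebra_simps)
  have "(a - b) * s \<le> (a - b) * 1" using s assms by (intro mult_left_mono) auto
  then show "b \<le> blend e c a b \<omega>" by (simp add: eq)
  have "0 \<le> (a - b) * s" using s assms by simp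
  then show "blend e c a b \<omega> \<le> a" by (simp add: eq)
qed

lemma smooth_blend: "smooth_on (- {0}) (\<lambda>x :: 'a::euclidean_space. blend e c a b (sgn x) *\<^sub>R sgn x)"
proof (rule smooth_onI)
  fix n
  have op: "open (- {0 :: 'a})" by (simp add: open_Compl)
  have "Cn (- {0}) n (\<lambda>x :: 'a. (sgn x \<bullet> e) * (- 1 / c))"
    by (intro Cn_mult [OF op] Cn_inner [OF op] Cn_const Cn_sgn)
  then have "Cn (- {0}) n (\<lambda>x :: 'a. smooth_step ((sgn x \<bullet> e) * (- 1 / c)))"
    by (rule Cn_compose_real [OF op _ Cn_smooth_step, rotated]) simp
  then have "Cn (- {0}) n (\<lambda>x :: 'a. (a + (b - a) * smooth_step ((sgn x \<bullet> e) * (- 1 / c))) *\<^sub>R sgn x)"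
    by (intro Cn_scaleR [OF op] Cn_add [OF op] Cn_mult [OF op] Cn_const Cn_sgn)
  then show "Cn (- {0}) n (\<lambda>x :: 'a. blend e c a b (sgn x) *\<^sub>R sgn x)"
    by (simp add: blend_def)
qed

lemma Ck_close_blend:
  fixes e :: "'a::euclidean_space"
  shows "\<exists>C>0. \<forall>a b \<epsilon>. \<bar>b - a\<bar> * C < \<epsilon> \<longrightarrow>
    Ck_close k \<epsilon> (\<lambda>\<omega>. blend e c a b \<omega> *\<^sub>R \<omega>) (\<lambda>\<omega>. a *\<^sub>R \<omega>)"
proof -
  let ?g = "\<lambda>x :: 'a. blend e c 0 1 (sgn x) *\<^sub>R sgn x"
  have g: "smooth_on (- {0}) ?g" by (rule smooth_blend)
  obtain C where C: "C > 0" "\<And>vs \<omega>. set vs \<subseteq> Basis \<Longrightarrow> length vs \<le> k \<Longrightarrow> \<omega> \<in> sphere 0 1 \<Longrightarrow>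
      norm (iter_deriv vs ?g \<omega>) \<le> C"
    using iter_deriv_bounded_on_sphere [OF g, of k] by blast
  have "Ck_close k \<epsilon> (\<lambda>\<omega>. blend e c a b \<omega> *\<^sub>R \<omega>) (\<lambda>\<omega>. a *\<^sub>R \<omega>)" if "\<bar>b - a\<bar> * C < \<epsilon>" for a b \<epsilon>
    unfolding Ck_close_def
  proof (intro allI impI ballI)
    fix vs :: "'a list" and \<omega> :: 'a assume vs: "set vs \<subseteq> Basis \<and> length vs \<le> k" and \<omega>: "\<omega> \<in> sphere 0 1"
    have "radial_ext (\<lambda>\<omega>. blend e c a b \<omega> *\<^sub>R \<omega> - a *\<^sub>R \<omega>) = (\<lambda>x. (b - a) *\<^sub>R ?g x)"
      by (auto simp: radial_ext_def blend_def scaleR_left_distrib fun_eq_iff)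
    moreover have "iter_deriv vs (\<lambda>x. (b - a) *\<^sub>R ?g x) \<omega> = (b - a) *\<^sub>R iter_deriv vs ?g \<omega>"
      by (rule iter_deriv_scaleR [OF _ g]) (use \<omega> in \<open>auto simp: open_Compl\<close>)
    ultimately have "norm (iter_deriv vs (radial_ext (\<lambda>\<omega>. blend e c a b \<omega> *\<^sub>R \<omega> - a *\<^sub>R \<omega>)) \<omega>) =
        \<bar>b - a\<bar> * norm (iter_deriv vs ?g \<omega>)" by simp
    also have "\<dots> \<le> \<bar>b - a\<bar> * C" using C(2) [of vs \<omega>] vs \<omega> by (intro mult_left_mono) auto
    finally show "norm (iter_deriv vs (radial_ext (\<lambda>\<omega>. blend e c a b \<omega> *\<^sub>R \<omega> - a *\<^sub>R \<omega>)) \<omega>) < \<epsilon>"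
      using that by linarith
  qed
  with C(1) show ?thesis by blast
qed

text \<open>Radial projection recovers the parameter of a star-shaped sphere; so the parametrisation and its
  differential on tangent vectors are injective.\<close>

lemma star_shaped_initial_data:
  fixes \<rho> \<sigma> :: "'a::euclidean_space \<Rightarrow> real"
  assumes smooth: "smooth_on_sphere (\<lambda>\<omega>. \<rho> \<omega> *\<^sub>R \<omega>)" "smooth_on_sphere (\<lambda>\<omega>. \<sigma> \<omega> *\<^sub>R \<omega>)"
    and pos: "\<And>\<omega>. \<rho> \<omega> > 0" and slow: "\<And>\<omega>. \<bar>\<sigma> \<omega>\<bar> < 1"
  shows "initial_data (\<lambda>\<omega>. \<rho> \<omega> *\<^sub>R \<omega>) (\<lambda>\<omega>. \<sigma> \<omega> *\<^sub>R \<omega>)"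
  unfolding initial_data_def
proof (intro conjI ballI smooth)
  have sgn: "sgn (\<rho> \<omega> *\<^sub>R \<omega>) = sgn \<omega>" for \<omega> using pos [of \<omega>] by (simp add: sgn_scaleR)
  show "inj_on (\<lambda>\<omega>. \<rho> \<omega> *\<^sub>R \<omega>) (sphere 0 1)"
  proof (rule inj_onI)
    fix x y :: 'a assume xy: "x \<in> sphere 0 1" "y \<in> sphere 0 1" and eq: "\<rho> x *\<^sub>R x = \<rho> y *\<^sub>R y"
    have "sgn x = sgn y" using sgn [of x] sgn [of y] eq by simp
    with xy show "x = y" by (simp add: sgn_div_norm)
  qed
  fix \<omega> :: 'a assume \<omega>: "\<omega> \<in> sphere 0 1"
  show "timelike (1, \<sigma> \<omega> *\<^sub>R \<omega>)"
    using slow [of \<omega>] \<omega> abs_square_less_1 [of "\<sigma> \<omega>"]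
    by (simp add: timelike_def mink_self power_mult_distrib)
  let ?f = "radial_ext (\<lambda>\<omega>. \<rho> \<omega> *\<^sub>R \<omega>)"
  define L where "L = frechet_derivative ?f (at \<omega>)"
  have n1: "norm \<omega> = 1" and \<omega>0: "\<omega> \<noteq> 0" and s\<omega>: "sgn \<omega> = \<omega>" using \<omega> by (auto simp: sgn_div_norm)
  have "iter_deriv [] ?f differentiable (at \<omega>)"
    using smooth(1) \<omega>0 unfolding smooth_on_sphere_def smooth_on_def by blast
  then have L: "(?f has_derivative L) (at \<omega>)"
    by (simp add: L_def flip: frechet_derivative_works)
  have lin: "linear L" using L by (rule has_derivative_linear)
  have f\<omega>: "?f \<omega> = \<rho> \<omega> *\<^sub>R \<omega>" by (simp add: radial_ext_def s\<omega>)
  have "L \<omega> = 0"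
  proof -
    have "((\<lambda>s. \<omega> + s *\<^sub>R \<omega>) has_derivative (\<lambda>s. s *\<^sub>R \<omega>)) (at (0::real))"
      by (auto intro!: derivative_eq_intros)
    moreover have "(?f has_derivative L) (at (\<omega> + 0 *\<^sub>R \<omega>))" using L by simp
    ultimately have "((\<lambda>s. ?f (\<omega> + s *\<^sub>R \<omega>)) has_derivative (\<lambda>s. L (s *\<^sub>R \<omega>))) (at (0::real))"
      by (rule has_derivative_compose)
    moreover have "((\<lambda>s. ?f (\<omega> + s *\<^sub>R \<omega>)) has_derivative (\<lambda>s. 0)) (at (0::real))"
    proof (rule has_derivative_transform_within_open [OF has_derivative_const])
      show "open {-1<..<1::real}" "0 \<in> {-1<..<1::real}" by auto
      fix s :: real assume "s \<in> {-1<..<1}"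
      then have "sgn ((1 + s) *\<^sub>R \<omega>) = sgn \<omega>" by (simp add: sgn_scaleR)
      then show "?f \<omega> = ?f (\<omega> + s *\<^sub>R \<omega>)" by (simp add: radial_ext_def scaleR_left_distrib)
    qed
    ultimately have "(\<lambda>s. L (s *\<^sub>R \<omega>)) = (\<lambda>s. 0)" by (rule has_derivative_unique)
    from fun_cong [OF this, of 1] show ?thesis by simp
  qed
  \<comment> \<open>\<open>sgn\<close> is a left inverse of the embedding, so the differential is injective on the tangent space\<close>
  have ker: "h = 0" if h: "\<omega> \<bullet> h = 0" "L h = 0" for h
  proof -
    have "(sgn has_derivative (\<lambda>h. (h - (h \<bullet> sgn (?f \<omega>)) *\<^sub>R sgn (?f \<omega>)) /\<^sub>R norm (?f \<omega>))) (at (?f \<omega>))"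
      by (rule has_derivative_sgn) (use pos [of \<omega>] \<omega>0 in \<open>simp add: f\<omega>\<close>)
    from has_derivative_compose [OF L this]
    have "((\<lambda>x. sgn (?f x)) has_derivative
        (\<lambda>h. (L h - (L h \<bullet> sgn (?f \<omega>)) *\<^sub>R sgn (?f \<omega>)) /\<^sub>R norm (?f \<omega>))) (at \<omega>)" .
    moreover have "(\<lambda>x. sgn (?f x)) = sgn"
    proof
      fix x :: 'a
      have "sgn (sgn x) = sgn x" by (cases "x = 0") (simp_all add: sgn_div_norm)
      then show "sgn (?f x) = sgn x" using sgn [of "sgn x"] by (simp add: radial_ext_def)
    qed
    ultimately have "(sgn has_derivative
        (\<lambda>h. (L h - (L h \<bullet> sgn (?f \<omega>)) *\<^sub>R sgn (?f \<omega>)) /\<^sub>R norm (?f \<omega>))) (at \<omega>)" by simp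
    from fun_cong [OF has_derivative_unique [OF has_derivative_sgn [OF \<omega>0] this], of h]
    show ?thesis using h by (simp add: s\<omega> n1 inner_commute)
  qed
  define T where "T = {h. \<omega> \<bullet> h = 0}"
  have T: "subspace T" unfolding T_def by (rule subspace_hyperplane)
  have "inj_on L (span T)"
  proof -
    have "inj_on L T"
    proof (rule inj_onI)
      fix x y assume "x \<in> T" "y \<in> T" "L x = L y"
      then have "\<omega> \<bullet> (x - y) = 0" "L (x - y) = 0"
        by (auto simp: T_def inner_diff_right linear_diff [OF lin])
      then show "x = y" using ker [of "x - y"] by simp
    qed
    then show ?thesis using T by (simp add: span_eq_iff [THEN iffD2])
  qed
  then have "dim (L ` T) = dim T" by (rule dim_image_eq [OF lin])
  also have "dim T = DIM('a) - 1" unfolding T_def by (rule dim_hyperplane [OF \<omega>0])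
  also have "L ` T = range L"
  proof (rule antisym)
    show "range L \<subseteq> L ` T"
    proof clarify
      fix h
      have "L (h - (\<omega> \<bullet> h) *\<^sub>R \<omega>) = L h"
        by (simp add: linear_diff [OF lin] linear_cmul [OF lin] \<open>L \<omega> = 0\<close>)
      moreover have "h - (\<omega> \<bullet> h) *\<^sub>R \<omega> \<in> T"
        using n1 by (simp add: T_def inner_diff_right norm_eq_1)
      ultimately show "L h \<in> L ` T" by (metis image_eqI)
    qed
  qed auto
  finally show "dim (range (frechet_derivative ?f (at \<omega>))) = DIM('a) - 1"
    by (simp add: L_def)
qed

section \<open>Hypersurfaces that are not eventually tangent to a light cone\<close>

lemma orthonormal_pair_exists:
  assumes "DIM('a::euclidean_space) \<ge> 2"
  obtains e f :: "'a::euclidean_space" where "norm e = 1" "norm f = 1" "e \<bullet> f = 0"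
proof -
  obtain B where B: "B \<subseteq> (Basis :: 'a set)" "card B = 2"
    using obtain_subset_with_card_n [OF assms] by metis
  then obtain e f where "B = {e, f}" "e \<noteq> f" by (meson card_2_iff)
  with B have "e \<in> Basis" "f \<in> Basis" "e \<noteq> f" by auto
  then show thesis using that [of e f] by (auto simp: inner_not_same_Basis)
qed

lemma small_perturbation_exists:
  fixes g h :: "real \<Rightarrow> real"
  assumes "isCont g 0" "isCont h 0" "\<delta> > 0" "b > 0"
  obtains \<tau> where "0 < \<tau>" "\<tau> < b" "\<bar>g \<tau> - g 0\<bar> < \<delta>" "\<bar>h \<tau> - h 0\<bar> < \<delta>"
proof -
  have "\<forall>\<^sub>F x in at 0. \<bar>g x - g 0\<bar> < \<delta>" "\<forall>\<^sub>F x in at 0. \<bar>h x - h 0\<bar> < \<delta>"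
    using tendstoD [OF assms(1) [unfolded isCont_def] assms(3)]
      tendstoD [OF assms(2) [unfolded isCont_def] assms(3)] by (simp_all add: dist_real_def)
  then have "\<forall>\<^sub>F x in at 0. \<bar>g x - g 0\<bar> < \<delta> \<and> \<bar>h x - h 0\<bar> < \<delta>"
    by (rule eventually_conj)
  then obtain d where d: "d > 0" "\<And>x. x \<noteq> 0 \<Longrightarrow> \<bar>x\<bar> < d \<Longrightarrow> \<bar>g x - g 0\<bar> < \<delta> \<and> \<bar>h x - h 0\<bar> < \<delta>"
    unfolding eventually_at by (auto simp: dist_real_def)
  show thesis
    using that [of "min d b / 2"] d assms(4) by (auto simp: min_def)
qed

theorem theorem3p6:
  fixes d k m :: nat and t\<^sub>0 \<epsilon> :: real
  assumes "d \<ge> 1" and "DIM('a::euclidean_space) = d + 1"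
    and "t\<^sub>0 > 0"
    and "small_data_global_existence TYPE('a) (real d + 1) k t\<^sub>0"
    and "\<epsilon> > 0"
  shows "\<exists>(M :: (real \<times> 'a) set) X v.
     initial_data X v \<and> close_to_dS m \<epsilon> t\<^sub>0 X v \<and>
     global_cmc_solution (real d + 1) t\<^sub>0 X v M \<and>
     (\<forall>(\<tau>\<^sub>0 :: real) (\<xi>\<^sub>0 :: 'a). \<exists>L>0.
        ((\<lambda>t. SUP x\<in>{x. (t, x) \<in> M}. ereal \<bar>norm (x - \<xi>\<^sub>0) - t + \<tau>\<^sub>0\<bar>) \<longlongrightarrow> L) at_top)"
proof -
  obtain \<epsilon>' where \<epsilon>': "\<epsilon>' > 0" and global: "\<And>X v :: 'a \<Rightarrow> 'a. initial_data X v \<Longrightarrow> close_to_dS k \<epsilon>' t\<^sub>0 X v \<Longrightarrow>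
      \<exists>M. global_cmc_solution (real d + 1) t\<^sub>0 X v M"
    using assms(4) unfolding small_data_global_existence_def by blast
  obtain e f :: 'a where ef: "norm e = 1" "norm f = 1" "e \<bullet> f = 0"
    using orthonormal_pair_exists [where 'a = 'a] assms(1,2) by auto
  have ee: "e \<bullet> e = 1" "f \<bullet> f = 1" "f \<bullet> e = 0"
    using ef by (simp_all add: norm_eq_1 inner_commute)
  define R V where "R t = sqrt (1 + t\<^sup>2)" and "V t = t / sqrt (1 + t\<^sup>2)" for t :: real
  have R_gt: "R t > \<bar>t\<bar>" for t by (simp add: R_def real_less_rsqrt)
  have R_pos: "R t > 0" for t using R_gt [of t] by linarith
  have V_lt: "\<bar>V t\<bar> < 1" for t
    using R_gt [of t] R_pos [of t] by (simp add: V_def R_def [symmetric] abs_of_pos)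
  \<comment> \<open>at time \<open>t\<^sub>0\<close> the null hyperplane through the origin with normal \<open>(1, e)\<close> meets \<open>de_Sitter\<close> in the
    directions \<open>\<omega>\<close> with \<open>\<omega> \<bullet> e = 2 * c\<close>\<close>
  define c where "c = t\<^sub>0 / R t\<^sub>0 / 2"
  have c: "0 < c" "c < 1 / 2"
    using assms(3) R_gt [of t\<^sub>0] R_pos [of t\<^sub>0] by (simp_all add: c_def)
  obtain C1 where C1: "C1 > 0" "\<And>a b \<epsilon>. \<bar>b - a\<bar> * C1 < \<epsilon> \<Longrightarrow>
      Ck_close k \<epsilon> (\<lambda>\<omega>. blend e c a b \<omega> *\<^sub>R \<omega>) (\<lambda>\<omega>. a *\<^sub>R \<omega>)"
    using Ck_close_blend [of k e c] by blast
  obtain C2 where C2: "C2 > 0" "\<And>a b \<epsilon>. \<bar>b - a\<bar> * C2 < \<epsilon> \<Longrightarrow>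
      Ck_close m \<epsilon> (\<lambda>\<omega>. blend e c a b \<omega> *\<^sub>R \<omega>) (\<lambda>\<omega>. a *\<^sub>R \<omega>)"
    using Ck_close_blend [of m e c] by blast
  obtain \<tau> where \<tau>: "0 < \<tau>" "\<tau> < t\<^sub>0 / 2"
    and small: "\<bar>R (t\<^sub>0 - \<tau>) - R t\<^sub>0\<bar> < min (\<epsilon>' / C1) (\<epsilon> / C2)" "\<bar>V (t\<^sub>0 - \<tau>) - V t\<^sub>0\<bar> < min (\<epsilon>' / C1) (\<epsilon> / C2)"
  proof (rule small_perturbation_exists [of "\<lambda>\<tau>. R (t\<^sub>0 - \<tau>)" "\<lambda>\<tau>. V (t\<^sub>0 - \<tau>)" "min (\<epsilon>' / C1) (\<epsilon> / C2)" "t\<^sub>0 / 2"])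
    have "1 + t\<^sub>0\<^sup>2 > 0" by (simp add: add_pos_nonneg)
    then have "1 + t\<^sub>0\<^sup>2 \<noteq> 0" by simp
    then show "isCont (\<lambda>\<tau>. R (t\<^sub>0 - \<tau>)) 0" "isCont (\<lambda>\<tau>. V (t\<^sub>0 - \<tau>)) 0"
      unfolding R_def V_def by (intro continuous_intros; simp)+
  qed (use assms(3,5) \<epsilon>' C1 C2 in auto)
  define \<rho> \<sigma> where "\<rho> = blend e c (R t\<^sub>0) (R (t\<^sub>0 - \<tau>))" and "\<sigma> = blend e c (V t\<^sub>0) (V (t\<^sub>0 - \<tau>))"
  define X v where "X \<omega> = \<rho> \<omega> *\<^sub>R \<omega>" and "v \<omega> = \<sigma> \<omega> *\<^sub>R \<omega>" for \<omega>
  have RR: "R (t\<^sub>0 - \<tau>) \<le> R t\<^sub>0"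
    using \<tau> by (simp add: R_def power_mono)
  have VV: "V (t\<^sub>0 - \<tau>) \<le> V t\<^sub>0"
  proof -
    have "(t\<^sub>0 - \<tau>) * R t\<^sub>0 \<le> t\<^sub>0 * R (t\<^sub>0 - \<tau>)"
    proof (rule power2_le_imp_le)
      have R2: "(R t)\<^sup>2 = 1 + t\<^sup>2" for t by (simp add: R_def add_nonneg_nonneg)
      have "(t\<^sub>0 - \<tau>)\<^sup>2 \<le> t\<^sub>0\<^sup>2" using \<tau> by (intro power_mono) auto
      then show "((t\<^sub>0 - \<tau>) * R t\<^sub>0)\<^sup>2 \<le> (t\<^sub>0 * R (t\<^sub>0 - \<tau>))\<^sup>2"
        unfolding power_mult_distrib R2 distrib_left by (simp add: mult.commute)
      show "0 \<le> t\<^sub>0 * R (t\<^sub>0 - \<tau>)" using assms(3) R_pos [of "t\<^sub>0 - \<tau>"] by simp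
    qed
    then show ?thesis
      using R_pos [of t\<^sub>0] R_pos [of "t\<^sub>0 - \<tau>"] by (simp add: V_def R_def [symmetric] field_simps)
  qed
  have \<rho>: "\<rho> \<omega> > 0" "\<rho> \<omega> \<le> R t\<^sub>0" for \<omega>
    using blend_between [OF RR, of e c \<omega>] R_pos [of "t\<^sub>0 - \<tau>"] by (auto simp: \<rho>_def)
  have \<sigma>: "\<bar>\<sigma> \<omega>\<bar> < 1" for \<omega>
    using blend_between [OF VV, of e c \<omega>] V_lt [of t\<^sub>0] V_lt [of "t\<^sub>0 - \<tau>"] by (auto simp: \<sigma>_def)
  have data: "initial_data X v"
    unfolding X_def v_def
  proof (rule star_shaped_initial_data [OF _ _ \<rho>(1) \<sigma>])
    show "smooth_on_sphere (\<lambda>\<omega>. \<rho> \<omega> *\<^sub>R \<omega>)" "smooth_on_sphere (\<lambda>\<omega>. \<sigma> \<omega> *\<^sub>R \<omega>)"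
      unfolding smooth_on_sphere_def radial_ext_def \<rho>_def \<sigma>_def by (rule smooth_blend)+
  qed
  have dS: "dS_position t = (\<lambda>\<omega>. R t *\<^sub>R \<omega>)" "dS_velocity t = (\<lambda>\<omega>. V t *\<^sub>R \<omega>)" for t
    by (simp_all add: fun_eq_iff dS_position_def dS_velocity_def R_def V_def)
  have "close_to_dS k \<epsilon>' t\<^sub>0 X v"
    unfolding close_to_dS_def dS X_def v_def \<rho>_def \<sigma>_def
    using small C1 by (intro conjI C1(2)) (simp_all add: pos_less_divide_eq)
  then obtain M where M: "global_cmc_solution (real d + 1) t\<^sub>0 X v M"
    using global [OF data] by blast
  have close: "close_to_dS m \<epsilon> t\<^sub>0 X v"
    unfolding close_to_dS_def dS X_def v_def \<rho>_def \<sigma>_def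
    using small C2 by (intro conjI C2(2)) (simp_all add: pos_less_divide_eq)
  obtain \<phi> where emb: "timelike_embedding t\<^sub>0 \<phi>" and M_eq: "M = hypersurface_of t\<^sub>0 \<phi>"
    and cmc: "\<And>t \<omega>. t \<ge> t\<^sub>0 \<Longrightarrow> \<omega> \<in> sphere 0 1 \<Longrightarrow> has_mean_curvature \<phi> t \<omega> (real d + 1)"
    and init: "\<And>\<omega>. \<omega> \<in> sphere 0 1 \<Longrightarrow> \<phi> t\<^sub>0 \<omega> = X \<omega> \<and> (1, v \<omega>) \<in> tangent_space \<phi> t\<^sub>0 \<omega>"
    using M unfolding global_cmc_solution_def by blast
  interpret cmc_hypersurface t\<^sub>0 \<phi> "real d + 1"
    by unfold_locales (use emb cmc in auto)
  have H: "real d + 1 = real DIM('a)" using assms(2) by simp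
  have star: "\<phi> t\<^sub>0 \<omega> = \<rho> \<omega> *\<^sub>R \<omega> \<and> \<rho> \<omega> > 0" if "\<omega> \<in> sphere 0 1" for \<omega>
    using init [OF that] \<rho> by (simp add: X_def)
  have gen0: "\<exists>\<omega>\<in>sphere 0 1. \<phi> t \<omega> = dS_position (t - 0) e'"
    if e': "norm e' = 1" "norm (e' - e) \<le> 2 * c" "e' \<bullet> e \<ge> 0" and t: "t\<^sub>0 \<le> t" for e' t
  proof (rule generator_in_hypersurface [OF H _ _ star _ _ t])
    show "e' \<in> sphere 0 1" "0 < t\<^sub>0" using e' assms(3) by auto
    fix \<omega> :: 'a assume \<omega>: "\<omega> \<in> sphere 0 1" and far: "\<phi> t\<^sub>0 \<omega> \<bullet> e' > t\<^sub>0 - 0"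
    have "t\<^sub>0 < \<rho> \<omega> * (\<omega> \<bullet> e')" using far star [OF \<omega>] by simp
    moreover from this have "\<omega> \<bullet> e' > 0"
      using assms(3) \<rho>(1) [of \<omega>] by (metis less_trans zero_less_mult_pos)
    ultimately have "t\<^sub>0 < R t\<^sub>0 * (\<omega> \<bullet> e')"
      using \<rho>(2) [of \<omega>] by (meson less_le_trans mult_right_mono less_imp_le)
    then have "2 * c < \<omega> \<bullet> e'"
      using R_pos [of t\<^sub>0] by (simp add: c_def pos_divide_less_eq mult.commute)
    moreover have "\<omega> \<bullet> (e' - e) \<le> 2 * c"
      using norm_cauchy_schwarz [of \<omega> "e' - e"] \<omega> e'(2) by simp
    ultimately have "\<omega> \<bullet> e \<ge> 0" by (simp add: inner_diff_right)
    then have "\<rho> \<omega> = R t\<^sub>0" "\<sigma> \<omega> = V t\<^sub>0"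
      by (simp_all add: \<rho>_def \<sigma>_def blend_eq_left [OF c(1)])
    then show "\<phi> t\<^sub>0 \<omega> = dS_position (t\<^sub>0 - 0) \<omega> \<and> (1, dS_velocity (t\<^sub>0 - 0) \<omega>) \<in> tangent_space \<phi> t\<^sub>0 \<omega>"
      using init [OF \<omega>] by (simp add: X_def v_def dS)
  next
    have "\<rho> e' = R t\<^sub>0" using e'(3) by (simp add: \<rho>_def blend_eq_left [OF c(1)])
    then show "t\<^sub>0 - 0 < \<phi> t\<^sub>0 e' \<bullet> e'"
      using star [of e'] e'(1) R_gt [of t\<^sub>0] assms(3) by (simp add: norm_eq_1)
  qed
  have gen1: "\<exists>\<omega>\<in>sphere 0 1. \<phi> t \<omega> = dS_position (t - \<tau>) (- e)" if t: "t\<^sub>0 \<le> t" for t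
  proof (rule generator_in_hypersurface [OF H _ _ star _ _ t])
    show "- e \<in> sphere 0 1" "\<tau> < t\<^sub>0" using ef \<tau> by auto
    fix \<omega> :: 'a assume \<omega>: "\<omega> \<in> sphere 0 1" and far: "\<phi> t\<^sub>0 \<omega> \<bullet> (- e) > t\<^sub>0 - \<tau>"
    have "t\<^sub>0 / 2 < \<rho> \<omega> * (\<omega> \<bullet> (- e))" using far star [OF \<omega>] \<tau> by simp
    moreover from this have "\<omega> \<bullet> (- e) > 0"
      using assms(3) \<rho>(1) [of \<omega>] by (metis less_trans half_gt_zero zero_less_mult_pos)
    ultimately have "t\<^sub>0 / 2 < R t\<^sub>0 * (\<omega> \<bullet> (- e))"
      using \<rho>(2) [of \<omega>] by (meson less_le_trans mult_right_mono less_imp_le)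
    then have "c < \<omega> \<bullet> (- e)"
      using R_pos [of t\<^sub>0] by (simp add: c_def field_simps)
    then have "\<rho> \<omega> = R (t\<^sub>0 - \<tau>)" "\<sigma> \<omega> = V (t\<^sub>0 - \<tau>)"
      by (simp_all add: \<rho>_def \<sigma>_def blend_eq_right [OF c(1)])
    then show "\<phi> t\<^sub>0 \<omega> = dS_position (t\<^sub>0 - \<tau>) \<omega> \<and> (1, dS_velocity (t\<^sub>0 - \<tau>) \<omega>) \<in> tangent_space \<phi> t\<^sub>0 \<omega>"
      using init [OF \<omega>] by (simp add: X_def v_def dS)
  next
    have "\<rho> (- e) = R (t\<^sub>0 - \<tau>)" using c ee by (simp add: \<rho>_def blend_eq_right [OF c(1)])
    then show "t\<^sub>0 - \<tau> < \<phi> t\<^sub>0 (- e) \<bullet> (- e)"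
      using star [of "- e"] ef ee R_gt [of "t\<^sub>0 - \<tau>"] \<tau> by simp
  qed
  have "\<exists>L>0. ((\<lambda>t. SUP x\<in>{x. (t, x) \<in> M}. ereal \<bar>norm (x - \<xi>\<^sub>0) - t + \<tau>\<^sub>0\<bar>) \<longlongrightarrow> L) at_top" for \<tau>\<^sub>0 \<xi>\<^sub>0
  proof -
    obtain L where L: "((\<lambda>t. SUP x\<in>{x. (t, x) \<in> M}. ereal \<bar>norm (x - \<xi>\<^sub>0) - t + \<tau>\<^sub>0\<bar>) \<longlongrightarrow> L) at_top"
      using cone_distance_converges [of \<xi>\<^sub>0 \<tau>\<^sub>0] unfolding M_eq by blast
    have "L > 0"
    proof (rule ccontr)
      assume nL: "\<not> L > 0"
      have dir0: "\<xi>\<^sub>0 \<bullet> e' = \<tau>\<^sub>0" if e': "norm e' = 1" "norm (e' - e) \<le> 2 * c" "e' \<bullet> e \<ge> 0" for e'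
        using apex_of_asymptotic_cone [OF L [unfolded M_eq] nL _ gen0 [OF e']] e' by simp
      have dir1: "\<xi>\<^sub>0 \<bullet> (- e) = \<tau>\<^sub>0 - \<tau>"
        by (rule apex_of_asymptotic_cone [OF L [unfolded M_eq] nL _ gen1]) (use ef in auto)
      \<comment> \<open>directions at angle \<open>arccos a\<close> from \<open>e\<close>, whose distance \<open>sqrt (2 - 2 * a)\<close> from \<open>e\<close> is \<open>2 * c\<close>\<close>
      define a s where "a = 1 - 2 * c\<^sup>2" and "s = sqrt (1 - a\<^sup>2)"
      have c2: "0 < c\<^sup>2" "c\<^sup>2 < 1 / 4"
        using c power_strict_mono [of c "1 / 2" 2] by (auto simp: power2_eq_square)
      then have a: "0 < a" "a < 1" by (auto simp: a_def)
      then have s: "s\<^sup>2 = 1 - a\<^sup>2" by (simp add: s_def abs_square_le_1 power_le_one)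
      have dir: "\<xi>\<^sub>0 \<bullet> (a *\<^sub>R e + r *\<^sub>R f) = \<tau>\<^sub>0" if r: "r\<^sup>2 = s\<^sup>2" for r
      proof (rule dir0)
        let ?e' = "a *\<^sub>R e + r *\<^sub>R f"
        have "?e' \<bullet> ?e' = a\<^sup>2 + r\<^sup>2"
          using ef ee by (simp add: inner_add_left inner_add_right power2_eq_square)
        then show "norm ?e' = 1" using r s by (simp add: norm_eq_1)
        show "0 \<le> ?e' \<bullet> e" using ee a by (simp add: inner_add_left)
        have "(?e' - e) \<bullet> (?e' - e) = (1 - a)\<^sup>2 + r\<^sup>2"
          using ef ee by (simp add: inner_add_left inner_add_right inner_diff_left inner_diff_right
              power2_eq_square algebra_simps)
        also have "\<dots> = (2 * c)\<^sup>2" using r s by (simp add: a_def power2_eq_square algebra_simps)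
        finally have "(norm (?e' - e))\<^sup>2 = (2 * c)\<^sup>2" by (simp only: power2_norm_eq_inner)
        then show "norm (?e' - e) \<le> 2 * c"
          by (rule power2_le_imp_le [OF eq_refl]) (use c in linarith)
      qed
      have "\<xi>\<^sub>0 \<bullet> e = \<tau>\<^sub>0" by (rule dir0) (use ef ee c in auto)
      moreover have "a * (\<xi>\<^sub>0 \<bullet> e) = \<tau>\<^sub>0"
        using dir [of s] dir [of "- s"] by (simp add: inner_add_right inner_diff_right)
      ultimately have "\<tau>\<^sub>0 = 0" using a by (simp add: algebra_simps)
      with \<open>\<xi>\<^sub>0 \<bullet> e = \<tau>\<^sub>0\<close> dir1 \<tau>(1) show False by simp
    qed
    with L show ?thesis by blast
  qed
  with data close M show ?thesis by blast
qed

end
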